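(* Let $n\ge 2$. There exist positive constants $A_n$ and $B_n$, depending only on $n$, such that the following holds. Let $\Omega\subset\mathbb{R}^n$ be a bounded domain with $0\in\Omega$, let $R_\Omega:=\sup_{x\in\Omega}|x|$, let $R\ge R_\Omega$ and let $\beta\ge \frac{2}{n}$. Then for every $c$ with $0<c<A_n$, $$\int_{\Omega} \exp\left(c\left(\frac{|u(x)|}{E_2^{\beta}\left(\frac{|x|}{R}\right)}\right)^{\frac{n}{n-1}}\right)dx\le B_n\,\mathrm{vol}(\Omega)\qquad\text{for all } u\in W^{1,n}_0(\Omega)\text{ with } I_n[u,\Omega,R]\le 1 .$$ In other words, $$\sup_{u\in W^{1,n}_0(\Omega),\ I_n[u,\Omega,R]\le 1}\ \int_{\Omega} \exp\left(c\left(\frac{|u(x)|}{E_2^{\beta}\left(\frac{|x|}{R}\right)}\right)^{\frac{n}{n-1}}\right)dx<+\infty\qquad\text{for } 0<c<A_n .$$ Moreover, for every bounded domain $\Omega\subset\mathbb{R}^n$ with $0\in\Omega$ and every $R\ge R_\Omega$, if $\beta<\frac1n$ then for every $c>0$ $$\sup_{u\in W^{1,n}_0(\Omega),\ I_n[u,\Omega,R]\le 1}\ \int_{\Omega} \exp\left(c\left(\frac{|u(x)|}{E_2^{\beta}\left(\frac{|x|}{R}\right)}\right)^{\frac{n}{n-1}}\right)dx=+\infty .$$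
   Context: For $t\in(0,1]$ define $E_1(t):=\log\left(\frac{e}{t}\right)$ and $E_2(t):=\log(eE_1(t))$; here $E_2^{\beta}(t)$ means $(E_2(t))^{\beta}$, and similarly for $E_1^{n}(t)$. For a bounded domain $\Omega\subset\mathbb{R}^n$ ($n\ge2$), $R_\Omega:=\sup_{x\in\Omega}|x|$, and for $R\ge R_\Omega$ and $u\in W^{1,n}_0(\Omega)$ (the usual Sobolev space) define $$I_n[u,\Omega,R]:=\int_\Omega|\nabla u|^n\,dx-\left(\frac{n-1}{n}\right)^n\int_\Omega\frac{|u|^n}{|x|^nE_1^n\left(\frac{|x|}{R}\right)}\,dx .$$ $\mathrm{vol}(\Omega)$ is the Lebesgue measure of $\Omega$. *)

theory Defs
  imports "HOL-Analysis.Analysis"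
begin

definition domain :: "'a::topological_space set \<Rightarrow> bool" where
  "domain \<Omega> \<longleftrightarrow> open \<Omega> \<and> connected \<Omega> \<and> \<Omega> \<noteq> {}"

definition grad :: "(real^'n \<Rightarrow> real) \<Rightarrow> real^'n \<Rightarrow> real^'n" where
  "grad f x = (\<chi> i. frechet_derivative f (at x) (axis i 1))"

primrec Ck :: "nat \<Rightarrow> (real^'n \<Rightarrow> real) \<Rightarrow> bool" where
  "Ck 0 f \<longleftrightarrow> continuous_on UNIV f"
| "Ck (Suc k) f \<longleftrightarrow> (\<forall>x. f differentiable (at x)) \<and> (\<forall>i. Ck k (\<lambda>x. grad f x $ i))"

definition test_function :: "(real^'n) set \<Rightarrow> (real^'n \<Rightarrow> real) \<Rightarrow> bool" where
  "test_function \<Omega> \<phi> \<longleftrightarrow>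
     (\<forall>k. Ck k \<phi>) \<and> (\<exists>K. compact K \<and> K \<subseteq> \<Omega> \<and> (\<forall>x. x \<notin> K \<longrightarrow> \<phi> x = 0))"

(* Functions on \<Omega> are represented by total functions; their values outside \<Omega> play no role. *)

definition Lp :: "nat \<Rightarrow> (real^'n) set \<Rightarrow> (real^'n \<Rightarrow> 'b::euclidean_space) set" where
  "Lp p \<Omega> = {f. f \<in> borel_measurable (lebesgue_on \<Omega>) \<and>
                integrable (lebesgue_on \<Omega>) (\<lambda>x. norm (f x) ^ p)}"

definition locally_integrable :: "(real^'n) set \<Rightarrow> (real^'n \<Rightarrow> 'b::euclidean_space) \<Rightarrow> bool" where
  "locally_integrable \<Omega> f \<longleftrightarrow> (\<forall>K. compact K \<longrightarrow> K \<subseteq> \<Omega> \<longrightarrow> integrable (lebesgue_on K) f)"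

definition has_weak_gradient ::
    "(real^'n) set \<Rightarrow> (real^'n \<Rightarrow> real) \<Rightarrow> (real^'n \<Rightarrow> real^'n) \<Rightarrow> bool" where
  "has_weak_gradient \<Omega> u g \<longleftrightarrow>
     locally_integrable \<Omega> u \<and> locally_integrable \<Omega> g \<and>
     (\<forall>\<phi> i. test_function \<Omega> \<phi> \<longrightarrow>
        (LINT x|lebesgue_on \<Omega>. u x * grad \<phi> x $ i) = - (LINT x|lebesgue_on \<Omega>. g x $ i * \<phi> x))"

(* Weak gradients are unique only up to null sets; this picks one representative.
   The notions below do not depend on the choice. *)
definition weak_grad :: "(real^'n) set \<Rightarrow> (real^'n \<Rightarrow> real) \<Rightarrow> real^'n \<Rightarrow> real^'n" where
  "weak_grad \<Omega> u = (SOME g. has_weak_gradient \<Omega> u g)"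

definition W1 :: "nat \<Rightarrow> (real^'n) set \<Rightarrow> (real^'n \<Rightarrow> real) set" where
  "W1 p \<Omega> = {u \<in> Lp p \<Omega>. \<exists>g. has_weak_gradient \<Omega> u g \<and> g \<in> Lp p \<Omega>}"

(* Closure of the test functions in the Sobolev norm. *)
definition W1_0 :: "nat \<Rightarrow> (real^'n) set \<Rightarrow> (real^'n \<Rightarrow> real) set" where
  "W1_0 p \<Omega> = {u \<in> W1 p \<Omega>. \<exists>\<phi> :: nat \<Rightarrow> real^'n \<Rightarrow> real.
      (\<forall>k. test_function \<Omega> (\<phi> k)) \<and>
      (\<lambda>k. LINT x|lebesgue_on \<Omega>. \<bar>\<phi> k x - u x\<bar> ^ p) \<longlonglongrightarrow> 0 \<and>
      (\<lambda>k. LINT x|lebesgue_on \<Omega>. norm (grad (\<phi> k) x - weak_grad \<Omega> u x) ^ p) \<longlonglongrightarrow> 0}"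

definition E1 :: "real \<Rightarrow> real" where
  "E1 t = ln (exp 1 / t)"

definition E2 :: "real \<Rightarrow> real" where
  "E2 t = ln (exp 1 * E1 t)"

definition R_dom :: "(real^'n) set \<Rightarrow> real" where
  "R_dom \<Omega> = (SUP x\<in>\<Omega>. norm x)"

(* Both integrands are nonnegative, so the integrals are taken in [0, \<infinity>].
   The first one is finite for u in W^{1,n}, so no \<infinity> - \<infinity> arises there. *)
definition I_fun :: "(real^'n \<Rightarrow> real) \<Rightarrow> (real^'n) set \<Rightarrow> real \<Rightarrow> ereal" where
  "I_fun u \<Omega> R =
     enn2ereal (\<integral>\<^sup>+x. ennreal (norm (weak_grad \<Omega> u x) ^ CARD('n)) \<partial>lebesgue_on \<Omega>)
     - ereal (((real CARD('n) - 1) / real CARD('n)) ^ CARD('n))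
       * enn2ereal (\<integral>\<^sup>+x. ennreal (\<bar>u x\<bar> ^ CARD('n)
           / (norm x ^ CARD('n) * E1 (norm x / R) ^ CARD('n))) \<partial>lebesgue_on \<Omega>)"

definition admissible :: "(real^'n) set \<Rightarrow> real \<Rightarrow> (real^'n \<Rightarrow> real) set" where
  "admissible \<Omega> R = {u \<in> W1_0 CARD('n) \<Omega>. I_fun u \<Omega> R \<le> 1}"

definition exp_integral ::
    "real \<Rightarrow> real \<Rightarrow> (real^'n \<Rightarrow> real) \<Rightarrow> (real^'n) set \<Rightarrow> real \<Rightarrow> ennreal" where
  "exp_integral c \<beta> u \<Omega> R =
     (\<integral>\<^sup>+x. ennreal (exp (c * (\<bar>u x\<bar> / E2 (norm x / R) powr \<beta>)
         powr (real CARD('n) / (real CARD('n) - 1)))) \<partial>lebesgue_on \<Omega>)"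

end

theory Submission
  imports Defs
begin

text \<open>Let \<open>k = (n-1)/n\<close>.  For a function \<open>u\<close> put \<open>a = - k u x / (|x|^2 E1)\<close> (\<open>ground_slope\<close> below).  It is
the gradient that \<open>u\<close> would have if it were locally a multiple of the ground state \<open>E1^k\<close> of \<open>I_n\<close>, and \<open>|a|^n\<close> is exactly the integrand that \<open>I_n\<close> subtracts, so that
\<open>I_n[u] = \<integral> (|\<nabla>u|^n - |a|^n)\<close>.  Put \<open>b = \<nabla>u - a\<close>.

For the bound, strict convexity of \<open>|v|^n\<close> gives \<open>|a+b|^n \<ge> |a|^n + n |a|^(n-2) a \<bullet> b + c |b|^n\<close>, together
with a quadratic gain.  The linear term is, up to a constant, the divergence of a radial field with
density \<open>|u|^n\<close>, so its integral vanishes.  Multiplying this field by \<open>1 + \<gamma>/E2\<close> adds the term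
\<open>|a|^n/E2^2\<close> to the divergence, at a price that the quadratic gain pays.  The result is
\<open>I_n[u] \<ge> c \<integral> (|a|^n/E2^2 + |b|^n)\<close> (\<open>leray_inequality_with_remainder\<close>).  Now let
\<open>f = u E2^(-2/n)\<close>.  Then \<open>|\<nabla>f| \<le> |b| + 3 |a| E2^(-2/n)\<close>, and the \<open>n\<close>-th power of the right side is
controlled by the remainder: this is where the exponent \<open>2/n\<close> comes from.  Hence \<open>f\<close> has bounded
\<open>W^{1,n}\<close> energy, and Trudinger's inequality, with a constant proportional to the volume, applies to it
(\<open>trudinger_exponential_bound\<close>).  Its proof bounds \<open>f(x)\<close> by an average of \<open>|\<nabla>f|\<close> over the rays from
\<open>x\<close>.  When this is integrated over a level set of measure \<open>\<delta>^n\<close>, the part of the rays up to length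
\<open>\<delta>\<close> contributes a constant and the rest a power \<open>(n-1)/n\<close> of a logarithm, and so the level sets
decay exponentially.  Finally, test functions approximate \<open>u\<close> almost everywhere along a subsequence,
and Fatou's lemma, used both for the Leray term and for the exponential integral, carries the bound over
to \<open>W_0^{1,n}\<close> (\<open>W1_0_exponential_bound\<close>).  A larger \<open>\<beta>\<close> only decreases the integrand because \<open>E2 \<ge> 1\<close>.

The bound fails for \<open>\<beta> < 1/n\<close> because of the functions \<open>u = \<epsilon> L^(1/n) E1^k \<xi>(ln E1 / L)\<close> with a fixed bump \<open>\<xi>\<close>
supported in \<open>[1,3]\<close> (\<open>trial\<close>).  On the support of \<open>u\<close> \<open>|b|\<close> is smaller than the bound for \<open>|a|\<close> by a factor of
order \<open>1/L\<close>.  Since the linear term integrates to zero, \<open>I_n[u]\<close> is at most a constant times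
\<open>\<epsilon>^n/L \<integral> dx / (E1 |x|^n)\<close> over \<open>E1 \<le> exp (3L)\<close>, hence at most a constant times \<open>\<epsilon>^n\<close>, uniformly in \<open>L\<close>
(\<open>trial_energy_bound\<close>).  On the shell \<open>T \<le> E1 \<le> T + 1\<close> with \<open>T = exp (2L)\<close>, whose volume is of order
\<open>exp (-n T)\<close>, the exponent in the integral is at least \<open>c C L^\<eta> T\<close> for some \<open>\<eta> > 0\<close>, which beats \<open>n T\<close>
as \<open>L \<rightarrow> \<infinity>\<close> (\<open>trial_exp_integral_ge\<close>).  That these smooth \<open>u\<close> are admissible, where \<open>weak_grad\<close> is some
representative of the weak gradient, needs its uniqueness up to null sets (\<open>weak_gradient_unique\<close>).\<close>


section \<open>Inequalities for powers of norms\<close>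

text \<open>As a function of \<open>r\<^sup>2\<close> the power \<open>r^(m+2)\<close> is convex, and the left side is its tangent at \<open>q\<^sup>2\<close>.
  The induction in steps of two multiplies the inequality by \<open>r\<^sup>2\<close>; the error is a square.\<close>

lemma power_above_quadratic_tangent:
  fixes r q :: real
  assumes "0 \<le> r" "0 \<le> q"
  shows "q^(m+2) + real (m+2) / 2 * q^m * (r\<^sup>2 - q\<^sup>2) \<le> r^(m+2)"
proof (induction m rule: induct_nat_012)
  case 0
  show ?case by (simp add: power2_eq_square)
next
  case 1
  \<comment> \<open>the case of exponent \<open>3\<close>, where the defect factors\<close>
  have "r^3 - (q^3 + 3 / 2 * q * (r\<^sup>2 - q\<^sup>2)) = (r - q)\<^sup>2 * (r + q/2)"
    by (simp add: power2_eq_square power3_eq_cube field_simps)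
  also have "\<dots> \<ge> 0" using assms by simp
  finally show ?case by (simp add: numeral_3_eq_3)
next
  case (ge2 m)
  have "r^(m+2) * r\<^sup>2 \<ge> (q^(m+2) + real (m+2) / 2 * q^m * (r\<^sup>2 - q\<^sup>2)) * r\<^sup>2"
    using ge2(1) by (intro mult_right_mono) auto
  moreover have "(q^(m+2) + real (m+2) / 2 * q^m * (r\<^sup>2 - q\<^sup>2)) * r\<^sup>2
      - (q^(m+2) * q\<^sup>2 + real (m+4) / 2 * (q^m * q\<^sup>2) * (r\<^sup>2 - q\<^sup>2))
     = real (m+2) / 2 * q^m * (r\<^sup>2 - q\<^sup>2)\<^sup>2"
    by (simp add: power_add power2_eq_square field_simps)
  moreover have "real (m+2) / 2 * q^m * (r\<^sup>2 - q\<^sup>2)\<^sup>2 \<ge> 0" using assms by simp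
  ultimately have "q^(m+2) * q\<^sup>2 + real (m+4) / 2 * (q^m * q\<^sup>2) * (r\<^sup>2 - q\<^sup>2) \<le> r^(m+2) * r\<^sup>2"
    by linarith
  then show ?case by (simp add: power_add power2_eq_square mult_ac add_ac)
qed

lemma norm_add_power2:
  fixes a b :: "'a::real_inner"
  shows "(norm (a+b))\<^sup>2 = (norm a)\<^sup>2 + 2 * (a \<bullet> b) + (norm b)\<^sup>2"
  by (simp add: power2_norm_eq_inner inner_add inner_commute)

text \<open>The tangent inequality at \<open>q = |a|\<close>, \<open>r = |a+b|\<close>.\<close>

lemma norm_add_power_ge_quadratic:
  fixes a b :: "'a::real_inner"
  assumes "n \<ge> 2"
  shows "norm a ^ n + n * norm a^(n-2) * (a \<bullet> b) + n/2 * norm a^(n-2) * (norm b)\<^sup>2 \<le> norm (a+b) ^ n"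
proof -
  obtain m where n: "n = m+2" using assms by (metis add.commute le_Suc_ex)
  show ?thesis
    using power_above_quadratic_tangent[of "norm (a+b)" "norm a" m]
    unfolding n norm_add_power2 by (simp add: field_simps)
qed

text \<open>If \<open>|b| \<le> M |a|\<close> the quadratic gain dominates \<open>|b|^n\<close>.  Otherwise \<open>|a+b|^n\<close> is almost \<open>|b|^n\<close>, and
  the terms with \<open>a\<close> are small compared with it.\<close>

lemma norm_add_power_ge_power:
  fixes n :: nat assumes "n \<ge> 2"
  obtains c where "c > 0" "\<And>a b :: 'a::real_inner.
     norm a ^ n + n * norm a^(n-2) * (a \<bullet> b) + c * norm b ^ n \<le> norm (a+b) ^ n"
proof -
  \<comment> \<open>\<open>M\<close> is such that \<open>1/M + n/M + 1/2 = 1 - n/M\<close>: the three left-hand terms sum to the right-hand side\<close>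
  define M where "M = 4 * real n + 2"
  have M: "M \<ge> 1" by (simp add: M_def)
  define c where "c = min (1/2) (n / 2 / M^(n-2))"
  have c0: "c > 0" using assms M by (simp add: c_def)
  have "norm a ^ n + n * norm a^(n-2) * (a \<bullet> b) + c * norm b ^ n \<le> norm (a+b) ^ n"
    for a b :: 'a
  proof (cases "norm b \<le> M * norm a")
    case True
    have n: "n = (n-2) + 2" using assms by simp
    have "c * norm b ^ n = c * norm b ^ (n-2) * (norm b)\<^sup>2"
      by (subst n, subst power_add) simp
    also have "\<dots> \<le> (n / 2 / M^(n-2)) * (M * norm a) ^ (n-2) * (norm b)\<^sup>2"
      using True M by (intro mult_right_mono mult_mono power_mono) (auto simp: c_def)
    also have "\<dots> = n/2 * norm a^(n-2) * (norm b)\<^sup>2"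
      using M by (simp add: power_mult_distrib)
    finally show ?thesis using norm_add_power_ge_quadratic[OF assms, of a b] by simp
  next
    case False
    define A where "A = norm a" define B where "B = norm b"
    have AB: "A \<ge> 0" "B > 0" "A \<le> B/M"
    proof -
      have "M * A < B" using False by (simp add: A_def B_def)
      moreover have "M * A \<ge> 0" using M by (simp add: A_def)
      ultimately have "M * A < B" "B > 0" by linarith+
      then show "A \<ge> 0" "B > 0" "A \<le> B/M" using M by (auto simp: A_def field_simps)
    qed
    have BM: "B / M \<ge> 0" "B/M \<le> B" using AB M by (auto simp: field_simps)
    have pw: "(1/M)^n \<le> 1/M" "(1/M)^(n-1) \<le> 1/M"
      using power_decreasing[of 1 n "1/M"] power_decreasing[of 1 "n-1" "1/M"] M assms by auto
    have 1: "A^n \<le> 1/M * B^n"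
    proof -
      have "A^n \<le> (B/M)^n" using AB by (intro power_mono) auto
      also have "\<dots> = (1/M)^n * B^n" by (simp add: power_divide)
      also have "\<dots> \<le> 1/M * B^n" using pw AB by (intro mult_right_mono) auto
      finally show ?thesis .
    qed
    have 2: "n * A^(n-2) * (a \<bullet> b) \<le> n * (1/M * B^n)"
    proof -
      have "n * A^(n-2) * (a \<bullet> b) \<le> n * A^(n-2) * (A * B)"
        using Cauchy_Schwarz_ineq2[of a b] AB by (intro mult_left_mono) (auto simp: A_def B_def)
      also have "\<dots> = n * (A^(n-1) * B)"
        using assms by (auto simp: le_iff_add)
      also have "\<dots> \<le> n * ((B/M)^(n-1) * B)"
        using AB by (intro mult_left_mono mult_right_mono power_mono) auto
      also have "(B/M)^(n-1) * B = (1/M)^(n-1) * B^n"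
        using assms by (auto simp: le_iff_add power_divide)
      also have "n * \<dots> \<le> n * (1/M * B^n)" using pw AB by (intro mult_left_mono mult_right_mono) auto
      finally show ?thesis .
    qed
    \<comment> \<open>Bernoulli's inequality\<close>
    have 3: "norm (a+b)^n \<ge> (1 - n/M) * B^n"
    proof -
      have "norm (a+b) \<ge> B - A" using norm_diff_ineq[of b a] by (simp add: A_def B_def add.commute)
      then have "norm (a+b) \<ge> B * (1 - 1/M)" using AB by (simp add: algebra_simps)
      moreover have "B * (1 - 1/M) \<ge> 0" using AB M by simp
      ultimately have "norm (a+b)^n \<ge> (B * (1 - 1/M))^n" by (rule power_mono)
      moreover have "(1 - 1/M)^n \<ge> 1 - n/M"
        using Bernoulli_inequality[of "-1/M" n] M by simp
      then have "B^n * (1 - 1/M)^n \<ge> B^n * (1 - n/M)" using AB by (intro mult_left_mono) auto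
      ultimately show ?thesis by (simp add: power_mult_distrib mult.commute)
    qed
    have "(1 + 2 * n)/M = 1/2" unfolding M_def by (simp add: field_simps)
    then have "(1/M + n/M + 1/2) * B^n = (1 - n/M) * B^n" by (simp add: add_divide_distrib)
    then have "1/M * B^n + n * (1/M * B^n) + 1/2 * B^n = (1 - n/M) * B^n"
      by (simp add: algebra_simps)
    moreover have "c * B^n \<le> 1/2 * B^n" using AB by (intro mult_right_mono) (auto simp: c_def)
    ultimately have "A^n + n * A^(n-2) * (a \<bullet> b) + c * B^n \<le> (1 - n/M) * B^n"
      using 1 2 by (metis add_mono)
    then show ?thesis using 3 unfolding A_def B_def by (rule order_trans)
  qed
  then show ?thesis by (rule that[OF c0])
qed

text \<open>The mean value estimate \<open>|x^m - y^m| \<le> m |x - y| M^(m-1)\<close>, multiplied by \<open>M\<close> so that it also covers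
  \<open>m = 0\<close>.\<close>

lemma abs_power_diff_le:
  fixes x y :: real
  assumes "0 \<le> x" "x \<le> M" "0 \<le> y" "y \<le> M"
  shows "\<bar>x^m - y^m\<bar> * M \<le> m * \<bar>x-y\<bar> * M^m"
proof (induction m)
  case (Suc m)
  have "x^Suc m - y^Suc m = x * (x^m - y^m) + (x-y) * y^m" by (simp add: algebra_simps)
  then have "\<bar>x^Suc m - y^Suc m\<bar> * M \<le> (\<bar>x\<bar> * \<bar>x^m - y^m\<bar> + \<bar>x-y\<bar> * \<bar>y^m\<bar>) * M"
    using assms abs_triangle_ineq[of "x * (x^m - y^m)" "(x-y) * y^m"]
    by (intro mult_right_mono) (simp_all add: abs_mult)
  also have "\<dots> = x * (\<bar>x^m - y^m\<bar> * M) + \<bar>x-y\<bar> * (y^m * M)"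
    using assms by (simp add: algebra_simps)
  also have "\<dots> \<le> M * (m * \<bar>x-y\<bar> * M^m) + \<bar>x-y\<bar> * (M^m * M)"
  proof -
    have "x * (\<bar>x^m - y^m\<bar> * M) \<le> M * (m * \<bar>x-y\<bar> * M^m)"
      by (rule mult_mono[OF assms(2) Suc]) (use assms in auto)
    moreover have "y^m * M \<le> M^m * M" using assms by (intro mult_right_mono power_mono) auto
    then have "\<bar>x-y\<bar> * (y^m * M) \<le> \<bar>x-y\<bar> * (M^m * M)" by (intro mult_left_mono) auto
    ultimately show ?thesis by (rule add_mono)
  qed
  also have "\<dots> = Suc m * \<bar>x-y\<bar> * M^Suc m" by (simp add: algebra_simps)
  finally show ?case .
qed simp

text \<open>The upper counterpart.  For \<open>|b| \<le> |a|\<close> the tangent inequality is applied with the base point \<open>|a+b|\<close>,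
  which gives the slope \<open>|a+b|^(n-2)\<close>; replacing it by \<open>|a|^(n-2)\<close> costs only a term of second order in \<open>b\<close>.\<close>

lemma norm_add_power_le:
  fixes n :: nat assumes "n \<ge> 2"
  obtains C where "C > 0" "\<And>a b :: 'a::real_inner.
     norm (a+b) ^ n \<le> norm a ^ n + n * norm a^(n-2) * (a \<bullet> b)
        + C * (norm a^(n-2) * (norm b)\<^sup>2 + norm b ^ n)"
proof -
  define C where "C = real n * real (n-2) * 2^(n-2) + real n * 2^(n-2) + (2^n + n)"
  have C0: "C > 0" using assms by (simp add: C_def add_nonneg_pos)
  have "norm (a+b) ^ n \<le> norm a ^ n + n * norm a^(n-2) * (a \<bullet> b)
        + C * (norm a^(n-2) * (norm b)\<^sup>2 + norm b ^ n)" for a b :: 'a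
  proof -
    define A where "A = norm a" define B where "B = norm b"
    define P where "P = norm (a+b)"
    have AB: "A \<ge> 0" "B \<ge> 0" "P \<ge> 0" "P \<le> A + B" "\<bar>P - A\<bar> \<le> B"
      using norm_triangle_ineq[of a b] norm_diff_ineq[of a b]
      by (auto simp: A_def B_def P_def)
    have ab: "\<bar>a \<bullet> b\<bar> \<le> A * B" using Cauchy_Schwarz_ineq2[of a b] by (simp add: A_def B_def)
    show ?thesis
    proof (cases "A \<le> B")
      case True
      have "P^n \<le> (2*B)^n" using AB True by (intro power_mono) auto
      then have 1: "P^n \<le> 2^n * B^n" by (simp add: power_mult_distrib)
      have "n * A^(n-2) * (-(a \<bullet> b)) \<le> n * B^(n-2) * (B * B)"
      proof -
        have "A * B \<le> B * B" using True AB by (intro mult_right_mono) auto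
        then have "- (a \<bullet> b) \<le> B * B" using ab by linarith
        then have "n * A^(n-2) * (-(a \<bullet> b)) \<le> n * A^(n-2) * (B * B)"
          using AB by (intro mult_left_mono) auto
        also have "\<dots> \<le> n * B^(n-2) * (B * B)"
          using AB True by (intro mult_left_mono mult_right_mono power_mono) auto
        finally show ?thesis .
      qed
      also have "\<dots> = n * B^n" using assms by (auto simp: le_iff_add)
      finally have 2: "n * A^(n-2) * (-(a \<bullet> b)) \<le> n * B^n" .
      have "(2^n + n) * B^n \<le> C * B^n" using AB by (intro mult_right_mono) (auto simp: C_def)
      also have "\<dots> \<le> C * (A^(n-2) * B\<^sup>2 + B^n)" using AB C0 by (intro mult_left_mono) auto
      finally have 3: "(2^n + n) * B^n \<le> C * (A^(n-2) * B\<^sup>2 + B^n)" .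
      have "(2^n + n) * B^n = 2^n * B^n + n * B^n" by (simp add: algebra_simps)
      moreover have "n * A^(n-2) * (-(a \<bullet> b)) = - (n * A^(n-2) * (a \<bullet> b))" by simp
      ultimately have "P^n \<le> A^n + n * A^(n-2) * (a \<bullet> b) + C * (A^(n-2) * B\<^sup>2 + B^n)"
        using 1 2 3 AB zero_le_power[of A n] by linarith
      then show ?thesis unfolding A_def B_def P_def .
    next
      case False
      obtain m where n: "n = m+2" using assms by (metis add.commute le_Suc_ex)
      have nm: "n-2 = m" using n by simp
      have p: "P^n + real n / 2 * P^m * (A\<^sup>2 - P\<^sup>2) \<le> A^n"
        using power_above_quadratic_tangent[of A P m] AB n by simp
      have PA: "P\<^sup>2 - A\<^sup>2 = 2 * (a \<bullet> b) + B\<^sup>2" unfolding P_def A_def B_def norm_add_power2 by simp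
      have P2: "P^m \<le> 2^m * A^m"
        using power_mono[of P "2*A" m] AB False by (simp add: power_mult_distrib)
      have d: "\<bar>P^m - A^m\<bar> * \<bar>a \<bullet> b\<bar> \<le> m * 2^m * (A^m * B\<^sup>2)"
      proof -
        have "\<bar>P^m - A^m\<bar> * \<bar>a \<bullet> b\<bar> \<le> \<bar>P^m - A^m\<bar> * (2 * A * B)"
          using ab AB by (intro mult_left_mono) auto
        also have "\<dots> = (\<bar>P^m - A^m\<bar> * (2 * A)) * B" by simp
        also have "\<dots> \<le> (m * \<bar>P - A\<bar> * (2*A)^m) * B"
          using AB False by (intro mult_right_mono abs_power_diff_le) auto
        also have "\<dots> \<le> (m * B * (2*A)^m) * B"
          using AB by (intro mult_right_mono mult_left_mono) auto
        also have "\<dots> = m * 2^m * (A^m * B\<^sup>2)" by (simp add: power_mult_distrib power2_eq_square)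
        finally show ?thesis .
      qed
      have eq: "real n / 2 * P^m * (A\<^sup>2 - P\<^sup>2) = - (real n / 2 * P^m * (P\<^sup>2 - A\<^sup>2))"
      proof -
        have "A\<^sup>2 - P\<^sup>2 = - (P\<^sup>2 - A\<^sup>2)" by simp
        then show ?thesis by (simp only: mult_minus_right)
      qed
      have "P^n \<le> A^n + real n / 2 * P^m * (2 * (a \<bullet> b) + B\<^sup>2)"
        using p unfolding eq PA by (simp only: add_uminus_conv_diff diff_le_eq)
      also have "real n / 2 * P^m * (2 * (a \<bullet> b) + B\<^sup>2) = n * P^m * (a \<bullet> b) + real n / 2 * P^m * B\<^sup>2"
        by (simp add: distrib_left)
      also have "n * P^m * (a \<bullet> b) = n * A^m * (a \<bullet> b) + n * ((P^m - A^m) * (a \<bullet> b))"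
        by (simp add: left_diff_distrib right_diff_distrib)
      also have "A^n + (n * A^m * (a \<bullet> b) + n * ((P^m - A^m) * (a \<bullet> b)) + real n / 2 * P^m * B\<^sup>2)
        = A^n + n * A^m * (a \<bullet> b) + n * ((P^m - A^m) * (a \<bullet> b)) + real n / 2 * P^m * B\<^sup>2"
        by simp
      also have "\<dots> \<le> A^n + n * A^m * (a \<bullet> b) + n * (m * 2^m * (A^m * B\<^sup>2)) + real n * (2^m * A^m) * B\<^sup>2"
      proof -
        have "(P ^ m - A ^ m) * (a \<bullet> b) \<le> m * 2^m * (A^m * B\<^sup>2)"
          using abs_ge_self d unfolding abs_mult[symmetric] by (rule order_trans)
        then have 1: "n * ((P^m - A^m) * (a \<bullet> b)) \<le> n * (m * 2^m * (A^m * B\<^sup>2))"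
          by (intro mult_left_mono) auto
        have "real n / 2 * P^m \<le> real n * P^m" using AB by (intro mult_right_mono) auto
        also have "\<dots> \<le> real n * (2^m * A^m)" using P2 by (intro mult_left_mono) auto
        finally have 2: "real n / 2 * P^m * B\<^sup>2 \<le> real n * (2^m * A^m) * B\<^sup>2"
          by (intro mult_right_mono) auto
        show ?thesis by (intro add_mono order_refl 1 2)
      qed
      also have "\<dots> = A^n + n * A^m * (a \<bullet> b) + (C - (2^n + n)) * (A^m * B\<^sup>2)"
      proof -
        have "C - (2^n + n) = real n * (m * 2^m) + real n * 2^m" unfolding C_def nm by simp
        then have "(C - (2^n + n)) * (A^m * B\<^sup>2)
            = n * (m * 2^m * (A^m * B\<^sup>2)) + real n * (2^m * A^m) * B\<^sup>2"
          by (simp only: distrib_right distrib_left mult_ac)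
        then show ?thesis by (simp only: add.assoc)
      qed
      also have "\<dots> \<le> A^n + n * A^m * (a \<bullet> b) + C * (A^m * B\<^sup>2 + B^n)"
      proof (intro add_left_mono mult_mono)
        have "0 \<le> real (2^n + n)" by (rule of_nat_0_le_iff)
        then show "C - (2^n + n) \<le> C" by (simp only: diff_le_eq le_add_same_cancel1)
      qed (use AB C0 in auto)
      finally show ?thesis unfolding A_def B_def P_def nm .
    qed
  qed
  then show ?thesis by (rule that[OF C0])
qed

text \<open>The average of the two lower bounds above leaves half of the quadratic gain, and this absorbs the
  perturbation \<open>|a|^(n-2) (a \<bullet> b) / (2s)\<close> of the linear term up to \<open>|a|^n / (4 n s\<^sup>2)\<close>.  The bracket on the
  left is the expression that integrates to zero when \<open>s = E2\<close> and \<open>a\<close> is the ground slope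
  (\<open>drift_eq_divergence\<close> with \<open>\<gamma> = 1/(2n)\<close>); it subtracts at least \<open>|a|^n / (2 n s\<^sup>2)\<close>, so that a multiple
  of \<open>|a|^n / s\<^sup>2\<close> remains as a gain.\<close>

lemma power_ineq_with_log_remainder:
  assumes n: "n \<ge> (2::nat)"
  obtains c where "c > 0" "\<And>(a :: 'a::real_inner) b s. s \<ge> 1 \<Longrightarrow>
     norm a ^ n + c * (norm a ^ n / s\<^sup>2 + norm b ^ n)
     + (n * (1 + 1 / (2 * real n) / s) * norm a ^ (n-2) * (a \<bullet> b) - 1 / (2 * (real n - 1)) * norm a ^ n / s\<^sup>2)
     \<le> norm (a + b) ^ n"
proof -
  obtain c0 where c0: "c0 > 0" "\<And>a b :: 'a.
     norm a ^ n + n * norm a^(n-2) * (a \<bullet> b) + c0 * norm b ^ n \<le> norm (a+b) ^ n"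
    using norm_add_power_ge_power[OF n] by blast
  define c where "c = min (c0/2) (1 / (4 * real n))"
  have "norm a ^ n + c * (norm a ^ n / s\<^sup>2 + norm b ^ n)
     + (n * (1 + 1 / (2 * real n) / s) * norm a ^ (n-2) * (a \<bullet> b) - 1 / (2 * (real n - 1)) * norm a ^ n / s\<^sup>2)
     \<le> norm (a + b) ^ n" if s: "s \<ge> 1" for a b :: 'a and s :: real
  proof -
    define X where "X = norm a ^ (n-2)"
    define A where "A = norm a" define B where "B = norm b"
    have An: "norm a ^ n = X * A\<^sup>2"
      unfolding X_def A_def using n by (metis le_add_diff_inverse2 power_add)
    have X: "X \<ge> 0" by (simp add: X_def)
    have 1: "norm a ^ n + n * X * (a \<bullet> b) + n/2 * X * B\<^sup>2 \<le> norm (a+b)^n"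
      using norm_add_power_ge_quadratic[OF n] unfolding X_def B_def .
    have 2: "norm a ^ n + n * X * (a \<bullet> b) + c0 * norm b ^ n \<le> norm (a+b)^n"
      using c0(2) unfolding X_def .
    have "a \<bullet> b / s \<le> A * B / s"
      using s norm_cauchy_schwarz[of a b] by (simp add: A_def B_def divide_right_mono)
    also have "\<dots> \<le> n/2 * B\<^sup>2 + 1/(2 * real n) * (A/s)\<^sup>2"
    proof -
      have "0 \<le> (n * B - A/s)\<^sup>2 / (2*n)" by simp
      also have "\<dots> = n/2 * B\<^sup>2 + 1/(2 * real n) * (A/s)\<^sup>2 - A * B / s"
        using n s by (simp add: power2_eq_square field_simps)
      finally show ?thesis by simp
    qed
    finally have "X * (a \<bullet> b / s) \<le> X * (n/2 * B\<^sup>2 + 1/(2 * real n) * (A/s)\<^sup>2)"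
      using X by (rule mult_left_mono)
    then have 3: "X * (a \<bullet> b / s) / 2 \<le> n/4 * (X * B\<^sup>2) + 1/(4 * real n) * (X * A\<^sup>2 / s\<^sup>2)"
      by (simp add: power_divide field_simps)
    have 4: "1/(4 * real n) * (X * A\<^sup>2 / s\<^sup>2) + 1/(4 * real n) * (X * A\<^sup>2 / s\<^sup>2) \<le> 1 / (2 * (real n - 1)) * (X * A\<^sup>2 / s\<^sup>2)"
    proof -
      have "1/(4 * real n) + 1/(4 * real n) \<le> 1 / (2 * (real n - 1))" using n by (simp add: field_simps)
      then have "(1/(4 * real n) + 1/(4 * real n)) * (X * A\<^sup>2 / s\<^sup>2) \<le> 1 / (2 * (real n - 1)) * (X * A\<^sup>2 / s\<^sup>2)"
        using X by (intro mult_right_mono) auto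
      then show ?thesis by (simp only: distrib_right)
    qed
    have 5: "c * (X * A\<^sup>2 / s\<^sup>2) \<le> 1/(4 * real n) * (X * A\<^sup>2 / s\<^sup>2)"
      using X by (intro mult_right_mono) (auto simp: c_def)
    have 6: "c * norm b ^ n \<le> c0/2 * norm b ^ n" by (intro mult_right_mono) (auto simp: c_def)
    have 7: "n * (1 + 1 / (2 * real n) / s) * X * (a \<bullet> b) = n * X * (a \<bullet> b) + X * (a \<bullet> b / s) / 2"
      using n s by (simp add: field_simps)
    define Y where "Y = X * A\<^sup>2 / s\<^sup>2"
    have e: "1 / (2 * (real n - 1)) * (X * A\<^sup>2) / s\<^sup>2 = 1 / (2 * (real n - 1)) * Y" by (simp add: Y_def)
    have f: "c * (Y + norm b ^ n) = c * Y + c * norm b ^ n" by (simp add: distrib_left)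
    have g: "n/4 * (X * B\<^sup>2) = (n/2 * X * B\<^sup>2)/2" by simp
    show ?thesis
      using 1 2 3 4 5 6 unfolding An X_def[symmetric] 7 e f g Y_def[symmetric] by linarith
  qed
  moreover have "c > 0" using c0(1) n by (simp add: c_def)
  ultimately show ?thesis using that[of c] by blast
qed

lemma power_add_le_two_power:
  fixes p q :: real
  assumes "p \<ge> 0" "q \<ge> 0"
  shows "(p + q)^n \<le> 2^n * (p^n + q^n)"
proof -
  have "(p + q)^n \<le> (2 * max p q)^n" using assms by (intro power_mono) auto
  also have "\<dots> = 2^n * max (p^n) (q^n)"
    using assms by (auto simp: power_mult_distrib max_def power_mono intro: antisym)
  also have "\<dots> \<le> 2^n * (p^n + q^n)" using assms by (intro mult_left_mono) auto
  finally show ?thesis .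
qed

text \<open>Whichever of \<open>b \<le> \<theta> (a+b)\<close> and \<open>a \<le> (1-\<theta>) (a+b)\<close> holds bounds \<open>a + b\<close> by one summand.  For small
  \<open>\<theta>\<close> the factor of \<open>a^n\<close> is close to \<open>1\<close>, which is what makes energies converge.\<close>

lemma add_power_le_split:
  fixes a b :: real
  assumes "a \<ge> 0" "b \<ge> 0" "0 < \<theta>" "\<theta> < 1"
  shows "(a + b)^n \<le> (1 / (1 - \<theta>))^n * a^n + (1 / \<theta>)^n * b^n"
proof (cases "b \<le> \<theta> * (a + b)")
  case True
  then have "a + b \<le> (1 / (1 - \<theta>)) * a" using assms by (simp add: field_simps)
  then have "(a + b)^n \<le> ((1 / (1 - \<theta>)) * a)^n" using assms by (intro power_mono) auto
  then have "(a + b)^n \<le> (1 / (1 - \<theta>))^n * a^n" by (simp only: power_mult_distrib)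
  moreover have "0 \<le> (1 / \<theta>)^n * b^n" using assms by simp
  ultimately show ?thesis by linarith
next
  case False
  then have "a + b \<le> (1 / \<theta>) * b" using assms by (simp add: field_simps)
  then have "(a + b)^n \<le> ((1 / \<theta>) * b)^n" using assms by (intro power_mono) auto
  then have "(a + b)^n \<le> (1 / \<theta>)^n * b^n" by (simp only: power_mult_distrib)
  moreover have "0 \<le> (1 / (1 - \<theta>))^n * a^n" using assms by simp
  ultimately show ?thesis by linarith
qed


section \<open>Divergences of compactly supported fields\<close>

lemma lborel_integral_translation:
  fixes f :: "'a::euclidean_space \<Rightarrow> real"
  assumes "integrable lborel f"
  shows "integrable lborel (\<lambda>x. f (x + v))" "(\<integral>x. f (x + v) \<partial>lborel) = (\<integral>x. f x \<partial>lborel)"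
proof -
  have f: "f \<in> borel_measurable borel" using assms by auto
  have "integrable (distr lborel borel ((+) v)) f"
    unfolding lborel_distr_plus using assms by simp
  then show "integrable lborel (\<lambda>x. f (x + v))"
    using f by (subst (asm) integrable_distr_eq) (auto simp: add.commute)
  have "(\<integral>x. f x \<partial>lborel) = (\<integral>x. f x \<partial>distr lborel borel ((+) v))"
    unfolding lborel_distr_plus ..
  also have "\<dots> = (\<integral>x. f (x + v) \<partial>lborel)"
    using f by (subst integral_distr) (auto simp: add.commute)
  finally show "(\<integral>x. f (x + v) \<partial>lborel) = (\<integral>x. f x \<partial>lborel)" ..
qed

lemma nn_integral_affine:
  fixes f :: "'a::euclidean_space \<Rightarrow> ennreal" and t :: 'a
  assumes [measurable]: "f \<in> borel_measurable borel" and c: "c \<noteq> 0"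
  shows "(\<integral>\<^sup>+x. f x \<partial>lborel) = ennreal (\<bar>c\<bar>^DIM('a)) * (\<integral>\<^sup>+x. f (t + c *\<^sub>R x) \<partial>lborel)"
  by (subst lborel_affine[OF c, of t])
     (simp add: nn_integral_density nn_integral_distr nn_integral_cmult)

lemma integrable_continuous_bounded_support:
  fixes f :: "'a::euclidean_space \<Rightarrow> real"
  assumes "continuous_on UNIV f" "\<And>x. norm x > r \<Longrightarrow> f x = 0"
  shows "integrable lborel f"
proof -
  have "integrable lborel (\<lambda>x. indicator (cball 0 r) x *\<^sub>R f x)"
    using continuous_on_subset[OF assms(1)] by (intro borel_integrable_compact) simp_all
  also have "(\<lambda>x. indicator (cball 0 r) x *\<^sub>R f x) = f"
    using assms(2) by (fastforce simp: indicator_def)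
  finally show ?thesis .
qed

text \<open>The difference quotients have integral zero by translation invariance, and they converge dominatedly
  because they are bounded and supported in a fixed ball.\<close>

lemma directional_derivative_integral_zero:
  fixes K :: "'a::euclidean_space \<Rightarrow> real"
  assumes K: "\<And>x. (K has_derivative K' x) (at x)"
    and K': "continuous_on UNIV (\<lambda>x. K' x v)"
    and supp: "\<And>x. norm x > r \<Longrightarrow> K x = 0"
  shows "integrable lborel (\<lambda>x. K' x v)" "(\<integral>x. K' x v \<partial>lborel) = 0"
proof -
  have contK: "continuous_on UNIV K"
    using K by (meson continuous_at_imp_continuous_on has_derivative_continuous)
  define h where "h i = 1 / real (Suc i)" for i
  have h: "0 < h i" "h i \<le> 1" for i by (auto simp: h_def)
  define F where "F i x = (K (x + h i *\<^sub>R v) - K x) / h i" for i x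
  have intK: "integrable lborel K" using contK supp by (rule integrable_continuous_bounded_support)
  have F0: "integrable lborel (F i)" "(\<integral>x. F i x \<partial>lborel) = 0" for i
    unfolding F_def
    using lborel_integral_translation[OF intK, of "h i *\<^sub>R v"] intK by simp_all
  have "compact ((\<lambda>x. K' x v) ` cball 0 (\<bar>r\<bar> + 2 * norm v))"
    using K' by (intro compact_continuous_image) (auto intro: continuous_on_subset)
  then obtain C where "\<forall>x\<in>cball 0 (\<bar>r\<bar> + 2 * norm v). \<bar>K' x v\<bar> \<le> C"
    by (auto simp: bounded_iff dest!: compact_imp_bounded)
  then have C: "\<And>x. norm x \<le> \<bar>r\<bar> + 2 * norm v \<Longrightarrow> \<bar>K' x v\<bar> \<le> C" by auto
  have line: "((\<lambda>\<tau>. K (x + \<tau> *\<^sub>R v)) has_real_derivative K' (x + \<tau> *\<^sub>R v) v) (at \<tau>)" for x \<tau>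
  proof -
    have "((\<lambda>\<tau>. K (x + \<tau> *\<^sub>R v)) has_derivative (\<lambda>d. K' (x + \<tau> *\<^sub>R v) (d *\<^sub>R v))) (at \<tau>)"
      by (rule has_derivative_compose[OF _ K]) (auto intro!: derivative_eq_intros)
    then show ?thesis
      using linear_scale[OF has_derivative_linear[OF K]]
      by (simp add: has_field_derivative_def mult_commute_abs)
  qed
  \<comment> \<open>the mean value theorem; the step sizes are at most \<open>1\<close>, so the supports stay in a fixed ball\<close>
  have bound: "\<bar>F i x\<bar> \<le> indicator (cball 0 (\<bar>r\<bar> + norm v)) x * \<bar>C\<bar>" for i x
  proof (cases "norm x \<le> \<bar>r\<bar> + norm v")
    case True
    obtain z where z: "0 < z" "z < h i" "K (x + h i *\<^sub>R v) - K (x + 0 *\<^sub>R v) = (h i - 0) * K' (x + z *\<^sub>R v) v"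
      using MVT2[OF h(1)[of i], of "\<lambda>\<tau>. K (x + \<tau> *\<^sub>R v)" "\<lambda>\<tau>. K' (x + \<tau> *\<^sub>R v) v"] line by blast
    have "norm (z *\<^sub>R v) \<le> norm v" using z h[of i] by (simp add: mult_left_le_one_le)
    then have "norm (x + z *\<^sub>R v) \<le> \<bar>r\<bar> + 2 * norm v"
      using norm_triangle_ineq[of x "z *\<^sub>R v"] True by linarith
    then show ?thesis using z h(1)[of i] C[of "x + z *\<^sub>R v"] True by (auto simp: F_def)
  next
    case False
    have "norm (h i *\<^sub>R v) \<le> norm v" using h[of i] by (simp add: mult_left_le_one_le)
    then have "norm (x + h i *\<^sub>R v) > r" "norm x > r"
      using norm_diff_ineq[of x "h i *\<^sub>R v"] False norm_ge_zero[of v] by linarith+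
    then show ?thesis using supp False by (auto simp: F_def)
  qed
  have lim: "(\<lambda>i. F i x) \<longlonglongrightarrow> K' x v" for x
  proof -
    have "((\<lambda>d. (K (x + d *\<^sub>R v) - K x) / d) \<longlongrightarrow> K' x v) (at 0)"
      using line[of x 0] by (simp add: DERIV_def)
    moreover have "filterlim h (at 0) sequentially"
      unfolding filterlim_at using h(1)
      using LIMSEQ_inverse_real_of_nat
      by (auto simp: h_def[abs_def] inverse_eq_divide less_imp_neq[symmetric] intro!: always_eventually)
    ultimately show ?thesis unfolding F_def by (rule filterlim_compose)
  qed
  have w: "integrable lborel (\<lambda>x. indicator (cball 0 (\<bar>r\<bar> + norm v)) x * \<bar>C\<bar> :: real)" for x :: 'a
    by (intro integrable_mult_left integrable_real_indicator)
       (use emeasure_bounded_finite[of "cball 0 (\<bar>r\<bar> + norm v)"] in auto)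
  have m: "(\<lambda>x. K' x v) \<in> borel_measurable lborel"
    using K' by (simp add: borel_measurable_continuous_onI)
  have dc: "integrable lborel (\<lambda>x. K' x v)" "(\<lambda>i. \<integral>x. F i x \<partial>lborel) \<longlonglongrightarrow> (\<integral>x. K' x v \<partial>lborel)"
    by (rule integrable_dominated_convergence[OF m _ w, of F] integral_dominated_convergence[OF m _ w, of F];
        use bound lim borel_measurable_integrable[OF F0(1)] in simp)+
  show "integrable lborel (\<lambda>x. K' x v)" by fact
  show "(\<integral>x. K' x v \<partial>lborel) = 0"
    using dc(2) unfolding F0(2) by (simp add: LIMSEQ_const_iff)
qed

text \<open>The integrand is the divergence of the field \<open>H(x) x\<close>.\<close>

lemma dilation_integral_zero:
  fixes H :: "'a::euclidean_space \<Rightarrow> real"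
  assumes H: "\<And>x. (H has_derivative H' x) (at x)"
    and H': "\<And>v. continuous_on UNIV (\<lambda>x. H' x v)"
    and supp: "\<And>x. norm x > r \<Longrightarrow> H x = 0"
  shows "integrable lborel (\<lambda>x. DIM('a) * H x + H' x x)"
        "(\<integral>x. DIM('a) * H x + H' x x \<partial>lborel) = 0"
proof -
  have contH: "continuous_on UNIV H"
    using H by (meson continuous_at_imp_continuous_on has_derivative_continuous)
  define K' where "K' i x v = (x \<bullet> i) * H' x v + (v \<bullet> i) * H x" for i x v
  have K: "((\<lambda>x. (x \<bullet> i) * H x) has_derivative K' i x) (at x)" for i x
    unfolding K'_def by (auto intro!: derivative_eq_intros H)
  have *: "integrable lborel (\<lambda>x. K' i x i)" "(\<integral>x. K' i x i \<partial>lborel) = 0" for i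
  proof -
    have "continuous_on UNIV (\<lambda>x. K' i x i)"
      unfolding K'_def by (intro continuous_intros H' contH)
    then show "integrable lborel (\<lambda>x. K' i x i)" "(\<integral>x. K' i x i \<partial>lborel) = 0"
      using directional_derivative_integral_zero[of "\<lambda>x. (x \<bullet> i) * H x" "K' i" i r, OF K] supp
      by auto
  qed
  have lin: "H' x x = (\<Sum>i\<in>Basis. (x \<bullet> i) * H' x i)" for x
  proof -
    have "H' x x = H' x (\<Sum>i\<in>Basis. (x \<bullet> i) *\<^sub>R i)" by (simp add: euclidean_representation)
    then show ?thesis
      using has_derivative_linear[OF H[of x]] by (simp add: linear_sum linear_scale)
  qed
  have eq: "DIM('a) * H x + H' x x = (\<Sum>i\<in>Basis. K' i x i)" for x
    unfolding K'_def lin by (simp add: sum.distrib inner_Basis)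
  show "integrable lborel (\<lambda>x. DIM('a) * H x + H' x x)" unfolding eq using * by auto
  show "(\<integral>x. DIM('a) * H x + H' x x \<partial>lborel) = 0" unfolding eq using * by simp
qed


section \<open>The logarithms \<open>E1\<close> and \<open>E2\<close>\<close>

lemma E1_eq: "0 < r \<Longrightarrow> 0 < R \<Longrightarrow> E1 (r/R) = 1 + ln R - ln r"
  by (simp add: E1_def ln_div ln_mult)

lemma E2_eq: "0 < E1 y \<Longrightarrow> E2 y = 1 + ln (E1 y)"
  by (simp add: E2_def ln_mult)

lemma E1_ge_1: "0 < r \<Longrightarrow> r \<le> R \<Longrightarrow> 1 \<le> E1 (r/R)"
  by (subst E1_eq) auto

lemma E2_ge_1: "0 < r \<Longrightarrow> r \<le> R \<Longrightarrow> 1 \<le> E2 (r/R)"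
  using E1_ge_1[of r R] by (subst E2_eq) auto

lemma E1_has_real_derivative:
  assumes "0 < r" "0 < R"
  shows "((\<lambda>r. E1 (r/R)) has_real_derivative - (1/r)) (at r)"
proof (rule has_field_derivative_transform_within_open)
  show "((\<lambda>r. 1 + ln R - ln r) has_real_derivative - (1/r)) (at r)"
    using assms by (auto intro!: derivative_eq_intros)
  show "1 + ln R - ln x = E1 (x/R)" if "x \<in> {0<..}" for x
    using that assms by (simp add: E1_eq)
qed (use assms in auto)

lemma E2_has_real_derivative:
  assumes "0 < r" "r < R"
  shows "((\<lambda>r. E2 (r/R)) has_real_derivative - (1 / (r * E1 (r/R)))) (at r)"
proof (rule has_field_derivative_transform_within_open)
  have "E1 (r/R) > 0" using E1_ge_1[of r R] assms by auto
  then show "((\<lambda>r. 1 + ln (E1 (r/R))) has_real_derivative - (1 / (r * E1 (r/R)))) (at r)"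
    using assms by (auto intro!: derivative_eq_intros E1_has_real_derivative simp: field_simps)
  show "1 + ln (E1 (x/R)) = E2 (x/R)" if "x \<in> {0<..<R}" for x
    using that assms E1_ge_1[of x R] by (simp add: E2_eq)
qed (use assms in auto)

lemma borel_measurable_E1 [measurable]: "E1 \<in> borel_measurable borel"
  unfolding E1_def[abs_def] by measurable

lemma borel_measurable_E2 [measurable]: "E2 \<in> borel_measurable borel"
  unfolding E2_def[abs_def] by measurable

lemma continuous_on_radial_E1_E2:
  "continuous_on {x::'a::euclidean_space. x \<noteq> 0 \<and> norm x < R} (\<lambda>x. E1 (norm x / R))"
  "continuous_on {x::'a::euclidean_space. x \<noteq> 0 \<and> norm x < R} (\<lambda>x. E2 (norm x / R))"
proof -
  have "isCont (\<lambda>x::'a. E1 (norm x / R)) x" "isCont (\<lambda>x::'a. E2 (norm x / R)) x"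
    if "x \<noteq> 0" "norm x < R" for x
  proof -
    have x: "0 < norm x" "norm x < R" using that by auto
    then have R: "0 < R" by linarith
    show "isCont (\<lambda>x::'a. E1 (norm x / R)) x"
      by (rule isCont_o2[OF isCont_norm[OF continuous_ident] DERIV_isCont[OF E1_has_real_derivative[OF x(1) R]]])
    show "isCont (\<lambda>x::'a. E2 (norm x / R)) x"
      by (rule isCont_o2[OF isCont_norm[OF continuous_ident] DERIV_isCont[OF E2_has_real_derivative[OF x]]])
  qed
  then show "continuous_on {x::'a::euclidean_space. x \<noteq> 0 \<and> norm x < R} (\<lambda>x. E1 (norm x / R))"
    "continuous_on {x::'a::euclidean_space. x \<noteq> 0 \<and> norm x < R} (\<lambda>x. E2 (norm x / R))"
    by (simp_all add: continuous_at_imp_continuous_on)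
qed


section \<open>One-dimensional auxiliary functions\<close>

lemma abs_power_has_real_derivative:
  fixes y :: real
  assumes "n \<ge> 2"
  shows "((\<lambda>y. \<bar>y\<bar>^n) has_real_derivative real n * \<bar>y\<bar>^(n-2) * y) (at y)"
proof -
  obtain m where n: "n = m + 2" using assms by (metis add.commute le_Suc_ex)
  consider "y > 0" | "y < 0" | "y = 0" by linarith
  then show ?thesis
  proof cases
    case 1
    have "((\<lambda>y. y^n) has_real_derivative real n * \<bar>y\<bar>^(n-2) * y) (at y)"
      using 1 n DERIV_pow[of n y UNIV] by (simp add: mult_ac)
    then show ?thesis
      by (rule has_field_derivative_transform_within_open[of _ _ _ "{0<..}"]) (use 1 in auto)
  next
    case 2
    have "((\<lambda>y. (-y)^n) has_real_derivative real n * \<bar>y\<bar>^(n-2) * y) (at y)"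
    proof -
      have "((\<lambda>y. (-y)^n) has_real_derivative (real n * (-y)^(n - Suc 0)) * (-1)) (at y)"
        by (rule DERIV_chain2[OF DERIV_pow]) (auto intro!: derivative_eq_intros)
      then show ?thesis using 2 n by (simp add: mult_ac)
    qed
    then show ?thesis
      by (rule has_field_derivative_transform_within_open[of _ _ _ "{..<0}"]) (use 2 in auto)
  next
    case 3
    have "((\<lambda>h::real. \<bar>h\<bar>^(m+1)) \<longlongrightarrow> 0) (at 0)"
      by (auto intro!: tendsto_eq_intros)
    then have "((\<lambda>h::real. \<bar>h\<bar>^n / h) \<longlongrightarrow> 0) (at 0)"
      by (rule Lim_null_comparison[rotated]) (auto simp: n eventually_at_filter field_simps abs_mult)
    then show ?thesis using 3 n by (simp add: DERIV_def)
  qed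
qed

lemma max_0_power2_has_real_derivative:
  "((\<lambda>y::real. (max 0 y)\<^sup>2) has_real_derivative 2 * max 0 y) (at y)"
proof -
  consider "y > 0" | "y < 0" | "y = 0" by linarith
  then show ?thesis
  proof cases
    case 1
    have "((\<lambda>y. y^2) has_real_derivative 2 * max 0 y) (at y)"
      using 1 by (auto intro!: derivative_eq_intros)
    then show ?thesis
      by (rule has_field_derivative_transform_within_open[of _ _ _ "{0<..}"]) (use 1 in auto)
  next
    case 2
    have "((\<lambda>y. 0) has_real_derivative 2 * max 0 y) (at y)"
      using 2 by (auto intro!: derivative_eq_intros)
    then show ?thesis
      by (rule has_field_derivative_transform_within_open[of _ _ _ "{..<0}"]) (use 2 in auto)
  next
    case 3
    have "((\<lambda>h::real. \<bar>h\<bar>) \<longlongrightarrow> 0) (at 0)"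
      by (auto intro!: tendsto_eq_intros)
    then have "((\<lambda>h::real. (max 0 h)\<^sup>2 / h) \<longlongrightarrow> 0) (at 0)"
      by (rule Lim_null_comparison[rotated])
         (auto simp: eventually_at_filter max_def power2_eq_square)
    then show ?thesis using 3 by (simp add: DERIV_def)
  qed
qed

text \<open>A continuously differentiable transition from \<open>0\<close> on \<open>(-\<infinity>,1]\<close> to \<open>1\<close> on \<open>[3,\<infinity>)\<close>, the integral of the
  hat function below.  Composed with \<open>|x|\<^sup>2 / \<epsilon>\<^sup>2\<close> it cuts off a neighbourhood of the origin.\<close>

definition step_fun :: "real \<Rightarrow> real" where
  "step_fun r = ((max 0 (r-1))\<^sup>2 - 2 * (max 0 (r-2))\<^sup>2 + (max 0 (r-3))\<^sup>2) / 2"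

definition hat_fun :: "real \<Rightarrow> real" where
  "hat_fun r = max 0 (r-1) - 2 * max 0 (r-2) + max 0 (r-3)"

lemma step_fun_has_real_derivative: "(step_fun has_real_derivative hat_fun r) (at r)"
proof -
  have *: "((\<lambda>r. (max 0 (r-c))\<^sup>2) has_real_derivative 2 * max 0 (r-c)) (at r)" for c :: real
  proof -
    have "((\<lambda>r. r - c) has_real_derivative 1) (at r)" by (auto intro!: derivative_eq_intros)
    from DERIV_chain2[OF max_0_power2_has_real_derivative this] show ?thesis by simp
  qed
  show ?thesis unfolding step_fun_def[abs_def] hat_fun_def
    by (rule DERIV_cong[OF DERIV_cdivide[OF DERIV_add[OF DERIV_diff[OF *[of 1] DERIV_cmult[OF *[of 2], of 2]] *[of 3]], of 2]])
       (simp add: field_simps)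
qed

lemma hat_fun_nonneg: "0 \<le> hat_fun r"
  by (auto simp: hat_fun_def max_def)

lemma step_fun_bounds: "0 \<le> step_fun r" "step_fun r \<le> 1"
  and step_fun_eq_0: "r \<le> 1 \<Longrightarrow> step_fun r = 0" and step_fun_eq_1: "3 \<le> r \<Longrightarrow> step_fun r = 1"
proof -
  show 0: "step_fun r = 0" if "r \<le> 1" for r using that by (simp add: step_fun_def max_def)
  show 1: "step_fun r = 1" if "3 \<le> r" for r
    using that by (simp add: step_fun_def max_def power2_eq_square field_simps)
  have mono: "step_fun x \<le> step_fun y" if "x \<le> y" for x y
    by (rule DERIV_nonneg_imp_nondecreasing[OF that])
       (use step_fun_has_real_derivative hat_fun_nonneg in blast)
  show "0 \<le> step_fun r" using mono[of "min r 1" r] 0[of "min r 1"] by simp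
  show "step_fun r \<le> 1" using mono[of r "max r 3"] 1[of "max r 3"] by simp
qed


section \<open>The Leray inequality with remainder terms\<close>

text \<open>The gradient of \<open>u\<close> at \<open>x\<close> whenever \<open>u / E1^k\<close>, with \<open>k = (n-1)/n\<close>, has a critical point there.\<close>

definition ground_slope :: "real \<Rightarrow> ('a::euclidean_space \<Rightarrow> real) \<Rightarrow> 'a \<Rightarrow> 'a" where
  "ground_slope R u x =
     - (((real DIM('a) - 1) / real DIM('a)) * u x / ((norm x)\<^sup>2 * E1 (norm x / R))) *\<^sub>R x"

lemma norm_ground_slope:
  fixes u :: "'a::euclidean_space \<Rightarrow> real"
  assumes "norm x < R"
  shows "norm (ground_slope R u x)
    = ((real DIM('a) - 1) / real DIM('a)) * \<bar>u x\<bar> / (norm x * E1 (norm x / R))"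
proof (cases "x = 0")
  case False
  then have "E1 (norm x / R) > 0" using E1_ge_1[of "norm x" R] assms by auto
  moreover have "\<bar>(real DIM('a) - 1) / real DIM('a)\<bar> = (real DIM('a) - 1) / real DIM('a)"
    using DIM_positive[where 'a='a] by (simp add: Suc_le_eq)
  ultimately show ?thesis using False unfolding ground_slope_def norm_scaleR abs_minus_cancel abs_divide abs_mult
    by (simp add: power2_eq_square)
qed (simp add: ground_slope_def)

text \<open>The field \<open>radial_weight R n \<gamma> (norm x) * |u x|^n * x\<close> is the one whose divergence supplies the linear
  term; \<open>\<gamma> = 0\<close> is the plain Leray inequality, \<open>\<gamma> > 0\<close> produces the remainder.\<close>

definition radial_weight :: "real \<Rightarrow> nat \<Rightarrow> real \<Rightarrow> real \<Rightarrow> real" where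
  "radial_weight R n \<gamma> r = (1 + \<gamma> / E2 (r/R)) / (E1 (r/R) ^ (n-1) * r ^ n)"

definition radial_weight_deriv :: "real \<Rightarrow> nat \<Rightarrow> real \<Rightarrow> real \<Rightarrow> real" where
  "radial_weight_deriv R n \<gamma> r =
     (\<gamma> / (E2 (r/R))\<^sup>2 + (real n - 1) * (1 + \<gamma> / E2 (r/R))) / (E1 (r/R) ^ n * r ^ (n+1))
     - n * radial_weight R n \<gamma> r / r"

lemma radial_weight_has_real_derivative:
  assumes "0 < r" "r < R" "n \<ge> 2"
  shows "(radial_weight R n \<gamma> has_real_derivative radial_weight_deriv R n \<gamma> r) (at r)"
proof -
  define t where "t = E1 (r/R)" define s where "s = E2 (r/R)"
  have t: "t \<ge> 1" and s: "s \<ge> 1" using assms E1_ge_1[of r R] E2_ge_1[of r R] by (auto simp: t_def s_def)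
  obtain m where n: "n = m + 2" using assms by (metis add.commute le_Suc_ex)
  have dt: "((\<lambda>r. E1 (r/R)) has_real_derivative - (1/r)) (at r)"
    using E1_has_real_derivative[of r R] assms by simp
  have ds: "((\<lambda>r. E2 (r/R)) has_real_derivative - (1 / (r * t))) (at r)"
    using E2_has_real_derivative[of r R] assms by (simp add: t_def)
  have d1: "((\<lambda>r. 1 + \<gamma> / E2 (r/R)) has_real_derivative \<gamma> / (s\<^sup>2 * (r * t))) (at r)"
    using s assms t unfolding s_def
    by (auto intro!: derivative_eq_intros ds simp: power2_eq_square)
  have d2: "((\<lambda>r. E1 (r/R) ^ (n-1) * r ^ n) has_real_derivative
      - (real (m+1) * t^m) / r * r^n + t^(m+1) * (n * r^(m+1))) (at r)"
    using assms
    by (intro DERIV_cong[OF DERIV_mult[OF DERIV_power[OF dt, of "n-1"] DERIV_pow[of n r UNIV]]])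
       (simp add: t_def n)
  have pos: "t^m > 0" "r^m > 0" "t > 0" "r > 0" "s > 0" using t s assms by auto
  have "(radial_weight R n \<gamma> has_real_derivative
     (\<gamma> / (s\<^sup>2 * (r * t)) * (t^(n-1) * r^n) - (1 + \<gamma>/s) * (- (real (m+1) * t^m) / r * r^n + t^(m+1) * (n * r^(m+1))))
      / (t^(n-1) * r^n * (t^(n-1) * r^n))) (at r)"
    unfolding radial_weight_def[abs_def]
    using DERIV_divide[OF d1 d2] pos by (simp add: t_def s_def)
  also have "(\<gamma> / (s\<^sup>2 * (r * t)) * (t^(n-1) * r^n) - (1 + \<gamma>/s) * (- (real (m+1) * t^m) / r * r^n + t^(m+1) * (n * r^(m+1))))
      / (t^(n-1) * r^n * (t^(n-1) * r^n)) = radial_weight_deriv R n \<gamma> r"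
  proof -
    have "(\<gamma> / (s\<^sup>2 * (r * t)) * (t^(n-1) * r^n) - h * (- (real (m+1) * t^m) / r * r^n + t^(m+1) * (n * r^(m+1))))
      / (t^(n-1) * r^n * (t^(n-1) * r^n))
      = (\<gamma> / s\<^sup>2 + (real n - 1) * h) / (t^n * r^(n+1)) - n * (h / (t^(n-1) * r^n)) / r" for h
      using pos by (simp add: n field_simps power2_eq_square)
    then show ?thesis unfolding radial_weight_deriv_def radial_weight_def t_def s_def .
  qed
  finally show ?thesis .
qed

text \<open>The right side is \<open>- k^(n-1)\<close> times the divergence of the radial field when \<open>p\<close> is the gradient of \<open>u\<close>.
  The computation is arranged in the two quantities \<open>Y\<close> and \<open>Z\<close>, the parts of first order in \<open>p\<close> and of
  order zero; \<open>n k = n - 1\<close> makes the terms without \<open>\<gamma>\<close> agree.\<close>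

lemma drift_eq_divergence:
  fixes u :: "'a::euclidean_space \<Rightarrow> real"
  defines "n \<equiv> DIM('a)"
  assumes n2: "DIM('a) \<ge> 2" and x: "x \<noteq> 0" "norm x < R"
  defines "k \<equiv> (real n - 1) / real n" and "a \<equiv> ground_slope R u x" and "r \<equiv> norm x"
  shows "n * (1 + \<gamma> / E2 (r/R)) * norm a ^ (n-2) * (a \<bullet> (p - a)) - \<gamma> / k * norm a ^ n / (E2 (r/R))\<^sup>2
    = - (k^(n-1) * (\<bar>u x\<bar>^n * (n * radial_weight R n \<gamma> r + r * radial_weight_deriv R n \<gamma> r)
           + radial_weight R n \<gamma> r * (n * \<bar>u x\<bar>^(n-2) * u x * (p \<bullet> x))))"
proof -
  define t where "t = E1 (r/R)" define s where "s = E2 (r/R)" define h where "h = 1 + \<gamma>/s"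
  have r0: "r > 0" using x by (simp add: r_def)
  have t: "t \<ge> 1" and s: "s \<ge> 1" using r0 x E1_ge_1[of r R] E2_ge_1[of r R] by (auto simp: t_def s_def r_def)
  obtain m where n: "n = m + 2" using n2 unfolding n_def by (metis add.commute le_Suc_ex)
  have k: "k > 0" "n * k = n - 1" using n by (auto simp: k_def)
  define Y where "Y = \<bar>u x\<bar>^m * u x * (p \<bullet> x) / (r^n * t^(n-1))"
  define Z where "Z = \<bar>u x\<bar>^n / (r^n * t^n)"
  have na: "norm a = k * \<bar>u x\<bar> / (r * t)"
    using norm_ground_slope[OF x(2), of u] by (simp add: a_def k_def n_def r_def t_def)
  have an: "norm a ^ n = k^n * Z"
    unfolding na Z_def by (simp add: power_divide power_mult_distrib)
  have ap: "norm a ^ m * (a \<bullet> p) = - (k^(m+1) * Y)"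
  proof -
    have "a \<bullet> p = - (k * u x / (r\<^sup>2 * t) * (p \<bullet> x))"
      by (simp add: a_def ground_slope_def k_def n_def r_def t_def inner_commute)
    then show ?thesis unfolding na Y_def
      using r0 t by (simp add: n power_divide power_mult_distrib power_add power2_eq_square mult_ac)
  qed
  have aa: "norm a ^ m * (a \<bullet> a) = k^n * Z"
    unfolding an[symmetric] by (simp add: n power_add power2_norm_eq_inner[symmetric] power2_eq_square)
  have U: "\<bar>u x\<bar>^n * (n * radial_weight R n \<gamma> r + r * radial_weight_deriv R n \<gamma> r)
      = Z * (\<gamma>/s\<^sup>2 + (real n - 1) * h)"
    unfolding radial_weight_deriv_def using r0 t
    by (simp add: Z_def h_def s_def t_def[symmetric] field_simps)
  have V: "radial_weight R n \<gamma> r * (n * \<bar>u x\<bar>^(n-2) * u x * (p \<bullet> x)) = n * h * Y"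
    unfolding radial_weight_def Y_def h_def s_def t_def n by (simp add: mult_ac)
  have "norm a ^ (n-2) * (a \<bullet> (p - a)) = - (k^(m+1) * Y) - k^n * Z"
    using ap aa n by (simp add: inner_diff_right right_diff_distrib)
  then have "n * h * norm a ^ (n-2) * (a \<bullet> (p - a)) = n * h * (- (k^(m+1) * Y) - k^n * Z)"
    by (simp only: mult.assoc)
  moreover have "n * h * (- (k^(m+1) * Y) - k^n * Z) - \<gamma> / k * (k^n * Z) / s\<^sup>2
    = - (k^(n-1) * (Z * (\<gamma>/s\<^sup>2 + (real n - 1) * h) + n * h * Y))"
  proof -
    have e1: "k^n = k * k^(m+1)" "k^(n-1) = k^(m+1)" by (simp_all add: n)
    define K where "K = k^(m+1)"
    have "\<gamma> / k * (k * K * Z) / s\<^sup>2 = K * Z * (\<gamma> / s\<^sup>2)" using k(1) by simp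
    moreover have "n * h * (k * K * Z) = (real n - 1) * h * K * Z"
    proof -
      have "n * h * (k * K * Z) = (n * k) * h * K * Z" by (simp only: mult_ac)
      then show ?thesis using k(2) n by simp
    qed
    ultimately show ?thesis unfolding e1 K_def[symmetric]
      by (simp only:) (simp only: right_diff_distrib distrib_left mult_minus_right minus_add_distrib mult_ac add_ac diff_conv_add_uminus)
  qed
  ultimately show ?thesis unfolding U V an unfolding s_def h_def by (simp only:)
qed

lemma gradient_zero_off_support:
  fixes u :: "'a::euclidean_space \<Rightarrow> real"
  assumes u: "\<And>x. (u has_derivative (\<lambda>h. Du x \<bullet> h)) (at x)"
    and S: "open S" "\<And>x. x \<in> S \<Longrightarrow> u x = 0" "x \<in> S"
  shows "Du x = 0"
proof -
  have "((\<lambda>_. 0) has_derivative (\<lambda>h. Du x \<bullet> h)) (at x)"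
    by (rule has_derivative_transform_within_open[OF u S(1)]) (use S in auto)
  then have "(\<lambda>h. Du x \<bullet> h) = (\<lambda>h. 0)"
    using has_derivative_unique has_derivative_const by blast
  then have "Du x \<bullet> Du x = 0" by metis
  then show ?thesis by simp
qed

text \<open>The radial field is singular at the origin, and its coefficients are under control only for \<open>|x| < R\<close>.  The
  weight \<open>w\<close> serves to remove the origin, and the support of \<open>u\<close> lies inside the ball; the product is then a
  continuously differentiable field with compact support, whose divergence integrates to zero.  The term with \<open>Dw\<close> is
  the derivative of the weight.\<close>

lemma weighted_drift_identity:
  fixes u w :: "'a::euclidean_space \<Rightarrow> real" and \<gamma> :: real
  defines "n \<equiv> DIM('a)"
  assumes n2: "DIM('a) \<ge> 2"
    and u: "\<And>x. (u has_derivative (\<lambda>h. Du x \<bullet> h)) (at x)" "continuous_on UNIV Du"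
    and w: "\<And>x. (w has_derivative (\<lambda>h. Dw x \<bullet> h)) (at x)" "continuous_on UNIV Dw"
    and supp: "r0 < R" "\<And>x. norm x > r0 \<Longrightarrow> u x = 0"
    and near: "\<epsilon> > 0" "\<And>x. norm x < \<epsilon> \<Longrightarrow> w x * \<bar>u x\<bar> = 0"
  defines "k \<equiv> (real n - 1) / real n" and "a \<equiv> ground_slope R u"
  defines "Z \<equiv> \<lambda>\<gamma> x. w x * (n * (1 + \<gamma> / E2 (norm x/R)) * norm (a x) ^ (n-2) * (a x \<bullet> (Du x - a x))
                  - \<gamma> / k * norm (a x) ^ n / (E2 (norm x/R))\<^sup>2)
           - k^(n-1) * ((Dw x \<bullet> x) * (radial_weight R n \<gamma> (norm x) * \<bar>u x\<bar>^n))"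
  shows "integrable lborel (Z \<gamma>)" "(\<integral>x. Z \<gamma> x \<partial>lborel) = 0"
proof -
  define \<Psi> where "\<Psi> x = radial_weight R n \<gamma> (norm x)" for x :: 'a
  define \<Psi>1 where "\<Psi>1 x = radial_weight_deriv R n \<gamma> (norm x)" for x :: 'a
  define H where "H x = w x * (\<Psi> x * \<bar>u x\<bar>^n)" for x
  define H' where "H' x v = w x * (\<Psi> x * (n * \<bar>u x\<bar>^(n-2) * u x * (Du x \<bullet> v))
      + \<Psi>1 x * (x \<bullet> v) / norm x * \<bar>u x\<bar>^n) + (Dw x \<bullet> v) * (\<Psi> x * \<bar>u x\<bar>^n)" for x v
  have nn: "n \<ge> 2" using n2 by (simp add: n_def)
  have k0: "k > 0" using nn by (simp add: k_def)
  define U0 where "U0 = {x::'a. norm x < \<epsilon>}"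
  define U1 where "U1 = {x::'a. x \<noteq> 0 \<and> norm x < R}"
  define U2 where "U2 = {x::'a. norm x > r0}"
  have op: "open U0" "open U1" "open U2"
    unfolding U0_def U1_def U2_def
    by (auto intro!: open_Collect_less open_Collect_conj open_Collect_neq continuous_intros)
  have cover: "UNIV = U0 \<union> U1 \<union> U2"
    using supp(1) near(1) by (auto simp: U0_def U1_def U2_def)
  have H1: "(H has_derivative H' x) (at x)" if "x \<in> U1" for x
  proof -
    have x: "0 < norm x" "norm x < R" using that by (auto simp: U1_def)
    have d1: "(\<Psi> has_derivative (\<lambda>v. \<Psi>1 x * (x \<bullet> v) / norm x)) (at x)"
    proof -
      have "(\<Psi> has_derivative (\<lambda>v. \<Psi>1 x * ((x \<bullet> v) / norm x))) (at x)"
        unfolding \<Psi>_def \<Psi>1_def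
      proof (rule has_derivative_compose[of norm "\<lambda>v. (x \<bullet> v) / norm x"])
        show "(norm has_derivative (\<lambda>v. (x \<bullet> v) / norm x)) (at x within UNIV)"
          using has_derivative_norm[of x] x
          by (simp add: sgn_div_norm inner_commute divide_inverse mult_ac)
        show "(radial_weight R n \<gamma> has_derivative (*) (radial_weight_deriv R n \<gamma> (norm x))) (at (norm x))"
          using radial_weight_has_real_derivative[OF x nn] by (simp add: has_field_derivative_def)
      qed
      then show ?thesis by simp
    qed
    have d2: "((\<lambda>x. \<bar>u x\<bar>^n) has_derivative (\<lambda>v. n * \<bar>u x\<bar>^(n-2) * u x * (Du x \<bullet> v))) (at x)"
      using has_derivative_compose[OF u(1)[of x] abs_power_has_real_derivative[OF nn, of "u x", unfolded has_field_derivative_def]]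
      by simp
    show ?thesis unfolding H_def[abs_def] H'_def[abs_def]
      by (rule has_derivative_mult[OF w(1)[of x] has_derivative_mult[OF d1 d2]])
  qed
  have Hzero: "H x = 0" if "x \<in> U0 \<union> U2" for x
    using that supp(2) near(2) nn by (auto simp: H_def U0_def U2_def)
  have H0: "(H has_derivative (\<lambda>_. 0)) (at x)" if "x \<in> U0 \<union> U2" for x
    by (rule has_derivative_transform_within_open[of "\<lambda>_. 0" _ _ _ "U0 \<union> U2"])
       (use that op Hzero in auto)
  \<comment> \<open>where the field is cut off, the formula for its derivative must give zero too; on the overlap this is uniqueness of the derivative\<close>
  have H'0: "H' x v = 0" if "x \<in> U0 \<union> U2" for x v
  proof (cases "x \<in> U1")
    case True
    have "H' x = (\<lambda>_. 0)" by (rule has_derivative_unique[OF H1[OF True] H0[OF that]])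
    then show ?thesis by simp
  next
    case False
    have "u x = 0 \<or> x = 0" using False supp by (auto simp: U1_def not_less)
    moreover have "\<Psi> 0 = 0" using nn by (simp add: \<Psi>_def radial_weight_def)
    moreover have "\<Psi>1 0 * (0 \<bullet> v) / norm (0::'a) = 0" by simp
    ultimately show ?thesis using nn by (auto simp: H'_def power_0_left)
  qed
  have H: "(H has_derivative H' x) (at x)" for x
  proof (cases "x \<in> U0 \<union> U2")
    case True
    have "H' x = (\<lambda>_. 0)" using H'0[OF True] by auto
    then show ?thesis using H0[OF True] by simp
  next
    case False
    then show ?thesis using H1 cover by blast
  qed
  have cu: "continuous_on UNIV u" "continuous_on UNIV w"
    using u(1) w(1) by (meson continuous_at_imp_continuous_on has_derivative_continuous)+
  have H'cont: "continuous_on UNIV (\<lambda>x. H' x v)" for v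
  proof -
    have "continuous_on U1 (\<lambda>x. H' x v)"
    proof -
      have E: "continuous_on U1 (\<lambda>x. E1 (norm x / R))" "continuous_on U1 (\<lambda>x. E2 (norm x / R))"
        unfolding U1_def by (rule continuous_on_radial_E1_E2)+
      have E': "\<forall>x\<in>U1. E1 (norm x / R) \<noteq> 0" "\<forall>x\<in>U1. E2 (norm x / R) \<noteq> 0"
      proof -
        have "1 \<le> E1 (norm x / R)" "1 \<le> E2 (norm x / R)" if "x \<in> U1" for x
          using that E1_ge_1[of "norm x" R] E2_ge_1[of "norm x" R] by (simp_all add: U1_def)
        then show "\<forall>x\<in>U1. E1 (norm x / R) \<noteq> 0" "\<forall>x\<in>U1. E2 (norm x / R) \<noteq> 0"
          by (metis not_one_le_zero)+
      qed
      have W: "continuous_on U1 \<Psi>"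
        unfolding \<Psi>_def radial_weight_def
        by (intro continuous_intros E) (use E' in \<open>auto simp: U1_def\<close>)
      have W1: "continuous_on U1 \<Psi>1"
        unfolding \<Psi>1_def radial_weight_deriv_def
        by (intro continuous_intros E W[unfolded \<Psi>_def]) (use E' in \<open>auto simp: U1_def\<close>)
      show ?thesis unfolding H'_def
        by (intro continuous_intros W W1 continuous_on_subset[OF cu(1)] continuous_on_subset[OF cu(2)]
              continuous_on_subset[OF u(2)] continuous_on_subset[OF w(2)]) (auto simp: U1_def)
    qed
    moreover have "continuous_on (U0 \<union> U2) (\<lambda>x. H' x v)"
    proof -
      have "continuous_on (U0 \<union> U2) (\<lambda>x. H' x v) \<longleftrightarrow> continuous_on (U0 \<union> U2) (\<lambda>_. 0 :: real)"
        using H'0 by (intro continuous_on_cong) auto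
      then show ?thesis by simp
    qed
    ultimately have "continuous_on (U1 \<union> (U0 \<union> U2)) (\<lambda>x. H' x v)"
      by (rule continuous_on_open_Un[OF op(2) open_Un[OF op(1,3)]])
    then show ?thesis using cover by (simp add: Un_commute Un_left_commute)
  qed
  have eq: "n * H x + H' x x = (- (1 / k^(n-1))) * Z \<gamma> x" for x
  proof (cases "x \<in> U1")
    case True
    then have x: "x \<noteq> 0" "norm x < R" by (auto simp: U1_def)
    define D where "D = \<bar>u x\<bar>^n * (n * \<Psi> x + norm x * \<Psi>1 x) + \<Psi> x * (n * \<bar>u x\<bar>^(n-2) * u x * (Du x \<bullet> x))"
    have "Z \<gamma> x = w x * (- (k^(n-1) * D)) - k^(n-1) * ((Dw x \<bullet> x) * (\<Psi> x * \<bar>u x\<bar>^n))"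
      unfolding Z_def a_def D_def \<Psi>_def \<Psi>1_def k_def n_def
      by (subst drift_eq_divergence[OF n2 x]) (simp only:)
    then have "(- (1 / k^(n-1))) * Z \<gamma> x = w x * D + (Dw x \<bullet> x) * (\<Psi> x * \<bar>u x\<bar>^n)"
    proof -
      have "(- (1 / K)) * (w x * (- (K * D)) - K * E) = w x * D + E" if "K > 0" for K E :: real
        using that by (simp add: field_simps)
      from this[of "k^(n-1)"] show ?thesis unfolding \<open>Z \<gamma> x = _\<close> using k0 by simp
    qed
    also have "\<dots> = n * H x + H' x x"
    proof -
      have "\<Psi>1 x * (x \<bullet> x) / norm x = \<Psi>1 x * norm x"
        using x by (simp add: power2_norm_eq_inner[symmetric] power2_eq_square)
      then show ?thesis unfolding H_def H'_def D_def by (simp add: algebra_simps)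
    qed
    finally show ?thesis ..
  next
    case False
    then have "u x = 0 \<or> x = 0" using supp by (auto simp: U1_def not_less)
    moreover have "\<Psi> 0 = 0" using nn by (simp add: \<Psi>_def radial_weight_def)
    ultimately show ?thesis using nn
      by (auto simp: Z_def a_def ground_slope_def H_def H'_def power_0_left)
  qed
  have Hs: "norm x > r0 \<Longrightarrow> H x = 0" for x using Hzero by (auto simp: U2_def)
  have *: "integrable lborel (\<lambda>x. (- (1 / k^(n-1))) * Z \<gamma> x)" "(\<integral>x. (- (1 / k^(n-1))) * Z \<gamma> x \<partial>lborel) = 0"
    using dilation_integral_zero[of H H' r0, OF H H'cont Hs] unfolding n_def[symmetric] eq by auto
  have "integrable lborel (\<lambda>x. (- (k^(n-1))) * ((- (1 / k^(n-1))) * Z \<gamma> x))"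
    by (rule integrable_mult_right) (rule *(1))
  moreover have "(\<lambda>x. (- (k^(n-1))) * ((- (1 / k^(n-1))) * Z \<gamma> x)) = Z \<gamma>"
    using k0 by (simp add: fun_eq_iff)
  ultimately show "integrable lborel (Z \<gamma>)" by (simp only:)
  show "(\<integral>x. Z \<gamma> x \<partial>lborel) = 0" using *(2) k0 by simp
qed

text \<open>The pointwise inequality is multiplied by cut-offs \<open>\<eta> j\<close> that vanish near the origin, and integrated.
  The divergence term disappears, and the term with the derivative of the cut-off has a favourable sign because \<open>\<eta> j\<close>
  is radially increasing, so it is simply dropped, and the limit \<open>j \<rightarrow> \<infinity>\<close> is Fatou's lemma.\<close>

lemma leray_inequality_with_remainder:
  assumes n2: "DIM('a::euclidean_space) \<ge> 2"
  obtains c where "c > 0" "\<And>(u :: 'a \<Rightarrow> real) Du R r0.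
     (\<And>x. (u has_derivative (\<lambda>h. Du x \<bullet> h)) (at x)) \<Longrightarrow> continuous_on UNIV Du \<Longrightarrow>
     r0 < R \<Longrightarrow> (\<And>x. norm x > r0 \<Longrightarrow> u x = 0) \<Longrightarrow>
     (\<integral>\<^sup>+x. ennreal (norm (ground_slope R u x) ^ DIM('a) + c * (norm (ground_slope R u x) ^ DIM('a) / (E2 (norm x/R))\<^sup>2
          + norm (Du x - ground_slope R u x) ^ DIM('a))) \<partial>lborel)
       \<le> (\<integral>\<^sup>+x. ennreal (norm (Du x) ^ DIM('a)) \<partial>lborel)"
proof -
  define n where "n = DIM('a)"
  have nn: "n \<ge> 2" using n2 by (simp add: n_def)
  obtain c where c: "c > 0" "\<And>(a :: 'a) b s. s \<ge> 1 \<Longrightarrow>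
     norm a ^ n + c * (norm a ^ n / s\<^sup>2 + norm b ^ n)
     + (n * (1 + 1 / (2 * real n) / s) * norm a ^ (n-2) * (a \<bullet> b) - 1 / (2 * (real n - 1)) * norm a ^ n / s\<^sup>2)
     \<le> norm (a + b) ^ n"
    using power_ineq_with_log_remainder[OF nn, where 'a='a] by blast
  have "(\<integral>\<^sup>+x. ennreal (norm (ground_slope R u x) ^ n + c * (norm (ground_slope R u x) ^ n / (E2 (norm x/R))\<^sup>2
          + norm (Du x - ground_slope R u x) ^ n)) \<partial>lborel)
       \<le> (\<integral>\<^sup>+x. ennreal (norm (Du x) ^ n) \<partial>lborel)"
    if u: "\<And>x. (u has_derivative (\<lambda>h. Du x \<bullet> h)) (at x)" "continuous_on UNIV Du"
     and supp: "r0 < R" "\<And>x. norm x > r0 \<Longrightarrow> u x = 0" for u :: "'a \<Rightarrow> real" and Du R r0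
  proof (cases "R > 0")
    case False
    then have u0: "u x = 0" for x using supp order.strict_trans2[of r0 0 "norm x"] by (cases "r0 < 0") auto
    have "Du x = 0" for x using gradient_zero_off_support[OF u(1) open_UNIV u0] by simp
    then show ?thesis using nn by (simp add: ground_slope_def u0 power_0_left)
  next
    case R: True
    define a where "a = ground_slope R u"
    define k where "k = (real n - 1) / real n"
    define \<gamma> where "\<gamma> = 1 / (2 * real n)"
    have k: "0 < k" "k \<le> 1" "\<gamma> / k = 1 / (2 * (real n - 1))" "0 < \<gamma>" "\<gamma> \<le> 1"
      using nn by (auto simp: k_def \<gamma>_def field_simps)
    define Q where "Q x = n * (1 + \<gamma> / E2 (norm x/R)) * norm (a x) ^ (n-2) * (a x \<bullet> (Du x - a x))
                  - \<gamma> / k * norm (a x) ^ n / (E2 (norm x/R))\<^sup>2" for x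
    define P where "P x = norm (a x) ^ n + c * (norm (a x) ^ n / (E2 (norm x/R))\<^sup>2 + norm (Du x - a x) ^ n)" for x
    have P0: "P x \<ge> 0" for x using c(1) by (simp add: P_def)
    have PQ: "P x + Q x \<le> norm (Du x) ^ n" if "x \<noteq> 0" for x
    proof (cases "norm x < R")
      case True
      then show ?thesis
        using c(2)[of "E2 (norm x / R)" "a x" "Du x - a x"] E2_ge_1[of "norm x" R] that
        unfolding P_def Q_def k(3) unfolding \<gamma>_def by simp
    next
      case False
      then have "u x = 0" using supp by auto
      moreover have "Du x = 0"
        by (rule gradient_zero_off_support[OF u(1), of "{x. norm x > r0}"])
           (use supp False in \<open>auto intro!: open_Collect_less continuous_intros\<close>)
      ultimately show ?thesis using nn by (simp add: P_def Q_def a_def ground_slope_def power_0_left)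
    qed
    have ucont: "continuous_on UNIV u"
      using u(1) by (meson continuous_at_imp_continuous_on has_derivative_continuous)
    have Dint: "integrable lborel (\<lambda>x. norm (Du x) ^ n)"
    proof (rule integrable_continuous_bounded_support[of _ r0])
      show "norm (Du x) ^ n = 0" if "norm x > r0" for x
      proof -
        have "open {x::'a. norm x > r0}" by (intro open_Collect_less continuous_intros)
        then have "Du x = 0"
          by (rule gradient_zero_off_support[OF u(1)]) (use that supp in auto)
        then show ?thesis using nn by simp
      qed
    qed (intro continuous_intros u)
    \<comment> \<open>any null sequence of radii would do\<close>
    define \<epsilon> where "\<epsilon> j = R / 2 * exp (- real j)" for j :: nat
    have \<epsilon>: "\<epsilon> j > 0" for j using R by (simp add: \<epsilon>_def)
    define \<eta> where "\<eta> j x = step_fun ((x \<bullet> x) / (\<epsilon> j)\<^sup>2)" for j and x :: 'a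
    define D\<eta> where "D\<eta> j x = (hat_fun ((x \<bullet> x) / (\<epsilon> j)\<^sup>2) * 2 / (\<epsilon> j)\<^sup>2) *\<^sub>R x" for j and x :: 'a
    have \<eta>: "(\<eta> j has_derivative (\<lambda>h. D\<eta> j x \<bullet> h)) (at x)" for j x
    proof -
      have "((\<lambda>x::'a. (x \<bullet> x) / (\<epsilon> j)\<^sup>2) has_derivative (\<lambda>h. 2 * (x \<bullet> h) / (\<epsilon> j)\<^sup>2)) (at x)"
        using \<epsilon>[of j] unfolding divide_inverse
        by (auto intro!: derivative_eq_intros simp: inner_commute)
      from has_derivative_compose[OF this step_fun_has_real_derivative[unfolded has_field_derivative_def]]
      show ?thesis unfolding \<eta>_def[abs_def] D\<eta>_def by (simp add: mult_ac)
    qed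
    have D\<eta>: "continuous_on UNIV (D\<eta> j)" for j
      unfolding D\<eta>_def[abs_def] hat_fun_def[abs_def] using \<epsilon>[of j]
      by (auto intro!: continuous_intros simp: less_imp_neq[symmetric])
    have \<eta>01: "0 \<le> \<eta> j x" "\<eta> j x \<le> 1" for j x unfolding \<eta>_def by (rule step_fun_bounds)+
    have near: "norm x < \<epsilon> j \<Longrightarrow> \<eta> j x * \<bar>u x\<bar> = 0" for j x
      using \<epsilon>[of j] power_mono[of "norm x" "\<epsilon> j" 2]
      by (auto simp: \<eta>_def power2_norm_eq_inner[symmetric] intro!: step_fun_eq_0)
    define Z where "Z j x = \<eta> j x * Q x - k^(n-1) * ((D\<eta> j x \<bullet> x) * (radial_weight R n \<gamma> (norm x) * \<bar>u x\<bar>^n))" for j x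
    have Z: "integrable lborel (Z j)" "(\<integral>x. Z j x \<partial>lborel) = 0" for j
      unfolding Z_def[abs_def] Q_def a_def k_def n_def
      using weighted_drift_identity(1)[OF n2 u \<eta>[of j] D\<eta>[of j] supp \<epsilon>[of j] near[of _ j], of \<gamma>]
        weighted_drift_identity(2)[OF n2 u \<eta>[of j] D\<eta>[of j] supp \<epsilon>[of j] near[of _ j], of \<gamma>]
      by (simp_all only:)
    \<comment> \<open>the derivative of the cut-off contributes with the sign that helps\<close>
    have E0: "0 \<le> k^(n-1) * ((D\<eta> j x \<bullet> x) * (radial_weight R n \<gamma> (norm x) * \<bar>u x\<bar>^n))" for j x
    proof (cases "x = 0 \<or> norm x \<ge> R")
      case True
      then have "D\<eta> j x \<bullet> x = 0 \<or> u x = 0" using supp by (auto simp: D\<eta>_def)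
      then show ?thesis using nn by (auto simp: power_0_left)
    next
      case False
      then have "E1 (norm x / R) \<ge> 1" "E2 (norm x / R) \<ge> 1"
        using E1_ge_1[of "norm x" R] E2_ge_1[of "norm x" R] by auto
      then have "radial_weight R n \<gamma> (norm x) \<ge> 0" using k by (simp add: radial_weight_def)
      moreover have "D\<eta> j x \<bullet> x \<ge> 0" by (simp add: D\<eta>_def hat_fun_nonneg)
      ultimately show ?thesis using k by simp
    qed
    have bound: "(\<integral>\<^sup>+x. ennreal (\<eta> j x * P x) \<partial>lborel) \<le> ennreal (\<integral>x. norm (Du x) ^ n \<partial>lborel)" for j
    proof -
      have le: "\<eta> j x * P x \<le> norm (Du x) ^ n - Z j x" for x
      proof (cases "x = 0")
        case True
        have "\<eta> j 0 = 0" by (simp add: \<eta>_def step_fun_eq_0)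
        then show ?thesis using True by (simp add: Z_def)
      next
        case False
        have "\<eta> j x * (P x + Q x) \<le> 1 * norm (Du x) ^ n"
          using mult_left_mono[OF PQ[OF False] \<eta>01(1)[of j x]] mult_right_mono[OF \<eta>01(2)[of j x], of "norm (Du x) ^ n"]
          by simp
        then have "\<eta> j x * P x + \<eta> j x * Q x \<le> norm (Du x) ^ n"
          unfolding distrib_left[of "\<eta> j x" "P x"] by simp
        then show ?thesis using E0[of j x] unfolding Z_def by linarith
      qed
      have iF: "integrable lborel (\<lambda>x. norm (Du x) ^ n - Z j x)"
        using Dint Z(1)[of j] by (rule Bochner_Integration.integrable_diff)
      have "(\<integral>\<^sup>+x. ennreal (\<eta> j x * P x) \<partial>lborel) \<le> (\<integral>\<^sup>+x. ennreal (norm (Du x) ^ n - Z j x) \<partial>lborel)"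
        using le by (intro nn_integral_mono ennreal_leI)
      also have "\<dots> = ennreal (\<integral>x. norm (Du x) ^ n - Z j x \<partial>lborel)"
      proof (rule nn_integral_eq_integral[OF iF], rule AE_I2)
        show "0 \<le> norm (Du x) ^ n - Z j x" for x
          using le[of x] mult_nonneg_nonneg[OF \<eta>01(1)[of j x] P0[of x]] by linarith
      qed
      also have "(\<integral>x. norm (Du x) ^ n - Z j x \<partial>lborel) = (\<integral>x. norm (Du x) ^ n \<partial>lborel)"
        using Bochner_Integration.integral_diff[OF Dint Z(1)[of j]] Z(2)[of j] by simp
      finally show ?thesis .
    qed
    have Pm: "P \<in> borel_measurable borel"
    proof -
      have [measurable]: "u \<in> borel_measurable borel" "Du \<in> borel_measurable borel"
        using ucont u(2) by (auto intro: borel_measurable_continuous_onI)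
      show ?thesis unfolding P_def[abs_def] a_def ground_slope_def[abs_def] by measurable
    qed
    have \<eta>m: "\<eta> j \<in> borel_measurable borel" for j
      by (rule borel_measurable_continuous_onI)
         (use \<eta> in \<open>meson continuous_at_imp_continuous_on has_derivative_continuous\<close>)
    have lim1: "eventually (\<lambda>j. \<eta> j x = 1) sequentially" if "x \<noteq> 0" for x
    proof -
      have "(\<lambda>j. 3 * (\<epsilon> j)\<^sup>2) \<longlonglongrightarrow> 3 * (R/2 * 0)\<^sup>2"
        unfolding \<epsilon>_def
        by (intro tendsto_intros filterlim_compose[OF exp_at_bot])
           (auto simp: filterlim_uminus_at_bot filterlim_real_sequentially)
      moreover have "3 * (R/2 * 0)\<^sup>2 < x \<bullet> x" using that by simp
      ultimately have "eventually (\<lambda>j. 3 * (\<epsilon> j)\<^sup>2 < x \<bullet> x) sequentially"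
        by (rule order_tendstoD)
      then show ?thesis
      proof eventually_elim
        case (elim j)
        then have "3 \<le> (x \<bullet> x) / (\<epsilon> j)\<^sup>2" using \<epsilon>[of j] by (simp add: pos_le_divide_eq)
        then show ?case unfolding \<eta>_def by (rule step_fun_eq_1)
      qed
    qed
    have "(\<integral>\<^sup>+x. ennreal (P x) \<partial>lborel) \<le> (\<integral>\<^sup>+x. liminf (\<lambda>j. ennreal (\<eta> j x * P x)) \<partial>lborel)"
    proof (rule nn_integral_mono_AE)
      have "AE x in lborel. x \<noteq> (0::'a)" by (rule AE_lborel_singleton)
      then show "AE x in lborel. ennreal (P x) \<le> liminf (\<lambda>j. ennreal (\<eta> j x * P x))"
      proof eventually_elim
        case (elim x)
        have "eventually (\<lambda>j. ennreal (P x) \<le> ennreal (\<eta> j x * P x)) sequentially"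
          using lim1[OF elim] by eventually_elim simp
        then show ?case by (rule Liminf_bounded)
      qed
    qed
    also have "\<dots> \<le> liminf (\<lambda>j. \<integral>\<^sup>+x. ennreal (\<eta> j x * P x) \<partial>lborel)"
    proof (intro nn_integral_liminf)
      note [measurable] = Pm \<eta>m
      show "(\<lambda>x. ennreal (\<eta> j x * P x)) \<in> borel_measurable lborel" for j by measurable
    qed
    also have "\<dots> \<le> ennreal (\<integral>x. norm (Du x) ^ n \<partial>lborel)"
      by (rule Liminf_le) (use bound in auto)
    also have "\<dots> = (\<integral>\<^sup>+x. ennreal (norm (Du x) ^ n) \<partial>lborel)"
      using Dint by (intro nn_integral_eq_integral[symmetric]) auto
    finally show ?thesis unfolding P_def a_def .
  qed
  then show ?thesis using that[of c] c(1) unfolding n_def by blast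
qed


section \<open>A Trudinger inequality for averages over cones\<close>

text \<open>A form of Young's inequality, from the two regimes \<open>a m \<le> 1\<close> and \<open>a m \<ge> 1\<close>.  The free parameter \<open>m\<close>
  balances the two terms differently at each distance.\<close>

lemma le_power_plus_inverse:
  fixes a m :: real
  assumes "a \<ge> 0" "m > 0" "n \<ge> 1"
  shows "a \<le> m^(n-1) * a^n + 1/m"
proof (cases "a * m \<le> 1")
  case True
  then have "a \<le> 1/m" using assms by (simp add: field_simps)
  moreover have "0 \<le> m^(n-1) * a^n" using assms by simp
  ultimately show ?thesis by linarith
next
  case False
  have "1 \<le> (a*m)^(n-1)" using False by (intro one_le_power) simp
  then have "a * 1 \<le> a * (a*m)^(n-1)" using assms(1) by (rule mult_left_mono)
  also have "\<dots> = m^(n-1) * a^n"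
    using assms by (cases n) (auto simp: power_mult_distrib)
  finally show ?thesis using assms by (simp add: add_increasing2)
qed

lemma nn_integral_lincomb:
  assumes "f \<in> borel_measurable M" "g \<in> borel_measurable M"
  shows "(\<integral>\<^sup>+x. a * f x + b * g x \<partial>M) = a * integral\<^sup>N M f + b * integral\<^sup>N M g"
  using assms by (simp add: nn_integral_add nn_integral_cmult)

text \<open>The integral of \<open>g\<close> along the rays \<open>x + s z\<close>, with \<open>s\<close> restricted to \<open>S\<close> and the direction \<open>z\<close> averaged
  over the unit ball (not normalised).  For \<open>S = {0<..}\<close> it is the Riesz potential
  \<open>\<integral> g(y) |x - y|^(1-n) dy / n\<close>, written in the form in which the fundamental theorem of calculus yields it.\<close>

definition cone_average :: "('a::euclidean_space \<Rightarrow> real) \<Rightarrow> real set \<Rightarrow> 'a \<Rightarrow> ennreal" where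
  "cone_average g S x =
     (\<integral>\<^sup>+s. (\<integral>\<^sup>+z. ennreal (g (x + s *\<^sub>R z) * norm z) * indicator (cball 0 1) z \<partial>lborel) * indicator S s \<partial>lborel)"

text \<open>Young's inequality with \<open>m = \<delta>\<close> turns the integrand into \<open>\<delta>^(n-1) g^n + 1/\<delta>\<close>.  After Fubini and a
  translation, both terms contribute a multiple of \<open>\<delta>^n\<close>.\<close>

lemma cone_average_near:
  fixes g :: "'a::euclidean_space \<Rightarrow> real"
  assumes g[measurable]: "g \<in> borel_measurable borel" and g0: "\<And>x. g x \<ge> 0"
    and M: "(\<integral>\<^sup>+x. ennreal (g x ^ DIM('a)) \<partial>lborel) \<le> ennreal M" "M \<ge> 0"
    and A[measurable]: "A \<in> sets borel" and A': "emeasure lborel A = ennreal (\<delta> ^ DIM('a))" and \<delta>: "\<delta> > 0"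
  shows "(\<integral>\<^sup>+x. cone_average g {0<..<\<delta>} x * indicator A x \<partial>lborel)
    \<le> ennreal (unit_ball_vol DIM('a) * (M + 1) * \<delta> ^ DIM('a))"
proof -
  define n where "n = DIM('a)"
  have n1: "n \<ge> 1" by (simp add: n_def Suc_le_eq)
  define \<omega> where "\<omega> = unit_ball_vol (real n)"
  have \<omega>: "emeasure lborel (cball (0::'a) 1) = ennreal \<omega>" "\<omega> > 0"
    by (auto simp: \<omega>_def n_def emeasure_cball)
  define F where "F s z x = ennreal (\<delta>^(n-1) * g (x + s *\<^sub>R z)^n + 1/\<delta>) * indicator A x" for s z x
  have [measurable]: "cball (0::'a) 1 \<in> sets borel" by simp
  have "(\<integral>\<^sup>+x. cone_average g {0<..<\<delta>} x * indicator A x \<partial>lborel)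
    \<le> (\<integral>\<^sup>+x. (\<integral>\<^sup>+s. (\<integral>\<^sup>+z. F s z x * indicator (cball 0 1) z \<partial>lborel) * indicator {0<..<\<delta>} s \<partial>lborel) \<partial>lborel)"
  proof (rule nn_integral_mono)
    fix x
    have *: "ennreal (g (x + s *\<^sub>R z) * norm z) * indicator A x * indicator (cball 0 1) z
        \<le> F s z x * indicator (cball 0 1) z" for s :: real and z
    proof (cases "norm z \<le> 1")
      case True
      have "g (x + s *\<^sub>R z) * norm z \<le> g (x + s *\<^sub>R z)"
        using True g0 by (simp add: mult_left_le)
      also have "\<dots> \<le> \<delta>^(n-1) * g (x + s *\<^sub>R z)^n + 1/\<delta>"
        using le_power_plus_inverse[OF g0 \<delta> n1] .
      finally show ?thesis unfolding F_def by (intro mult_right_mono ennreal_leI) auto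
    qed simp
    have "cone_average g {0<..<\<delta>} x * indicator A x =
      (\<integral>\<^sup>+s. (\<integral>\<^sup>+z. ennreal (g (x + s *\<^sub>R z) * norm z) * indicator A x * indicator (cball 0 1) z \<partial>lborel) * indicator {0<..<\<delta>} s \<partial>lborel)"
      unfolding cone_average_def by (cases "x \<in> A") auto
    also have "\<dots> \<le> (\<integral>\<^sup>+s. (\<integral>\<^sup>+z. F s z x * indicator (cball 0 1) z \<partial>lborel) * indicator {0<..<\<delta>} s \<partial>lborel)"
      by (rule nn_integral_mono, rule mult_right_mono[OF nn_integral_mono[OF *]]) simp
    finally show "cone_average g {0<..<\<delta>} x * indicator A x
      \<le> (\<integral>\<^sup>+s. (\<integral>\<^sup>+z. F s z x * indicator (cball 0 1) z \<partial>lborel) * indicator {0<..<\<delta>} s \<partial>lborel)" .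
  qed
  also have "\<dots> = (\<integral>\<^sup>+s. (\<integral>\<^sup>+x. (\<integral>\<^sup>+z. F s z x * indicator (cball 0 1) z \<partial>lborel) * indicator {0<..<\<delta>} s \<partial>lborel) \<partial>lborel)"
    unfolding F_def by (rule lborel_pair.Fubini') measurable
  also have "\<dots> = (\<integral>\<^sup>+s. (\<integral>\<^sup>+x. (\<integral>\<^sup>+z. F s z x * indicator (cball 0 1) z \<partial>lborel) \<partial>lborel) * indicator {0<..<\<delta>} s \<partial>lborel)"
    unfolding F_def by (intro nn_integral_cong nn_integral_multc) measurable
  also have "\<dots> = (\<integral>\<^sup>+s. (\<integral>\<^sup>+z. (\<integral>\<^sup>+x. F s z x \<partial>lborel) * indicator (cball 0 1) z \<partial>lborel) * indicator {0<..<\<delta>} s \<partial>lborel)"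
  proof -
    have "(\<integral>\<^sup>+x. (\<integral>\<^sup>+z. F s z x * indicator (cball 0 1) z \<partial>lborel) \<partial>lborel)
       = (\<integral>\<^sup>+z. (\<integral>\<^sup>+x. F s z x * indicator (cball 0 1) z \<partial>lborel) \<partial>lborel)" for s
      unfolding F_def by (rule lborel_pair.Fubini') measurable
    also have "\<dots> s = (\<integral>\<^sup>+z. (\<integral>\<^sup>+x. F s z x \<partial>lborel) * indicator (cball 0 1) z \<partial>lborel)" for s
      unfolding F_def by (intro nn_integral_cong nn_integral_multc) measurable
    finally show ?thesis by simp
  qed
  also have "\<dots> \<le> (\<integral>\<^sup>+s. (\<integral>\<^sup>+z. ennreal (\<delta>^(n-1) * M + \<delta>^n/\<delta>) * indicator (cball (0::'a) 1) z \<partial>lborel) * indicator {0<..<\<delta>} s \<partial>lborel)"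
  proof (rule nn_integral_mono, rule mult_right_mono, rule nn_integral_mono, rule mult_right_mono)
    fix s :: real and z :: 'a
    have "(\<integral>\<^sup>+x. F s z x \<partial>lborel) \<le> (\<integral>\<^sup>+x. ennreal (\<delta>^(n-1)) * ennreal (g (x + s *\<^sub>R z)^n) + ennreal (1/\<delta>) * indicator A x \<partial>lborel)"
      unfolding F_def using \<delta> g0
      by (intro nn_integral_mono) (auto simp: indicator_def simp flip: ennreal_mult ennreal_plus)
    also have "\<dots> = ennreal (\<delta>^(n-1)) * (\<integral>\<^sup>+x. ennreal (g (x + s *\<^sub>R z)^n) \<partial>lborel) + ennreal (1/\<delta>) * ennreal (\<delta>^n)"
      by (simp add: nn_integral_add nn_integral_cmult A' n_def)
    also have "(\<integral>\<^sup>+x. ennreal (g (x + s *\<^sub>R z)^n) \<partial>lborel) = (\<integral>\<^sup>+x. ennreal (g x^n) \<partial>lborel)"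
      by (subst nn_integral_affine[of _ 1 "s *\<^sub>R z"]) (auto simp: add.commute)
    also have "ennreal (\<delta>^(n-1)) * (\<integral>\<^sup>+x. ennreal (g x^n) \<partial>lborel) + ennreal (1/\<delta>) * ennreal (\<delta>^n)
       \<le> ennreal (\<delta>^(n-1)) * ennreal M + ennreal (1/\<delta>) * ennreal (\<delta>^n)"
      using M(1) unfolding n_def by (intro add_mono mult_left_mono) auto
    also have "\<dots> = ennreal (\<delta>^(n-1) * M + \<delta>^n/\<delta>)"
      using \<delta> M(2) by (simp flip: ennreal_mult ennreal_plus)
    finally show "(\<integral>\<^sup>+x. F s z x \<partial>lborel) \<le> ennreal (\<delta>^(n-1) * M + \<delta>^n/\<delta>)" .
  qed auto
  also have "\<dots> = ennreal (\<delta>^(n-1) * M + \<delta>^n/\<delta>) * ennreal \<omega> * ennreal \<delta>"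
    using \<delta> by (simp add: nn_integral_cmult_indicator \<omega>(1))
  also have "\<dots> = ennreal (\<omega> * (M + 1) * \<delta>^n)"
  proof -
    have "(\<delta>^(n-1) * M + \<delta>^n/\<delta>) * \<omega> * \<delta> = \<omega> * (M + 1) * \<delta>^n"
      using \<delta> n1 by (cases n) (auto simp: field_simps)
    moreover have "\<delta>^(n-1) * M + \<delta>^n/\<delta> \<ge> 0" using \<delta> M(2) by simp
    then have "ennreal (\<delta>^(n-1) * M + \<delta>^n/\<delta>) * ennreal \<omega> * ennreal \<delta> = ennreal ((\<delta>^(n-1) * M + \<delta>^n/\<delta>) * \<omega> * \<delta>)"
      using \<delta> \<omega>(2) by (simp flip: ennreal_mult)
    ultimately show ?thesis by (simp only:)
  qed
  finally show ?thesis unfolding n_def \<omega>_def .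
qed

lemma nn_integral_inverse_power_tail:
  assumes "r > 0" "n \<ge> 1"
  shows "(\<integral>\<^sup>+s. ennreal (1 / s^(n+1)) * indicator {r..} s \<partial>lborel) = ennreal (1 / (n * r^n))"
proof -
  have "((\<lambda>s::real. 1 / (real n * s^n)) \<longlongrightarrow> 0) at_top"
    using assms by (intro real_tendsto_divide_at_top tendsto_const filterlim_tendsto_pos_mult_at_top[OF tendsto_const]
      filterlim_pow_at_top filterlim_ident) auto
  from tendsto_minus[OF this] have lim: "((\<lambda>s::real. - (1 / (real n * s^n))) \<longlongrightarrow> 0) at_top" by simp
  have d: "((\<lambda>s::real. - (1 / (real n * s^n))) has_real_derivative 1 / x^(n+1)) (at x)" if "r \<le> x" for x
  proof -
    obtain m where n: "n = Suc m" using assms(2) by (cases n) auto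
    have x: "x \<noteq> 0" using that assms by simp
    have "((\<lambda>s. - (1/n) * inverse (s^n)) has_real_derivative
        - (1/n) * (- (inverse (x^n) * (real n * x^(n - Suc 0)) * inverse (x^n)))) (at x)"
      using x by (intro DERIV_cmult DERIV_inverse' DERIV_pow) auto
    also have "- (1/n) * (- (inverse (x^n) * (real n * x^(n - Suc 0)) * inverse (x^n))) = 1 / x^(n+1)"
      using x by (simp add: n divide_inverse del: of_nat_Suc)
    also have "(\<lambda>s. - (1/n) * inverse (s^n)) = (\<lambda>s::real. - (1 / (real n * s^n)))"
      by (simp add: divide_inverse)
    finally show ?thesis .
  qed
  show ?thesis
  proof -
    have "(\<integral>\<^sup>+s. ennreal (1 / s^(n+1)) * indicator {r..} s \<partial>lborel) = ennreal (0 - (- (1 / (real n * r^n))))"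
      by (rule nn_integral_FTC_atLeast[OF _ d _ lim]) (use assms in auto)
    then show ?thesis by simp
  qed
qed

lemma nn_integral_ball_dilation:
  fixes F :: "'a::euclidean_space \<Rightarrow> ennreal"
  assumes [measurable]: "F \<in> borel_measurable borel" and s: "s > 0"
  shows "(\<integral>\<^sup>+z. F (x + s *\<^sub>R z) * indicator (cball 0 1) z \<partial>lborel)
     = ennreal (1 / s^DIM('a)) * (\<integral>\<^sup>+y. F y * indicator (cball x s) y \<partial>lborel)"
proof -
  have [measurable]: "cball x s \<in> sets borel" by simp
  have "(\<integral>\<^sup>+y. F y * indicator (cball x s) y \<partial>lborel)
    = ennreal (s^DIM('a)) * (\<integral>\<^sup>+z. F (x + s *\<^sub>R z) * indicator (cball x s) (x + s *\<^sub>R z) \<partial>lborel)"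
    using s by (subst nn_integral_affine[of _ s x]) simp_all
  also have "(\<lambda>z. indicator (cball x s) (x + s *\<^sub>R z) :: ennreal) = indicator (cball 0 1)"
    using s by (auto simp: indicator_def dist_norm mult_le_cancel_left1)
  finally have "ennreal (1 / s^DIM('a)) * (\<integral>\<^sup>+y. F y * indicator (cball x s) y \<partial>lborel)
    = ennreal (1 / s^DIM('a)) * ennreal (s^DIM('a)) * (\<integral>\<^sup>+z. F (x + s *\<^sub>R z) * indicator (cball 0 1) z \<partial>lborel)"
    by (metis (no_types, lifting) mult.assoc nn_integral_cong)
  then show ?thesis using s by (simp flip: ennreal_mult')
qed

text \<open>Young's inequality is applied at distance \<open>s\<close> with \<open>m = s L^(1/n)\<close>.  The first term is then
  \<open>L^((n-1)/n)\<close> times an integral that collapses to \<open>\<integral> g^n\<close> (\<open>T1\<close>).  The second is \<open>L^(-1/n)\<close> times the integral of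
  \<open>ds/s\<close> weighted by the share of the ball of radius \<open>s\<close> that lies in \<open>\<Omega>\<close>; it is of order \<open>L\<close>, because beyond the
  radius \<open>\<rho>\<close> this share decays (\<open>T2\<close>).\<close>

lemma cone_average_far:
  fixes g :: "'a::euclidean_space \<Rightarrow> real"
  assumes n2: "DIM('a) \<ge> 2"
    and g[measurable]: "g \<in> borel_measurable borel" and g0: "\<And>x. g x \<ge> 0"
    and M: "(\<integral>\<^sup>+x. ennreal (g x ^ DIM('a)) \<partial>lborel) \<le> ennreal M" "M \<ge> 0"
    and \<Omega>[measurable]: "\<Omega> \<in> sets borel" and \<Omega>': "emeasure lborel \<Omega> = ennreal (\<rho> ^ DIM('a))"
    and supp: "\<And>x. x \<notin> \<Omega> \<Longrightarrow> g x = 0"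
    and \<delta>: "0 < \<delta>" "\<delta> \<le> \<rho>"
    and L: "L = 1 + ln (\<rho> / \<delta>)"
  shows "cone_average g {\<delta>..} x
    \<le> ennreal ((M + unit_ball_vol DIM('a) + 1) * L powr ((real DIM('a) - 1) / real DIM('a)))"
proof -
  define n where "n = DIM('a)"
  have [measurable]: "cball (0::'a) 1 \<in> sets borel" by simp
  have n2: "n \<ge> 2" using n2 by (simp add: n_def)
  define \<omega> where "\<omega> = unit_ball_vol (real n)"
  have \<omega>: "\<omega> > 0" by (auto simp: \<omega>_def)
  have L1: "L \<ge> 1" using \<delta> L by simp
  define \<Lambda> where "\<Lambda> = L powr (1/n)"
  have \<Lambda>: "\<Lambda> \<ge> 1" "\<Lambda>^(n-1) = L powr ((real n - 1) / n)" "L / \<Lambda> = L powr ((real n - 1) / n)"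
  proof -
    show "\<Lambda> \<ge> 1" unfolding \<Lambda>_def using L1 by (simp add: ge_one_powr_ge_zero)
    show "\<Lambda>^(n-1) = L powr ((real n - 1) / n)"
      unfolding \<Lambda>_def using L1 n2 by (simp add: powr_power of_nat_diff)
    have "L powr ((real n - 1) / n) = L powr (1 - 1/n)" using n2 by (simp add: diff_divide_distrib)
    then show "L / \<Lambda> = L powr ((real n - 1) / n)"
      unfolding \<Lambda>_def using L1 by (simp add: powr_diff)
  qed
  \<comment> \<open>points outside \<open>\<Omega>\<close> contribute nothing, which is why the second term carries the indicator of \<open>\<Omega>\<close>\<close>
  have step: "ennreal (g (x + s *\<^sub>R z) * norm z) * indicator (cball 0 1) z
     \<le> ennreal (\<Lambda>^(n-1)) * (ennreal (s^(n-1) / s^n) * (ennreal (g (x + s *\<^sub>R z)^n * norm (x + s *\<^sub>R z - x)^n) * indicator (cball 0 1) z))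
      + ennreal (1 / (s * \<Lambda>)) * (indicator \<Omega> (x + s *\<^sub>R z) * indicator (cball 0 1) z)" if "s \<ge> \<delta>" for s and z :: 'a
  proof (cases "norm z \<le> 1 \<and> x + s *\<^sub>R z \<in> \<Omega>")
    case True
    have s: "s > 0" using that \<delta> by simp
    have "g (x + s *\<^sub>R z) * norm z \<le> (s * \<Lambda>)^(n-1) * (g (x + s *\<^sub>R z) * norm z)^n + 1 / (s * \<Lambda>)"
      using s \<Lambda> g0 n2 by (intro le_power_plus_inverse) auto
    also have "(s * \<Lambda>)^(n-1) * (g (x + s *\<^sub>R z) * norm z)^n = \<Lambda>^(n-1) * (s^(n-1) / s^n * (g (x + s *\<^sub>R z)^n * norm (x + s *\<^sub>R z - x)^n))"
      using s by (simp add: power_mult_distrib)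
    finally have "ennreal (g (x + s *\<^sub>R z) * norm z) \<le> ennreal (\<Lambda>^(n-1) * (s^(n-1) / s^n * (g (x + s *\<^sub>R z)^n * norm (x + s *\<^sub>R z - x)^n)) + 1 / (s * \<Lambda>))"
      by (rule ennreal_leI)
    also have "\<dots> = ennreal (\<Lambda>^(n-1)) * (ennreal (s^(n-1) / s^n) * ennreal (g (x + s *\<^sub>R z)^n * norm (x + s *\<^sub>R z - x)^n)) + ennreal (1 / (s * \<Lambda>))"
      using s \<Lambda>(1) g0 by (simp flip: ennreal_mult ennreal_plus)
    finally show ?thesis using True by simp
  next
    case False
    then show ?thesis using supp by auto
  qed
  define G where "G y = ennreal (g y^n * norm (y - x)^n)" for y
  have [measurable]: "G \<in> borel_measurable borel" unfolding G_def by measurable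
  define T1 where "T1 = (\<integral>\<^sup>+s. (ennreal (s^(n-1) / s^n) * (\<integral>\<^sup>+z. G (x + s *\<^sub>R z) * indicator (cball 0 1) z \<partial>lborel)) * indicator {\<delta>..} s \<partial>lborel)"
  define T2 where "T2 = (\<integral>\<^sup>+s. (ennreal (1/s) * (\<integral>\<^sup>+z. indicator \<Omega> (x + s *\<^sub>R z) * indicator (cball 0 1) z \<partial>lborel)) * indicator {\<delta>..} s \<partial>lborel)"
  have "cone_average g {\<delta>..} x \<le> (\<integral>\<^sup>+s. (\<integral>\<^sup>+z. ennreal (\<Lambda>^(n-1)) * (ennreal (s^(n-1) / s^n) * (G (x + s *\<^sub>R z) * indicator (cball 0 1) z))
      + ennreal (1 / (s * \<Lambda>)) * (indicator \<Omega> (x + s *\<^sub>R z) * indicator (cball 0 1) z) \<partial>lborel) * indicator {\<delta>..} s \<partial>lborel)"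
    unfolding cone_average_def
  proof (intro nn_integral_mono)
    fix s :: real
    show "(\<integral>\<^sup>+ z. ennreal (g (x + s *\<^sub>R z) * norm z) * indicator (cball 0 1) z \<partial>lborel) * indicator {\<delta>..} s \<le>
      (\<integral>\<^sup>+z. ennreal (\<Lambda>^(n-1)) * (ennreal (s^(n-1) / s^n) * (G (x + s *\<^sub>R z) * indicator (cball 0 1) z))
      + ennreal (1 / (s * \<Lambda>)) * (indicator \<Omega> (x + s *\<^sub>R z) * indicator (cball 0 1) z) \<partial>lborel) * indicator {\<delta>..} s"
    proof (cases "s \<ge> \<delta>")
      case True
      then show ?thesis unfolding G_def by (intro mult_right_mono nn_integral_mono step) auto
    qed auto
  qed
  also have "\<dots> = (\<integral>\<^sup>+s. ennreal (\<Lambda>^(n-1)) * ((ennreal (s^(n-1) / s^n) * (\<integral>\<^sup>+z. G (x + s *\<^sub>R z) * indicator (cball 0 1) z \<partial>lborel)) * indicator {\<delta>..} s)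
      + ennreal (1 / \<Lambda>) * ((ennreal (1/s) * (\<integral>\<^sup>+z. indicator \<Omega> (x + s *\<^sub>R z) * indicator (cball 0 1) z \<partial>lborel)) * indicator {\<delta>..} s) \<partial>lborel)"
  proof (intro nn_integral_cong)
    fix s :: real
    have e: "ennreal (1 / (s * \<Lambda>)) = ennreal (1 / \<Lambda>) * ennreal (1/s)" if "s \<ge> \<delta>"
      using that \<delta> \<Lambda>(1) by (simp flip: ennreal_mult)
    show "(\<integral>\<^sup>+z. ennreal (\<Lambda>^(n-1)) * (ennreal (s^(n-1) / s^n) * (G (x + s *\<^sub>R z) * indicator (cball 0 1) z))
      + ennreal (1 / (s * \<Lambda>)) * (indicator \<Omega> (x + s *\<^sub>R z) * indicator (cball 0 1) z) \<partial>lborel) * indicator {\<delta>..} s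
      = ennreal (\<Lambda>^(n-1)) * ((ennreal (s^(n-1) / s^n) * (\<integral>\<^sup>+z. G (x + s *\<^sub>R z) * indicator (cball 0 1) z \<partial>lborel)) * indicator {\<delta>..} s)
      + ennreal (1 / \<Lambda>) * ((ennreal (1/s) * (\<integral>\<^sup>+z. indicator \<Omega> (x + s *\<^sub>R z) * indicator (cball 0 1) z \<partial>lborel)) * indicator {\<delta>..} s)"
    proof (cases "s \<ge> \<delta>")
      case True
      have "(\<integral>\<^sup>+z. ennreal (\<Lambda>^(n-1)) * (ennreal (s^(n-1) / s^n) * (G (x + s *\<^sub>R z) * indicator (cball 0 1) z))
        + ennreal (1 / (s * \<Lambda>)) * (indicator \<Omega> (x + s *\<^sub>R z) * indicator (cball 0 1) z) \<partial>lborel)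
       = ennreal (\<Lambda>^(n-1)) * (ennreal (s^(n-1) / s^n) * (\<integral>\<^sup>+z. G (x + s *\<^sub>R z) * indicator (cball 0 1) z \<partial>lborel))
        + ennreal (1 / (s * \<Lambda>)) * (\<integral>\<^sup>+z. indicator \<Omega> (x + s *\<^sub>R z) * indicator (cball 0 1) z \<partial>lborel)"
      proof -
        have "(\<integral>\<^sup>+z. ennreal (s^(n-1) / s^n) * (G (x + s *\<^sub>R z) * indicator (cball 0 1) z) \<partial>lborel)
          = ennreal (s^(n-1) / s^n) * (\<integral>\<^sup>+z. G (x + s *\<^sub>R z) * indicator (cball 0 1) z \<partial>lborel)"
          by (rule nn_integral_cmult) measurable
        moreover have "(\<lambda>z. ennreal (s^(n-1) / s^n) * (G (x + s *\<^sub>R z) * indicator (cball 0 1) z)) \<in> borel_measurable lborel"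
          "(\<lambda>z. indicator \<Omega> (x + s *\<^sub>R z) * indicator (cball 0 1) z :: ennreal) \<in> borel_measurable lborel"
          by measurable
        ultimately show ?thesis by (simp only: nn_integral_lincomb)
      qed
      then show ?thesis using True unfolding e[OF True] by (simp add: mult.assoc)
    qed simp
  qed
  also have "\<dots> = ennreal (\<Lambda>^(n-1)) * T1 + ennreal (1 / \<Lambda>) * T2"
    unfolding T1_def T2_def by (rule nn_integral_lincomb) measurable
  \<comment> \<open>substitute \<open>y = x + s z\<close> and integrate over \<open>s \<ge> |y - x|\<close> first\<close>
  also have "T1 \<le> ennreal M"
  proof -
    have "T1 \<le> (\<integral>\<^sup>+s. (\<integral>\<^sup>+y. G y * (ennreal (1 / s^(n+1)) * (indicator (cball x s) y * indicator {\<delta>..} s)) \<partial>lborel) \<partial>lborel)"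
      unfolding T1_def
    proof (intro nn_integral_mono)
      fix s :: real
      show "ennreal (s^(n-1) / s^n) * (\<integral>\<^sup>+z. G (x + s *\<^sub>R z) * indicator (cball 0 1) z \<partial>lborel) * indicator {\<delta>..} s
        \<le> (\<integral>\<^sup>+y. G y * (ennreal (1 / s^(n+1)) * (indicator (cball x s) y * indicator {\<delta>..} s)) \<partial>lborel)"
      proof (cases "s \<ge> \<delta>")
        case True
        then have s: "s > 0" using \<delta> by simp
        have "ennreal (s^(n-1) / s^n) * (ennreal (1 / s^n) * I) = ennreal (1 / s^(n+1)) * I" for I
        proof -
          have "s^(n-1) / s^n * (1 / s^n) = 1 / s^(n+1)" using s n2 by (cases n) auto
          then show ?thesis using s by (simp flip: ennreal_mult mult.assoc)
        qed
        then have "ennreal (s^(n-1) / s^n) * (\<integral>\<^sup>+z. G (x + s *\<^sub>R z) * indicator (cball 0 1) z \<partial>lborel)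
           = ennreal (1 / s^(n+1)) * (\<integral>\<^sup>+y. G y * indicator (cball x s) y \<partial>lborel)"
          by (subst nn_integral_ball_dilation[OF _ s]) (simp_all add: n_def)
        moreover have [measurable]: "cball x s \<in> sets borel" by simp
        have "ennreal (1 / s^(n+1)) * (\<integral>\<^sup>+y. G y * indicator (cball x s) y \<partial>lborel)
          = (\<integral>\<^sup>+y. ennreal (1 / s^(n+1)) * (G y * indicator (cball x s) y) \<partial>lborel)"
          by (rule nn_integral_cmult[symmetric]) measurable
        ultimately show ?thesis using True by (simp add: mult_ac)
      qed auto
    qed
    also have "\<dots> = (\<integral>\<^sup>+y. (\<integral>\<^sup>+s. G y * (ennreal (1 / s^(n+1)) * (indicator (cball x s) y * indicator {\<delta>..} s)) \<partial>lborel) \<partial>lborel)"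
    proof (rule lborel_pair.Fubini')
      have "(\<lambda>p::'a \<times> real. indicator (cball x (snd p)) (fst p) :: ennreal) = (\<lambda>p. indicator {p. dist x (fst p) \<le> snd p} p)"
        by (auto simp: indicator_def)
      moreover have "{p::'a \<times> real. dist x (fst p) \<le> snd p} \<in> sets borel"
        by (intro borel_closed closed_Collect_le continuous_intros)
      then have "(\<lambda>p::'a \<times> real. indicator {p. dist x (fst p) \<le> snd p} p :: ennreal) \<in> borel_measurable (borel \<Otimes>\<^sub>M borel)"
        by (simp add: borel_prod)
      ultimately have [measurable]: "(\<lambda>p::'a \<times> real. indicator (cball x (snd p)) (fst p) :: ennreal) \<in> borel_measurable (lborel \<Otimes>\<^sub>M lborel)"
        by simp
      show "(\<lambda>(y, s). G y * (ennreal (1 / s ^ (n + 1)) * (indicator (cball x s) y * indicator {\<delta>..} s))) \<in> borel_measurable (lborel \<Otimes>\<^sub>M lborel)"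
        unfolding case_prod_beta by measurable
    qed
    also have "\<dots> \<le> (\<integral>\<^sup>+y. ennreal (g y^n) \<partial>lborel)"
    proof (rule nn_integral_mono)
      fix y
      show "(\<integral>\<^sup>+s. G y * (ennreal (1 / s^(n+1)) * (indicator (cball x s) y * indicator {\<delta>..} s)) \<partial>lborel) \<le> ennreal (g y^n)"
      proof (cases "y = x")
        case True
        then show ?thesis using n2 by (simp add: G_def power_0_left)
      next
        case False
        define r where "r = norm (y - x)"
        have r: "r > 0" using False by (simp add: r_def)
        have "(\<integral>\<^sup>+s. G y * (ennreal (1 / s^(n+1)) * (indicator (cball x s) y * indicator {\<delta>..} s)) \<partial>lborel)
           \<le> (\<integral>\<^sup>+s. G y * (ennreal (1 / s^(n+1)) * indicator {r..} s) \<partial>lborel)"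
          by (intro nn_integral_mono mult_left_mono) (auto simp: indicator_def r_def dist_norm norm_minus_commute)
        also have "\<dots> = G y * ennreal (1 / (n * r^n))"
          using n2 by (subst nn_integral_cmult) (simp_all add: nn_integral_inverse_power_tail[OF r, of n, simplified])
        also have "\<dots> = ennreal (g y^n / n)"
          using r g0 by (simp add: G_def r_def[symmetric] flip: ennreal_mult)
        also have "\<dots> \<le> ennreal (g y^n)"
        proof (rule ennreal_leI)
          have "g y^n / n \<le> g y^n / 1" using n2 g0[of y] by (intro divide_left_mono) auto
          then show "g y^n / n \<le> g y^n" by simp
        qed
        finally show ?thesis .
      qed
    qed
    also have "\<dots> \<le> ennreal M" using M unfolding n_def by simp
    finally show ?thesis .
  qed
  also have "T2 \<le> ennreal (\<omega> * ln (\<rho>/\<delta>) + 1)"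
  proof -
    have "T2 \<le> (\<integral>\<^sup>+s. ennreal \<omega> * (ennreal (1/s) * indicator {\<delta>..\<rho>} s) + ennreal (\<rho>^n) * (ennreal (1 / s^(n+1)) * indicator {\<rho>..} s) \<partial>lborel)"
      unfolding T2_def
    proof (intro nn_integral_mono)
      fix s :: real
      define J where "J = (\<integral>\<^sup>+z. indicator \<Omega> (x + s *\<^sub>R z) * indicator (cball 0 1) z \<partial>lborel)"
      have "J \<le> (\<integral>\<^sup>+z. indicator (cball (0::'a) 1) z \<partial>lborel)"
        unfolding J_def by (intro nn_integral_mono) (auto simp: indicator_def)
      then have J1: "J \<le> ennreal \<omega>" by (simp add: emeasure_cball \<omega>_def n_def)
      \<comment> \<open>for large \<open>s\<close> the set \<open>\<Omega>\<close> meets at most a set of directions of measure \<open>(\<rho>/s)^n\<close>\<close>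
      have J2: "J \<le> ennreal (1/s^n) * ennreal (\<rho>^n)" if "s > 0"
      proof -
        have "J = ennreal (1/s^n) * (\<integral>\<^sup>+y. indicator \<Omega> y * indicator (cball x s) y \<partial>lborel)"
          unfolding J_def n_def by (rule nn_integral_ball_dilation[OF _ that]) simp
        also have "(\<integral>\<^sup>+y. indicator \<Omega> y * indicator (cball x s) y \<partial>lborel) \<le> (\<integral>\<^sup>+y. indicator \<Omega> y \<partial>lborel)"
          by (intro nn_integral_mono) (auto simp: indicator_def)
        finally show ?thesis using \<Omega>' by (simp add: n_def mult_left_mono)
      qed
      show "ennreal (1/s) * J * indicator {\<delta>..} s \<le> ennreal \<omega> * (ennreal (1/s) * indicator {\<delta>..\<rho>} s) + ennreal (\<rho>^n) * (ennreal (1 / s^(n+1)) * indicator {\<rho>..} s)"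
      proof (cases "s \<ge> \<delta>")
        case True
        then have s: "s > 0" using \<delta> by simp
        show ?thesis
        proof (cases "s \<le> \<rho>")
          case True
          then show ?thesis using mult_left_mono[OF J1, of "ennreal (1/s)"] \<open>s \<ge> \<delta>\<close>
            by (auto simp: mult.commute intro: add_increasing2)
        next
          case False
          have "ennreal (1/s) * J \<le> ennreal (1/s) * (ennreal (1/s^n) * ennreal (\<rho>^n))"
            using J2[OF s] by (intro mult_left_mono) auto
          also have "\<dots> = ennreal (\<rho>^n) * ennreal (1 / s^(n+1))"
            using s \<delta> by (simp add: mult_ac flip: ennreal_mult)
          finally show ?thesis using False True by simp
        qed
      qed auto
    qed
    also have "\<dots> = ennreal \<omega> * (\<integral>\<^sup>+s. ennreal (1/s) * indicator {\<delta>..\<rho>} s \<partial>lborel) + ennreal (\<rho>^n) * (\<integral>\<^sup>+s. ennreal (1 / s^(n+1)) * indicator {\<rho>..} s \<partial>lborel)"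
      by (subst nn_integral_add) (simp_all add: nn_integral_cmult)
    also have "(\<integral>\<^sup>+s. ennreal (1/s) * indicator {\<delta>..\<rho>} s \<partial>lborel) = ennreal (ln \<rho> - ln \<delta>)"
      using \<delta> by (intro nn_integral_FTC_Icc) (auto intro!: derivative_eq_intros)
    also have "(\<integral>\<^sup>+s. ennreal (1 / s^(n+1)) * indicator {\<rho>..} s \<partial>lborel) = ennreal (1 / (n * \<rho>^n))"
      using \<delta> n2 by (intro nn_integral_inverse_power_tail) auto
    also have "ennreal \<omega> * ennreal (ln \<rho> - ln \<delta>) + ennreal (\<rho>^n) * ennreal (1 / (n * \<rho>^n)) = ennreal (\<omega> * ln (\<rho>/\<delta>) + 1/n)"
      using \<delta> \<omega> by (simp add: ln_div flip: ennreal_mult ennreal_plus)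
    also have "\<dots> \<le> ennreal (\<omega> * ln (\<rho>/\<delta>) + 1)" using n2 by (intro ennreal_leI) simp
    finally show ?thesis .
  qed
  also have "ennreal (\<Lambda>^(n-1)) * ennreal M + ennreal (1 / \<Lambda>) * ennreal (\<omega> * ln (\<rho>/\<delta>) + 1)
     = ennreal (\<Lambda>^(n-1) * M + 1 / \<Lambda> * (\<omega> * ln (\<rho>/\<delta>) + 1))"
    using \<Lambda>(1) M(2) \<omega> \<delta> by (simp flip: ennreal_mult ennreal_plus)
  also have "\<dots> \<le> ennreal ((M + \<omega> + 1) * L powr ((real n - 1) / n))"
  proof (rule ennreal_leI)
    have "\<omega> * ln (\<rho>/\<delta>) + 1 \<le> (\<omega> + 1) * L"
      using L1 \<omega> unfolding L by (simp add: algebra_simps)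
    then have "1 / \<Lambda> * (\<omega> * ln (\<rho>/\<delta>) + 1) \<le> 1 / \<Lambda> * ((\<omega> + 1) * L)"
      using \<Lambda>(1) by (intro mult_left_mono) auto
    also have "\<dots> = (\<omega> + 1) * (L / \<Lambda>)" by simp
    finally show "\<Lambda>^(n-1) * M + 1 / \<Lambda> * (\<omega> * ln (\<rho>/\<delta>) + 1) \<le> (M + \<omega> + 1) * L powr ((real n - 1) / n)"
      unfolding \<Lambda>(2,3) by (simp add: algebra_simps)
  qed
  finally show ?thesis
    unfolding n_def \<omega>_def by (auto simp: add_mono mult_left_mono)
qed

text \<open>The exceptional directions form the line through \<open>x\<close>, a null set in dimension at least two.  This
  lets a function that is differentiable only off the origin be integrated along almost all rays.\<close>

lemma AE_line_avoids_origin: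
  fixes x :: "'a::euclidean_space"
  assumes n2: "DIM('a) \<ge> 2" and x: "x \<noteq> 0"
  shows "AE z in lborel. z \<noteq> 0 \<and> (\<forall>s. x + s *\<^sub>R z \<noteq> 0)"
proof -
  have "dim (span {x}) \<le> 1" by (simp add: dim_span)
  then have "negligible (span {x})" using n2 by (intro negligible_lowdim) simp
  then have "span {x} \<in> null_sets (completion lborel)" by (simp add: negligible_iff_null_sets)
  moreover have "span {x} \<in> sets lborel" by (simp add: borel_closed closed_subspace)
  ultimately have "span {x} \<in> null_sets lborel" by (simp add: null_sets_completion_iff)
  then have "AE z in lborel. z \<notin> span {x}" by (rule AE_not_in)
  then show ?thesis
  proof eventually_elim
    case (elim z)
    have "z \<noteq> 0" using elim span_zero by auto
    moreover have "x + s *\<^sub>R z \<noteq> 0" for s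
    proof
      assume *: "x + s *\<^sub>R z = 0"
      then have "s \<noteq> 0" using x by auto
      then have "z = (1/s) *\<^sub>R (s *\<^sub>R z)" by simp
      also have "s *\<^sub>R z = - x" using * by (simp add: add_eq_0_iff)
      finally have "z \<in> span {x}" by (simp add: span_mul span_neg span_base)
      then show False using elim by simp
    qed
    ultimately show ?case by simp
  qed
qed

lemma ray_integral_bound:
  fixes f g :: "'a::euclidean_space \<Rightarrow> real"
  assumes f: "\<And>y. y \<noteq> 0 \<Longrightarrow> (f has_derivative f' y) (at y)"
    and cont: "continuous_on (-{0}) (\<lambda>y. f' y z)"
    and bound: "\<And>y. y \<noteq> 0 \<Longrightarrow> \<bar>f' y z\<bar> \<le> g y * norm z"
    and supp: "\<And>y. norm y > r \<Longrightarrow> f y = 0"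
    and z: "z \<noteq> 0" "\<And>s. x + s *\<^sub>R z \<noteq> 0"
  shows "ennreal \<bar>f x\<bar> \<le> (\<integral>\<^sup>+s. ennreal (g (x + s *\<^sub>R z) * norm z) * indicator {0<..} s \<partial>lborel)"
proof -
  \<comment> \<open>far enough along the ray to be outside the support of \<open>f\<close>\<close>
  define S where "S = (\<bar>r\<bar> + norm x + 1) / norm z"
  have S: "S > 0" unfolding S_def using z by (intro divide_pos_pos) (auto simp: add_nonneg_pos)
  have "norm (S *\<^sub>R z) = \<bar>r\<bar> + norm x + 1" using S z by (simp add: S_def)
  then have "norm (x + S *\<^sub>R z) > r" using norm_diff_ineq[of "S *\<^sub>R z" x] by (simp add: add.commute)
  then have fS: "f (x + S *\<^sub>R z) = 0" by (rule supp)
  define h where "h s = f' (x + s *\<^sub>R z) z" for s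
  have deriv: "((\<lambda>s. f (x + s *\<^sub>R z)) has_real_derivative h s) (at s)" for s
  proof -
    have "((\<lambda>s. f (x + s *\<^sub>R z)) has_derivative (\<lambda>d. f' (x + s *\<^sub>R z) (d *\<^sub>R z))) (at s)"
      by (rule has_derivative_compose[OF _ f]) (use z in \<open>auto intro!: derivative_eq_intros\<close>)
    then show ?thesis
      using linear_scale[OF has_derivative_linear[OF f[OF z(2)[of s]]]]
      by (simp add: has_field_derivative_def h_def mult_commute_abs)
  qed
  have hc: "continuous_on {0..S} h"
    unfolding h_def
    by (rule continuous_on_compose2[OF cont]) (use z in \<open>auto intro!: continuous_intros\<close>)
  have "has_bochner_integral lborel (\<lambda>s. indicator {0..S} s *\<^sub>R h s) (f (x + S *\<^sub>R z) - f (x + 0 *\<^sub>R z))"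
    by (rule has_bochner_integral_FTC_Icc[OF _ has_vector_derivative_at_within hc])
       (use S deriv in \<open>auto simp: has_real_derivative_iff_has_vector_derivative\<close>)
  then have hb: "integrable lborel (\<lambda>s. indicator {0..S} s *\<^sub>R h s)"
    "(\<integral>s. indicator {0..S} s *\<^sub>R h s \<partial>lborel) = - f x"
    using fS by (auto simp: has_bochner_integral_iff)
  have "ennreal \<bar>f x\<bar> = ennreal (norm (\<integral>s. indicator {0..S} s *\<^sub>R h s \<partial>lborel))" unfolding hb(2) by simp
  also have "\<dots> \<le> (\<integral>\<^sup>+s. ennreal (norm (indicator {0..S} s *\<^sub>R h s)) \<partial>lborel)"
    by (rule integral_norm_bound_ennreal[OF hb(1)])
  also have "\<dots> \<le> (\<integral>\<^sup>+s. ennreal (g (x + s *\<^sub>R z) * norm z) * indicator {0<..} s \<partial>lborel)"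
  proof (rule nn_integral_mono_AE)
    have "AE s in lborel. s \<noteq> (0::real)" by (rule AE_lborel_singleton)
    then show "AE s in lborel. ennreal (norm (indicator {0..S} s *\<^sub>R h s)) \<le> ennreal (g (x + s *\<^sub>R z) * norm z) * indicator {0<..} s"
    proof eventually_elim
      case (elim s)
      then show ?case using bound[OF z(2)[of s]]
        by (cases "0 \<le> s \<and> s \<le> S") (auto simp: h_def intro!: ennreal_leI)
    qed
  qed
  finally show ?thesis .
qed

text \<open>The fundamental theorem of calculus on the rays from \<open>x\<close>, averaged over their directions.\<close>

lemma cone_average_representation:
  fixes f g :: "'a::euclidean_space \<Rightarrow> real"
  assumes n2: "DIM('a) \<ge> 2" and x: "x \<noteq> 0"
    and f: "\<And>y. y \<noteq> 0 \<Longrightarrow> (f has_derivative f' y) (at y)"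
    and cont: "\<And>z. continuous_on (-{0}) (\<lambda>y. f' y z)"
    and bound: "\<And>y z. y \<noteq> 0 \<Longrightarrow> \<bar>f' y z\<bar> \<le> g y * norm z"
    and supp: "\<And>y. norm y > r \<Longrightarrow> f y = 0"
    and g[measurable]: "g \<in> borel_measurable borel"
  shows "ennreal (unit_ball_vol DIM('a) * \<bar>f x\<bar>) \<le> cone_average g {0<..} x"
proof -
  have [measurable]: "cball (0::'a) 1 \<in> sets borel" by simp
  have "ennreal (unit_ball_vol DIM('a) * \<bar>f x\<bar>) = (\<integral>\<^sup>+z. ennreal \<bar>f x\<bar> * indicator (cball (0::'a) 1) z \<partial>lborel)"
    by (simp add: nn_integral_cmult_indicator emeasure_cball ennreal_mult mult.commute)
  also have "\<dots> \<le> (\<integral>\<^sup>+z. (\<integral>\<^sup>+s. ennreal (g (x + s *\<^sub>R z) * norm z) * indicator {0<..} s \<partial>lborel) * indicator (cball 0 1) z \<partial>lborel)"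
  proof (rule nn_integral_mono_AE)
    show "AE z in lborel. ennreal \<bar>f x\<bar> * indicator (cball 0 1) z \<le>
        (\<integral>\<^sup>+s. ennreal (g (x + s *\<^sub>R z) * norm z) * indicator {0<..} s \<partial>lborel) * indicator (cball 0 1) z"
      using AE_line_avoids_origin[OF n2 x]
    proof eventually_elim
      case (elim z)
      then show ?case
        by (intro mult_right_mono ray_integral_bound[OF f cont bound supp]) auto
    qed
  qed
  also have "\<dots> = (\<integral>\<^sup>+z. (\<integral>\<^sup>+s. ennreal (g (x + s *\<^sub>R z) * norm z) * indicator (cball 0 1) z * indicator {0<..} s \<partial>lborel) \<partial>lborel)"
    by (intro nn_integral_cong) (auto split: split_indicator)
  also have "\<dots> = (\<integral>\<^sup>+s. (\<integral>\<^sup>+z. ennreal (g (x + s *\<^sub>R z) * norm z) * indicator (cball 0 1) z * indicator {0<..} s \<partial>lborel) \<partial>lborel)"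
    by (rule lborel_pair.Fubini') measurable
  also have "\<dots> = cone_average g {0<..} x"
    unfolding cone_average_def by (intro nn_integral_cong) (auto split: split_indicator)
  finally show ?thesis .
qed

lemma cone_average_split:
  fixes g :: "'a::euclidean_space \<Rightarrow> real"
  assumes g[measurable]: "g \<in> borel_measurable borel" and \<delta>: "\<delta> > 0"
  shows "cone_average g {0<..} x = cone_average g {0<..<\<delta>} x + cone_average g {\<delta>..} x"
proof -
  have [measurable]: "cball (0::'a) 1 \<in> sets borel" by simp
  show ?thesis unfolding cone_average_def
    using \<delta> by (subst nn_integral_add[symmetric]; (measurable; fail)?)
      (auto intro!: nn_integral_cong split: split_indicator)
qed

text \<open>On the level set \<open>A\<close> of measure \<open>\<delta>^n\<close> the function \<open>f\<close> exceeds \<open>lam\<close>; averaging the representation over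
  \<open>A\<close> gives \<open>lam \<le> C (1 + ln (\<rho>/\<delta>))^((n-1)/n) / \<omega>\<close>.  Solving for \<open>\<delta>\<close> yields the decay of the measure.\<close>

lemma level_set_bound:
  fixes f g :: "'a::euclidean_space \<Rightarrow> real"
  assumes n2: "DIM('a) \<ge> 2" and M0: "M \<ge> 0"
    and f[measurable]: "f \<in> borel_measurable borel"
    and g[measurable]: "g \<in> borel_measurable borel" and g0: "\<And>x. g x \<ge> 0"
    and M: "(\<integral>\<^sup>+x. ennreal (g x ^ DIM('a)) \<partial>lborel) \<le> ennreal M"
    and \<Omega>[measurable]: "\<Omega> \<in> sets borel" and V: "emeasure lborel \<Omega> = ennreal V" "V \<ge> 0"
    and supp: "\<And>x. x \<notin> \<Omega> \<Longrightarrow> g x = 0"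
    and rep: "\<And>x. x \<noteq> 0 \<Longrightarrow> ennreal (unit_ball_vol DIM('a) * \<bar>f x\<bar>) \<le> cone_average g {0<..} x"
    and C: "C = unit_ball_vol DIM('a) * (M + 1) + (M + unit_ball_vol DIM('a) + 1)"
    and lam: "lam > 0"
  shows "emeasure lborel {x\<in>\<Omega>. lam < \<bar>f x\<bar>} \<le> ennreal (V * exp (DIM('a)
     - DIM('a) * (lam * unit_ball_vol DIM('a) / C) powr (real DIM('a) / (real DIM('a) - 1))))"
proof -
  define n where "n = DIM('a)"
  have nn: "n \<ge> 2" using n2 by (simp add: n_def)
  define \<omega> where "\<omega> = unit_ball_vol (real n)"
  have \<omega>: "\<omega> > 0" by (simp add: \<omega>_def)
  define A where "A = {x\<in>\<Omega>. lam < \<bar>f x\<bar>}"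
  have A[measurable]: "A \<in> sets borel" unfolding A_def by measurable
  have AV: "emeasure lborel A \<le> ennreal V"
    unfolding V(1)[symmetric] by (rule emeasure_mono) (auto simp: A_def \<Omega>)
  then have "emeasure lborel A \<noteq> top" by (auto simp: top_unique)
  then obtain \<alpha> where \<alpha>: "emeasure lborel A = ennreal \<alpha>" "\<alpha> \<ge> 0"
    by (cases "emeasure lborel A") auto
  define k where "k = (real n - 1) / real n"
  define p where "p = real n / (real n - 1)"
  \<comment> \<open>the exponents are inverse to each other\<close>
  have kp: "k * p = 1" "p > 0" "k > 0" using nn by (auto simp: k_def p_def)
  have "ennreal \<alpha> \<le> ennreal (V * exp (n - n * (lam * \<omega> / C) powr p))"
  proof (cases "\<alpha> = 0")
    case False
    then have a0: "\<alpha> > 0" using \<alpha> by simp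
    have aV: "\<alpha> \<le> V" using AV V(2) unfolding \<alpha>(1) by (simp add: ennreal_le_iff)
    define \<delta> where "\<delta> = root n \<alpha>"
    define \<rho> where "\<rho> = root n V"
    have \<delta>: "\<delta> > 0" "\<delta>^n = \<alpha>" "\<rho>^n = V" "\<delta> \<le> \<rho>"
      using nn a0 aV by (auto simp: \<delta>_def \<rho>_def)
    define L where "L = 1 + ln (\<rho> / \<delta>)"
    have L1: "L \<ge> 1" using \<delta> by (simp add: L_def)
    define K where "K = L powr k"
    have K1: "K \<ge> 1" unfolding K_def using L1 kp by (intro ge_one_powr_ge_zero) auto
    have "ennreal (\<omega> * lam) * ennreal \<alpha> = (\<integral>\<^sup>+x. ennreal (\<omega> * lam) * indicator A x \<partial>lborel)"
      by (simp add: nn_integral_cmult_indicator \<alpha>)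
    also have "\<dots> \<le> (\<integral>\<^sup>+x. cone_average g {0<..<\<delta>} x * indicator A x + ennreal ((M + \<omega> + 1) * K) * indicator A x \<partial>lborel)"
    proof (rule nn_integral_mono_AE)
      have "AE x in lborel. x \<noteq> (0::'a)" by (rule AE_lborel_singleton)
      then show "AE x in lborel. ennreal (\<omega> * lam) * indicator A x \<le> cone_average g {0<..<\<delta>} x * indicator A x + ennreal ((M + \<omega> + 1) * K) * indicator A x"
      proof eventually_elim
        case (elim x)
        show ?case
        proof (cases "x \<in> A")
          case True
          have "ennreal (\<omega> * lam) \<le> ennreal (\<omega> * \<bar>f x\<bar>)"
            using True \<omega> by (intro ennreal_leI mult_left_mono) (auto simp: A_def)
          also have "\<dots> \<le> cone_average g {0<..} x" using rep[OF elim] by (simp add: \<omega>_def n_def)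
          also have "\<dots> = cone_average g {0<..<\<delta>} x + cone_average g {\<delta>..} x"
            by (rule cone_average_split[OF g \<delta>(1)])
          also have "cone_average g {\<delta>..} x \<le> ennreal ((M + \<omega> + 1) * K)"
            unfolding K_def k_def \<omega>_def n_def
            by (rule cone_average_far[OF n2 g g0 M M0 \<Omega> _ supp \<delta>(1,4) L_def])
               (use \<delta> V in \<open>auto simp: n_def\<close>)
          finally show ?thesis using True by (simp add: add_left_mono)
        qed simp
      qed
    qed
    also have "\<dots> = (\<integral>\<^sup>+x. cone_average g {0<..<\<delta>} x * indicator A x \<partial>lborel) + ennreal ((M + \<omega> + 1) * K) * ennreal \<alpha>"
    proof -
      have [measurable]: "cball (0::'a) 1 \<in> sets borel" by simp
      have [measurable]: "(\<lambda>x. cone_average g {0<..<\<delta>} x) \<in> borel_measurable borel"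
        unfolding cone_average_def by measurable
      show ?thesis by (subst nn_integral_add) (simp_all add: nn_integral_cmult_indicator \<alpha>)
    qed
    also have "(\<integral>\<^sup>+x. cone_average g {0<..<\<delta>} x * indicator A x \<partial>lborel) \<le> ennreal (\<omega> * (M + 1) * \<delta>^n)"
      unfolding \<omega>_def n_def
      by (rule cone_average_near[OF g g0 M M0 A _ \<delta>(1)]) (use \<delta> \<alpha> in \<open>auto simp: n_def\<close>)
    also have "ennreal (\<omega> * (M + 1) * \<delta>^n) + ennreal ((M + \<omega> + 1) * K) * ennreal \<alpha>
       = ennreal ((\<omega> * (M + 1) + (M + \<omega> + 1) * K) * \<alpha>)"
      using \<omega> M0 K1 a0 unfolding \<delta>(2) by (simp add: distrib_right flip: ennreal_mult ennreal_plus)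
    finally have "ennreal (\<omega> * lam * \<alpha>) \<le> ennreal ((\<omega> * (M + 1) + (M + \<omega> + 1) * K) * \<alpha>)"
      using \<omega> lam a0 by (simp add: ennreal_mult add_right_mono)
    then have "\<omega> * lam * \<alpha> \<le> (\<omega> * (M + 1) + (M + \<omega> + 1) * K) * \<alpha>"
      using \<omega> M0 K1 a0 by (subst (asm) ennreal_le_iff) auto
    then have "\<omega> * lam \<le> \<omega> * (M + 1) + (M + \<omega> + 1) * K" using a0 by simp
    also have "\<dots> \<le> \<omega> * (M + 1) * K + (M + \<omega> + 1) * K"
      using mult_left_mono[OF K1, of "\<omega> * (M + 1)"] \<omega> M0 by simp
    also have "\<dots> = C * K" unfolding C \<omega>_def n_def by (simp add: distrib_right)
    finally have "\<omega> * lam \<le> C * K" .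
    moreover have C0: "C > 0" using \<omega> M0 unfolding C n_def[symmetric] \<omega>_def[symmetric] by (auto intro!: add_nonneg_pos)
    ultimately have "lam * \<omega> / C \<le> K" by (simp add: divide_le_eq mult.commute)
    then have "(lam * \<omega> / C) powr p \<le> K powr p" using lam \<omega> C0 kp by (intro powr_mono2) auto
    also have "K powr p = L" unfolding K_def powr_powr kp(1) using L1 by simp
    finally have "n * ((lam * \<omega> / C) powr p) \<le> n * L" by (intro mult_left_mono) auto
    \<comment> \<open>\<open>n ln (\<rho>/\<delta>)\<close> is the logarithm of the ratio of the volumes\<close>
    also have "n * L = n + ln (V/\<alpha>)"
    proof -
      have "V / \<alpha> = (\<rho> / \<delta>)^n" using \<delta> by (simp add: power_divide)
      then show ?thesis using \<delta> by (simp add: L_def ln_realpow distrib_left)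
    qed
    finally have "ln (\<alpha>/V) \<le> n - n * (lam * \<omega> / C) powr p" using a0 aV by (simp add: ln_div)
    then have "\<alpha> / V \<le> exp (n - n * (lam * \<omega> / C) powr p)"
      using a0 aV by (metis divide_pos_pos exp_le_cancel_iff exp_ln less_le_trans)
    then show ?thesis using a0 aV by (intro ennreal_leI) (simp add: divide_le_eq mult.commute)
  qed (use V in simp)
  then show ?thesis unfolding \<alpha>(1)[symmetric] A_def p_def \<omega>_def n_def .
qed

text \<open>The layers \<open>k < c |f|^(n/(n-1)) \<le> k + 1\<close> have measure at most \<open>exp (n - n k)\<close> times that of \<open>\<Omega>\<close>, so the
  contributions \<open>exp (k + 1)\<close> are summed against a geometric series; it converges because \<open>n \<ge> 2 > 1\<close>.\<close>

lemma trudinger_exponential_bound: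
  assumes n2: "DIM('a::euclidean_space) \<ge> 2" and M0: "M \<ge> 0"
  obtains c B where "c > 0" "B > 0"
    "\<And>(f :: 'a \<Rightarrow> real) g \<Omega>. \<lbrakk>f \<in> borel_measurable borel; g \<in> borel_measurable borel; \<And>x. g x \<ge> 0;
     (\<integral>\<^sup>+x. ennreal (g x ^ DIM('a)) \<partial>lborel) \<le> ennreal M; \<Omega> \<in> sets borel; emeasure lborel \<Omega> < \<infinity>;
     \<And>x. x \<notin> \<Omega> \<Longrightarrow> g x = 0;
     \<And>x. x \<noteq> 0 \<Longrightarrow> ennreal (unit_ball_vol DIM('a) * \<bar>f x\<bar>) \<le> cone_average g {0<..} x\<rbrakk> \<Longrightarrow>
     (\<integral>\<^sup>+x. ennreal (exp (c * \<bar>f x\<bar> powr (real DIM('a) / (real DIM('a) - 1)))) * indicator \<Omega> x \<partial>lborel)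
       \<le> ennreal B * emeasure lborel \<Omega>"
proof -
  define n where "n = DIM('a)"
  have nn: "n \<ge> 2" using n2 by (simp add: n_def)
  define \<omega> where "\<omega> = unit_ball_vol (real n)"
  have \<omega>: "\<omega> > 0" by (simp add: \<omega>_def)
  define C where "C = \<omega> * (M + 1) + (M + \<omega> + 1)"
  have C0: "C > 0" using \<omega> M0 by (auto simp: C_def intro!: add_nonneg_pos)
  define p where "p = real n / (real n - 1)"
  have p: "p > 0" using nn by (simp add: p_def)
  define c where "c = (\<omega> / C) powr p"
  have c0: "c > 0" using \<omega> C0 by (simp add: c_def)
  have sm: "summable (\<lambda>k. exp (real n + 1) * exp (-1) ^ k :: real)"
    by (intro summable_mult summable_geometric) simp
  define B where "B = 1 + (\<Sum>k. exp (real n + 1) * exp (-1) ^ k :: real)"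
  have B0: "B > 0" unfolding B_def by (intro add_pos_nonneg suminf_nonneg sm) auto
  have "(\<integral>\<^sup>+x. ennreal (exp (c * \<bar>f x\<bar> powr p)) * indicator \<Omega> x \<partial>lborel) \<le> ennreal B * emeasure lborel \<Omega>"
    if f[measurable]: "f \<in> borel_measurable borel"
    and g: "g \<in> borel_measurable borel" and g0: "\<And>x. g x \<ge> 0"
    and M: "(\<integral>\<^sup>+x. ennreal (g x ^ DIM('a)) \<partial>lborel) \<le> ennreal M"
    and \<Omega>[measurable]: "\<Omega> \<in> sets borel" and fin: "emeasure lborel \<Omega> < \<infinity>"
    and supp: "\<And>x. x \<notin> \<Omega> \<Longrightarrow> g x = 0"
    and rep: "\<And>x. x \<noteq> 0 \<Longrightarrow> ennreal (unit_ball_vol DIM('a) * \<bar>f x\<bar>) \<le> cone_average g {0<..} x"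
    for f g :: "'a \<Rightarrow> real" and \<Omega>
  proof -
    obtain V where V: "emeasure lborel \<Omega> = ennreal V" "V \<ge> 0"
      using fin by (cases "emeasure lborel \<Omega>") auto
    \<comment> \<open>the level at which \<open>c |f|^p\<close> equals \<open>k\<close>\<close>
    define lam where "lam k = C / \<omega> * real k powr (1/p)" for k :: nat
    define S where "S k = {x\<in>\<Omega>. lam k < \<bar>f x\<bar>}" for k
    have S[measurable]: "S k \<in> sets borel" for k unfolding S_def by measurable
    have Sk: "emeasure lborel (S k) \<le> ennreal (V * exp (n - n * real k))" for k
    proof (cases "k = 0")
      case True
      have "emeasure lborel (S k) \<le> ennreal V"
        unfolding V(1)[symmetric] by (rule emeasure_mono) (auto simp: S_def)
      also have "V \<le> V * exp (n - n * real k)" using True V(2) by (simp add: mult_le_cancel_left1)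
      finally show ?thesis by (simp add: ennreal_leI)
    next
      case False
      then have "lam k > 0" using C0 \<omega> by (simp add: lam_def)
      from level_set_bound[OF n2 M0 f g g0 M \<Omega> V supp rep _ this, of C]
      have "emeasure lborel (S k) \<le> ennreal (V * exp (n - n * (lam k * \<omega> / C) powr p))"
        unfolding S_def C_def \<omega>_def n_def p_def by simp
      also have "lam k * \<omega> / C = real k powr (1/p)" using C0 \<omega> by (simp add: lam_def)
      also have "(real k powr (1/p)) powr p = real k" using p False by (simp add: powr_powr)
      finally show ?thesis .
    qed
    have pt: "ennreal (exp (c * \<bar>f x\<bar> powr p)) * indicator \<Omega> x
       \<le> indicator \<Omega> x + (\<Sum>k. ennreal (exp (real k + 1)) * indicator (S k) x)" for x
    proof (cases "x \<in> \<Omega>")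
      case x: True
      define h where "h = c * \<bar>f x\<bar> powr p"
      have h0: "h \<ge> 0" using c0 by (simp add: h_def)
      show ?thesis
      proof (cases "h = 0")
        case True
        then show ?thesis using x by (simp add: h_def[symmetric])
      next
        case False
        then have hp: "h > 0" using h0 by simp
        define k where "k = nat \<lceil>h\<rceil> - 1"
        have k: "real k < h" "h \<le> real k + 1"
          using hp unfolding k_def by linarith+
        have hf: "h = (\<bar>f x\<bar> * \<omega> / C) powr p"
          unfolding h_def c_def using \<omega> C0 by (simp add: powr_mult[symmetric] mult.commute)
        have "real k powr (1/p) < h powr (1/p)" using k p by (intro powr_less_mono2) auto
        also have "h powr (1/p) = \<bar>f x\<bar> * \<omega> / C"
          unfolding hf using p \<omega> C0 by (simp add: powr_powr)
        finally have "lam k < \<bar>f x\<bar>" using \<omega> C0 by (simp add: lam_def field_simps)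
        then have "x \<in> S k" using x by (simp add: S_def)
        then have "ennreal (exp h) \<le> ennreal (exp (real k + 1)) * indicator (S k) x"
          using k by (simp add: ennreal_leI)
        also have "\<dots> \<le> (\<Sum>k. ennreal (exp (real k + 1)) * indicator (S k) x)"
        proof -
          have "F k \<le> suminf F" for F :: "nat \<Rightarrow> ennreal"
            using sum_le_suminf[of F "{k}"] by simp
          then show ?thesis .
        qed
        finally show ?thesis using x by (simp add: h_def add_increasing)
      qed
    qed simp
    have "(\<integral>\<^sup>+x. ennreal (exp (c * \<bar>f x\<bar> powr p)) * indicator \<Omega> x \<partial>lborel)
      \<le> (\<integral>\<^sup>+x. indicator \<Omega> x + (\<Sum>k. ennreal (exp (real k + 1)) * indicator (S k) x) \<partial>lborel)"
      by (rule nn_integral_mono) (rule pt)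
    also have "\<dots> = emeasure lborel \<Omega> + (\<Sum>k. ennreal (exp (real k + 1)) * emeasure lborel (S k))"
      by (subst nn_integral_add) (simp_all add: nn_integral_suminf nn_integral_cmult_indicator)
    also have "\<dots> \<le> ennreal V + (\<Sum>k. ennreal (V * (exp (real n + 1) * exp (-1) ^ k)))"
    proof (intro add_mono suminf_le)
      show "ennreal (exp (real k + 1)) * emeasure lborel (S k) \<le> ennreal (V * (exp (real n + 1) * exp (-1) ^ k))" for k
      proof -
        have "ennreal (exp (real k + 1)) * emeasure lborel (S k) \<le> ennreal (exp (real k + 1)) * ennreal (V * exp (n - n * real k))"
          by (intro mult_left_mono Sk) auto
        also have "\<dots> = ennreal (V * exp (real k + 1 + (n - n * real k)))"
          using V by (simp add: exp_add mult_ac flip: ennreal_mult)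
        also have "\<dots> \<le> ennreal (V * exp (real n + 1 - k))"
        proof (intro ennreal_leI mult_left_mono)
          have "2 * real k \<le> n * real k" using nn by (intro mult_right_mono) auto
          then show "exp (real k + 1 + (n - n * real k)) \<le> exp (real n + 1 - k)" by simp
        qed (use V in simp)
        also have "exp (real n + 1 - k) = exp (real n + 1) * exp (-1) ^ k"
          by (simp add: exp_diff exp_minus power_inverse exp_of_nat_mult[symmetric] divide_inverse)
        finally show ?thesis .
      qed
    qed (auto simp: V)
    also have "(\<Sum>k. ennreal (V * (exp (real n + 1) * exp (-1) ^ k))) = ennreal (V * (\<Sum>k. exp (real n + 1) * exp (-1) ^ k))"
      using V(2) sm by (subst suminf_ennreal2) (auto simp: suminf_mult summable_mult)
    also have "ennreal V + \<dots> = ennreal B * emeasure lborel \<Omega>"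
    proof -
      define T where "T = (\<Sum>k. exp (real n + 1) * exp (-1) ^ k :: real)"
      have "T \<ge> 0" unfolding T_def by (intro suminf_nonneg sm) auto
      then have "ennreal V + ennreal (V * T) = ennreal ((1 + T) * V)"
        using V(2) by (simp add: algebra_simps flip: ennreal_plus)
      then show ?thesis unfolding V(1) B_def T_def[symmetric] using \<open>T \<ge> 0\<close> V(2) by (simp add: ennreal_mult)
    qed
    finally show ?thesis .
  qed
  note bound = this
  show ?thesis
    by (rule that[OF c0 B0]) (rule bound[unfolded n_def p_def]; assumption)
qed


section \<open>Exponential integrability for differentiable functions\<close>

definition damped :: "real \<Rightarrow> ('a::euclidean_space \<Rightarrow> real) \<Rightarrow> 'a \<Rightarrow> real" where
  "damped R u y = u y * E2 (norm y / R) powr (- (2 / DIM('a)))"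

definition damped_deriv :: "real \<Rightarrow> ('a::euclidean_space \<Rightarrow> real) \<Rightarrow> ('a \<Rightarrow> 'a) \<Rightarrow> 'a \<Rightarrow> 'a \<Rightarrow> real" where
  "damped_deriv R u Du y z = u y * ((2 / DIM('a)) * E2 (norm y / R) powr (- (2 / DIM('a)) - 1)
       / (E1 (norm y / R) * norm y) * ((y \<bullet> z) / norm y))
     + (Du y \<bullet> z) * E2 (norm y / R) powr (- (2 / DIM('a)))"

lemma damped_has_derivative:
  fixes u :: "'a::euclidean_space \<Rightarrow> real"
  assumes u: "\<And>x. (u has_derivative (\<lambda>h. Du x \<bullet> h)) (at x)"
    and supp: "r0 < R" "\<And>x. norm x > r0 \<Longrightarrow> u x = 0" and y: "y \<noteq> 0"
  shows "(damped R u has_derivative damped_deriv R u Du y) (at y)"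
proof (cases "norm y < R")
  case True
  then have ny: "0 < norm y" "norm y < R" using y by auto
  define q where "q = 2 / real DIM('a)"
  have E: "E1 (norm y / R) \<ge> 1" "E2 (norm y / R) \<ge> 1" using ny E1_ge_1 E2_ge_1 by auto
  have "((\<lambda>r. E2 (r/R) powr (- q)) has_real_derivative
      q * E2 (norm y/R) powr (- q - 1) / (E1 (norm y/R) * norm y)) (at (norm y))"
    by (rule DERIV_cong[OF DERIV_fun_powr[OF E2_has_real_derivative[OF ny]]]) (use E ny in \<open>auto simp: mult_ac\<close>)
  moreover have "(norm has_derivative (\<lambda>v. (y \<bullet> v) / norm y)) (at y within UNIV)"
    using has_derivative_norm[of y] y by (simp add: sgn_div_norm inner_commute divide_inverse mult_ac)
  ultimately have "((\<lambda>x::'a. E2 (norm x/R) powr (- q)) has_derivative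
     (\<lambda>v. q * E2 (norm y/R) powr (- q - 1) / (E1 (norm y/R) * norm y) * ((y \<bullet> v) / norm y))) (at y)"
    unfolding has_field_derivative_def by (rule has_derivative_compose[rotated])
  from has_derivative_mult[OF u[of y] this] show ?thesis
    unfolding damped_def[abs_def] damped_deriv_def[abs_def] q_def .
next
  case False
  have op: "open {x::'a. norm x > r0}" by (intro open_Collect_less continuous_intros)
  have yS: "y \<in> {x. norm x > r0}" using False supp by auto
  have "Du y = 0" by (rule gradient_zero_off_support[OF u op _ yS]) (use supp in auto)
  then have "damped_deriv R u Du y = (\<lambda>z. 0)" using yS supp(2) by (simp add: damped_deriv_def fun_eq_iff)
  moreover have "(damped R u has_derivative (\<lambda>z. 0)) (at y)"
    by (rule has_derivative_transform_within_open[OF has_derivative_const op yS])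
       (use supp in \<open>auto simp: damped_def\<close>)
  ultimately show ?thesis by simp
qed

lemma continuous_on_damped_deriv:
  fixes u :: "'a::euclidean_space \<Rightarrow> real"
  assumes u: "\<And>x. (u has_derivative (\<lambda>h. Du x \<bullet> h)) (at x)" "continuous_on UNIV Du"
    and supp: "r0 < R" "\<And>x. norm x > r0 \<Longrightarrow> u x = 0"
  shows "continuous_on (-{0}) (\<lambda>y. damped_deriv R u Du y z)"
proof -
  define U1 where "U1 = {x::'a. x \<noteq> 0 \<and> norm x < R}"
  define U2 where "U2 = {x::'a. norm x > r0}"
  have op: "open U1" "open U2"
    unfolding U1_def U2_def
    by (auto intro!: open_Collect_less open_Collect_conj open_Collect_neq continuous_intros)
  have cu: "continuous_on UNIV u"
    using u(1) by (meson continuous_at_imp_continuous_on has_derivative_continuous)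
  have E': "E1 (norm x / R) \<ge> 1" "E2 (norm x / R) \<ge> 1" if "x \<in> U1" for x
    using that E1_ge_1[of "norm x" R] E2_ge_1[of "norm x" R] by (auto simp: U1_def)
  have E: "\<forall>x\<in>U1. E1 (norm x / R) \<noteq> 0" "\<forall>x\<in>U1. E2 (norm x / R) \<noteq> 0"
    using E' by (metis not_one_le_zero)+
  have cE: "continuous_on U1 (\<lambda>x. E1 (norm x / R))" "continuous_on U1 (\<lambda>x. E2 (norm x / R))"
    unfolding U1_def by (rule continuous_on_radial_E1_E2)+
  have cP: "continuous_on U1 (\<lambda>x. E2 (norm x / R) powr q)" for q
    by (rule continuous_on_powr[OF cE(2) continuous_on_const E(2)])
  have nz: "\<forall>x\<in>U1. E1 (norm x / R) * norm x \<noteq> 0" "\<forall>x\<in>U1. norm x \<noteq> 0"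
    using E(1) by (auto simp: U1_def)
  have "continuous_on U1 (\<lambda>y. damped_deriv R u Du y z)"
    unfolding damped_deriv_def
    by (intro continuous_on_add continuous_on_mult continuous_on_divide continuous_on_inner
          continuous_on_norm continuous_on_id continuous_on_const cE cP nz
          continuous_on_subset[OF cu subset_UNIV] continuous_on_subset[OF u(2) subset_UNIV])
  moreover have "damped_deriv R u Du y z = 0" if "y \<in> U2" for y
  proof -
    have "Du y = 0" by (rule gradient_zero_off_support[OF u(1) op(2) _ that]) (use supp in \<open>auto simp: U2_def\<close>)
    then show ?thesis using that supp(2) by (simp add: damped_deriv_def U2_def)
  qed
  then have "continuous_on U2 (\<lambda>y. damped_deriv R u Du y z) \<longleftrightarrow> continuous_on U2 (\<lambda>_. 0 :: real)"
    by (intro continuous_on_cong) auto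
  ultimately have "continuous_on (U1 \<union> U2) (\<lambda>y. damped_deriv R u Du y z)"
    by (rule continuous_on_open_Un[OF op _ iffD2]) simp
  then show ?thesis by (rule continuous_on_subset) (use supp in \<open>auto simp: U1_def U2_def\<close>)
qed

text \<open>Differentiating \<open>E2^(-2/n)\<close> costs a factor \<open>1 / (E1 |x|)\<close>, which together with \<open>|u|\<close> is comparable to the
  ground slope.  The gradient of \<open>u\<close> itself is split as \<open>b + a\<close>, and the damping is kept only on \<open>a\<close>.\<close>

lemma damped_deriv_bound:
  fixes u :: "'a::euclidean_space \<Rightarrow> real"
  assumes n2: "DIM('a) \<ge> 2" and y: "y \<noteq> 0" and u0: "norm y \<ge> R \<Longrightarrow> u y = 0 \<and> Du y = 0"
  shows "\<bar>damped_deriv R u Du y z\<bar>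
    \<le> (norm (Du y - ground_slope R u y) + 3 * norm (ground_slope R u y) * E2 (norm y / R) powr (- (2 / DIM('a)))) * norm z"
proof (cases "norm y < R")
  case True
  define n where "n = real DIM('a)"
  have n: "n \<ge> 2" using n2 by (simp add: n_def)
  define t where "t = E1 (norm y / R)" define s where "s = E2 (norm y / R)"
  have ts: "t \<ge> 1" "s \<ge> 1" using True y E1_ge_1[of "norm y" R] E2_ge_1[of "norm y" R] by (auto simp: t_def s_def)
  define \<sigma> where "\<sigma> = s powr (- (2/n))"
  have \<sigma>: "0 < \<sigma>" "\<sigma> \<le> 1" using ts n by (auto simp: \<sigma>_def powr_minus divide_simps ge_one_powr_ge_zero)
  define a where "a = ground_slope R u y"
  have na: "norm a = (n - 1) / n * \<bar>u y\<bar> / (norm y * t)"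
    using norm_ground_slope[OF True, of u] by (simp add: a_def n_def t_def)
  have "\<bar>(y \<bullet> z) / norm y\<bar> \<le> norm z"
    using Cauchy_Schwarz_ineq2[of y z] y by (simp add: divide_le_eq mult.commute)
  moreover have "s powr (- (2/n) - 1) \<le> \<sigma>" unfolding \<sigma>_def using ts by (intro powr_mono) auto
  moreover have "2/n * \<bar>u y\<bar> / (t * norm y) \<le> 2 * norm a"
  proof -
    \<comment> \<open>here \<open>n \<ge> 2\<close> enters\<close>
    have "2/n \<le> 2 * ((n - 1)/n)" using n by (simp add: field_simps)
    then have "2/n * (\<bar>u y\<bar> / (t * norm y)) \<le> 2 * ((n - 1)/n) * (\<bar>u y\<bar> / (t * norm y))"
      using ts by (intro mult_right_mono) auto
    also have "2 * ((n - 1)/n) * (\<bar>u y\<bar> / (t * norm y)) = 2 * norm a"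
      unfolding na by (simp only: mult.assoc mult.commute[of t] times_divide_eq_right)
    finally show ?thesis by (simp only: times_divide_eq_right)
  qed
  ultimately have "(2/n * \<bar>u y\<bar> / (t * norm y)) * s powr (- (2/n) - 1) * \<bar>(y \<bullet> z) / norm y\<bar> \<le> 2 * norm a * \<sigma> * norm z"
    using \<sigma> by (intro mult_mono) auto
  then have 1: "\<bar>u y * ((2 / n) * s powr (- (2 / n) - 1) / (t * norm y) * ((y \<bullet> z) / norm y))\<bar> \<le> 2 * norm a * \<sigma> * norm z"
    using n ts by (simp add: abs_mult mult_ac)
  have "\<bar>Du y \<bullet> z\<bar> \<le> norm (Du y) * norm z" by (rule Cauchy_Schwarz_ineq2)
  also have "norm (Du y) \<le> norm (Du y - a) + norm a" using norm_triangle_ineq[of "Du y - a" a] by simp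
  finally have "\<bar>(Du y \<bullet> z) * \<sigma>\<bar> \<le> ((norm (Du y - a) + norm a) * norm z) * \<sigma>"
    using \<sigma> by (simp add: abs_mult mult_right_mono)
  also have "\<dots> \<le> (norm (Du y - a) + norm a * \<sigma>) * norm z"
  proof -
    have "norm (Du y - a) * \<sigma> \<le> norm (Du y - a)" using \<sigma> by (simp add: mult_left_le)
    then have "(norm (Du y - a) * \<sigma> + norm a * \<sigma>) * norm z \<le> (norm (Du y - a) + norm a * \<sigma>) * norm z"
      by (intro mult_right_mono) auto
    then show ?thesis by (simp add: algebra_simps)
  qed
  finally have 2: "\<bar>(Du y \<bullet> z) * \<sigma>\<bar> \<le> (norm (Du y - a) + norm a * \<sigma>) * norm z" .
  have "(norm (Du y - a) + 3 * norm a * \<sigma>) * norm z = 2 * norm a * \<sigma> * norm z + (norm (Du y - a) + norm a * \<sigma>) * norm z"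
    by (simp add: algebra_simps)
  then show ?thesis
    unfolding damped_deriv_def n_def[symmetric] a_def[symmetric] s_def[symmetric] t_def[symmetric] \<sigma>_def[symmetric]
    by (simp only:) (rule order_trans[OF abs_triangle_ineq add_mono[OF 1 2]])
next
  case False
  then show ?thesis using u0 by (simp add: damped_deriv_def)
qed

text \<open>The energy hypothesis bounds the remainder of the Leray inequality by \<open>3/c\<close>, hence also the \<open>n\<close>-th power of the
  majorant \<open>g\<close> of the gradient of \<open>u E2^(-2/n)\<close>, and Trudinger's inequality applies.  The Leray term is cancelled on
  both sides, which is legitimate as it is finite.  The constant \<open>3\<close> leaves room for approximation.\<close>

lemma weighted_exponential_bound:
  assumes n2: "DIM('a::euclidean_space) \<ge> 2"
  obtains A B where "A > 0" "B > 0"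
   "\<And>(u :: 'a \<Rightarrow> real) Du R K \<Omega>. \<lbrakk>\<And>x. (u has_derivative (\<lambda>h. Du x \<bullet> h)) (at x); continuous_on UNIV Du;
     compact K; K \<subseteq> \<Omega>; open \<Omega>; bounded \<Omega>; \<Omega> \<subseteq> ball 0 R; \<And>x. x \<notin> K \<Longrightarrow> u x = 0;
     (\<integral>\<^sup>+x. ennreal (norm (Du x) ^ DIM('a)) \<partial>lborel) \<le> ennreal 3 + (\<integral>\<^sup>+x. ennreal (norm (ground_slope R u x) ^ DIM('a)) \<partial>lborel)\<rbrakk> \<Longrightarrow>
     (\<integral>\<^sup>+x. ennreal (exp (A * (\<bar>u x\<bar> / E2 (norm x / R) powr (2 / DIM('a))) powr (real DIM('a) / (real DIM('a) - 1)))) * indicator \<Omega> x \<partial>lborel)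
       \<le> ennreal B * emeasure lborel \<Omega>"
proof -
  define n where "n = DIM('a)"
  have nn: "n \<ge> 2" using n2 by (simp add: n_def)
  obtain c where c0: "c > 0" and leray: "\<And>(u :: 'a \<Rightarrow> real) Du R r0.
     (\<And>x. (u has_derivative (\<lambda>h. Du x \<bullet> h)) (at x)) \<Longrightarrow> continuous_on UNIV Du \<Longrightarrow>
     r0 < R \<Longrightarrow> (\<And>x. norm x > r0 \<Longrightarrow> u x = 0) \<Longrightarrow>
     (\<integral>\<^sup>+x. ennreal (norm (ground_slope R u x) ^ DIM('a) + c * (norm (ground_slope R u x) ^ DIM('a) / (E2 (norm x/R))\<^sup>2
          + norm (Du x - ground_slope R u x) ^ DIM('a))) \<partial>lborel)
       \<le> (\<integral>\<^sup>+x. ennreal (norm (Du x) ^ DIM('a)) \<partial>lborel)"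
  proof (rule leray_inequality_with_remainder[OF n2], goal_cases)
    case (1 c)
    show ?case by (rule that[OF 1(2)], rule 1(3))
  qed
  \<comment> \<open>\<open>6 = 2 * 3\<close>: the factor \<open>2\<close> from the sum, the factor \<open>3\<close> from the derivative bound\<close>
  define M where "M = 6^n * (3 / c)"
  have M0: "M \<ge> 0" using c0 by (simp add: M_def)
  obtain A B where A0: "A > 0" and B0: "B > 0" and trud: "\<And>(f :: 'a \<Rightarrow> real) g \<Omega>. \<lbrakk>f \<in> borel_measurable borel; g \<in> borel_measurable borel; \<And>x. g x \<ge> 0;
     (\<integral>\<^sup>+x. ennreal (g x ^ DIM('a)) \<partial>lborel) \<le> ennreal M; \<Omega> \<in> sets borel; emeasure lborel \<Omega> < \<infinity>;
     \<And>x. x \<notin> \<Omega> \<Longrightarrow> g x = 0;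
     \<And>x. x \<noteq> 0 \<Longrightarrow> ennreal (unit_ball_vol DIM('a) * \<bar>f x\<bar>) \<le> cone_average g {0<..} x\<rbrakk> \<Longrightarrow>
     (\<integral>\<^sup>+x. ennreal (exp (A * \<bar>f x\<bar> powr (real DIM('a) / (real DIM('a) - 1)))) * indicator \<Omega> x \<partial>lborel)
       \<le> ennreal B * emeasure lborel \<Omega>"
  proof (rule trudinger_exponential_bound[OF n2 M0], goal_cases)
    case (1 A B)
    show ?case by (rule that[OF 1(2,3)], rule 1(4))
  qed
  have "(\<integral>\<^sup>+x. ennreal (exp (A * (\<bar>u x\<bar> / E2 (norm x / R) powr (2 / DIM('a))) powr (real DIM('a) / (real DIM('a) - 1)))) * indicator \<Omega> x \<partial>lborel)
       \<le> ennreal B * emeasure lborel \<Omega>"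
    if u: "\<And>x. (u has_derivative (\<lambda>h. Du x \<bullet> h)) (at x)" "continuous_on UNIV Du"
      and K: "compact K" "K \<subseteq> \<Omega>" "open \<Omega>" "bounded \<Omega>" "\<Omega> \<subseteq> ball 0 R" "\<And>x. x \<notin> K \<Longrightarrow> u x = 0"
      and energy: "(\<integral>\<^sup>+x. ennreal (norm (Du x) ^ DIM('a)) \<partial>lborel) \<le> ennreal 3 + (\<integral>\<^sup>+x. ennreal (norm (ground_slope R u x) ^ DIM('a)) \<partial>lborel)"
    for u :: "'a \<Rightarrow> real" and Du R K \<Omega>
  proof -
    obtain r0 where r0: "r0 < R" "\<And>x. norm x > r0 \<Longrightarrow> u x = 0"
    proof (cases "K = {}")
      case True
      then show ?thesis using that[of "R - 1"] K(6) by auto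
    next
      case False
      obtain x0 where x0: "x0 \<in> K" "\<forall>x\<in>K. norm x \<le> norm x0"
        using continuous_attains_sup[OF K(1) False continuous_on_norm[OF continuous_on_id]] by blast
      then have "norm x0 < R" using K(2,5) by auto
      moreover have "u x = 0" if "norm x > norm x0" for x
        using that x0(2) K(6)[of x] by (metis not_less)
      ultimately show ?thesis by (rule that)
    qed
    have Du0: "Du x = 0" if "x \<notin> K" for x
      by (rule gradient_zero_off_support[OF u(1) open_Compl[OF compact_imp_closed[OF K(1)]]]) (use that K(6) in auto)
    define a where "a = ground_slope R u"
    define b where "b x = Du x - a x" for x
    define g where "g x = norm (b x) + 3 * norm (a x) * E2 (norm x / R) powr (- (2 / n))" for x
    have ucont: "continuous_on UNIV u"
      using u(1) by (meson continuous_at_imp_continuous_on has_derivative_continuous)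
    have [measurable]: "u \<in> borel_measurable borel" "Du \<in> borel_measurable borel"
      using ucont u(2) by (auto intro: borel_measurable_continuous_onI)
    have [measurable]: "a \<in> borel_measurable borel"
      unfolding a_def ground_slope_def[abs_def] by measurable
    have [measurable]: "b \<in> borel_measurable borel" unfolding b_def[abs_def] by measurable
    have gm: "g \<in> borel_measurable borel" unfolding g_def[abs_def] by measurable
    have dm: "damped R u \<in> borel_measurable borel" unfolding damped_def[abs_def] by measurable
    have g0: "g x \<ge> 0" for x by (simp add: g_def)
    have a0: "a x = 0" if "u x = 0" for x using that by (simp add: a_def ground_slope_def)
    define X where "X x = norm (a x) ^ n" for x
    define Y where "Y x = norm (a x) ^ n / (E2 (norm x/R))\<^sup>2 + norm (b x) ^ n" for x
    have XY0: "X x \<ge> 0" "Y x \<ge> 0" for x by (auto simp: X_def Y_def)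
    have [measurable]: "X \<in> borel_measurable borel" "Y \<in> borel_measurable borel"
      unfolding X_def[abs_def] Y_def[abs_def] by measurable
    have gY: "g x ^ n \<le> 6^n * Y x" for x
    proof (cases "x = 0 \<or> norm x \<ge> R")
      case True
      then have "a x = 0" using r0 by (auto simp: a_def ground_slope_def)
      moreover have "norm (b x)^n \<le> 6^n * norm (b x)^n" by (simp add: mult_le_cancel_right1)
      ultimately show ?thesis using nn by (simp add: g_def Y_def power_0_left)
    next
      case False
      then have s: "E2 (norm x / R) \<ge> 1" using E2_ge_1[of "norm x" R] by auto
      define \<sigma> where "\<sigma> = E2 (norm x / R) powr (- (2 / n))"
      \<comment> \<open>the exponent \<open>2/n\<close> is the one that turns into the square of \<open>E2\<close>\<close>
      have \<sigma>n: "\<sigma>^n = 1 / (E2 (norm x / R))\<^sup>2"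
      proof -
        have "\<sigma>^n = E2 (norm x / R) powr (- (2 / n) * n)"
          unfolding \<sigma>_def using s by (subst powr_power) auto
        also have "- (2 / n) * n = - 2" using nn by simp
        also have "E2 (norm x / R) powr (- 2) = 1 / (E2 (norm x / R))\<^sup>2"
          using s by (simp add: powr_minus_divide)
        finally show ?thesis .
      qed
      have \<sigma>0: "\<sigma> \<ge> 0" by (simp add: \<sigma>_def)
      have "g x ^ n \<le> 2^n * (norm (b x)^n + (3 * norm (a x) * \<sigma>)^n)"
        unfolding g_def \<sigma>_def[symmetric] using \<sigma>0 by (intro power_add_le_two_power) auto
      also have "(3 * norm (a x) * \<sigma>)^n = 3^n * (norm (a x)^n / (E2 (norm x / R))\<^sup>2)"
        by (simp add: power_mult_distrib \<sigma>n)
      also have "2^n * (norm (b x)^n + 3^n * (norm (a x)^n / (E2 (norm x / R))\<^sup>2)) \<le> 2^n * (3^n * norm (b x)^n + 3^n * (norm (a x)^n / (E2 (norm x / R))\<^sup>2))"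
        by (intro mult_left_mono add_mono) (auto simp: mult_le_cancel_right1)
      also have "\<dots> = (2 * 3)^n * Y x" unfolding Y_def power_mult_distrib by (simp add: algebra_simps)
      finally show ?thesis by simp
    qed
    have "(\<integral>\<^sup>+x. ennreal (X x) \<partial>lborel) + ennreal c * (\<integral>\<^sup>+x. ennreal (Y x) \<partial>lborel)
       = (\<integral>\<^sup>+x. ennreal (X x + c * Y x) \<partial>lborel)"
      using XY0 c0 by (simp add: nn_integral_add nn_integral_cmult ennreal_mult)
    also have "\<dots> \<le> (\<integral>\<^sup>+x. ennreal (norm (Du x) ^ n) \<partial>lborel)"
      using leray[OF u r0] unfolding X_def Y_def b_def a_def n_def .
    finally have le: "(\<integral>\<^sup>+x. ennreal (X x) \<partial>lborel) + ennreal c * (\<integral>\<^sup>+x. ennreal (Y x) \<partial>lborel) \<le> (\<integral>\<^sup>+x. ennreal (norm (Du x) ^ n) \<partial>lborel)" .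
    have fin: "(\<integral>\<^sup>+x. ennreal (norm (Du x) ^ n) \<partial>lborel) < \<infinity>"
    proof -
      have "integrable lborel (\<lambda>x. norm (Du x) ^ n)"
      proof (rule integrable_continuous_bounded_support[of _ r0])
        show "norm (Du x) ^ n = 0" if "norm x > r0" for x
        proof -
          have "open {x::'a. norm x > r0}" by (intro open_Collect_less continuous_intros)
          then have "Du x = 0" by (rule gradient_zero_off_support[OF u(1)]) (use that r0 in auto)
          then show ?thesis using nn by simp
        qed
      qed (intro continuous_intros u)
      then show ?thesis by (simp add: integrable_iff_bounded)
    qed
    have "(\<integral>\<^sup>+x. ennreal (X x) \<partial>lborel) \<le> (\<integral>\<^sup>+x. ennreal (norm (Du x) ^ n) \<partial>lborel)"
      using le by (rule order_trans[rotated]) simp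
    then have finX: "(\<integral>\<^sup>+x. ennreal (X x) \<partial>lborel) \<noteq> top" using fin by (auto simp: top_unique)
    have "(\<integral>\<^sup>+x. ennreal (X x) \<partial>lborel) + ennreal c * (\<integral>\<^sup>+x. ennreal (Y x) \<partial>lborel)
        \<le> (\<integral>\<^sup>+x. ennreal (X x) \<partial>lborel) + ennreal 3"
    proof -
      have en: "(\<integral>\<^sup>+x. ennreal (norm (Du x) ^ n) \<partial>lborel) \<le> ennreal 3 + (\<integral>\<^sup>+x. ennreal (X x) \<partial>lborel)"
        using energy unfolding X_def a_def n_def .
      show ?thesis using order_trans[OF le en] by (simp only: add.commute[of "ennreal 3"])
    qed
    then have cY: "ennreal c * (\<integral>\<^sup>+x. ennreal (Y x) \<partial>lborel) \<le> ennreal 3"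
      using finX by (simp add: ennreal_add_left_cancel_le)
    have Y3: "(\<integral>\<^sup>+x. ennreal (Y x) \<partial>lborel) \<le> ennreal (3 / c)"
    proof -
      have "ennreal (1/c) * (ennreal c * (\<integral>\<^sup>+x. ennreal (Y x) \<partial>lborel)) \<le> ennreal (1/c) * ennreal 3"
        using cY by (rule mult_left_mono) simp
      also have "ennreal (1/c) * ennreal 3 = ennreal (3/c)" using c0 by (subst ennreal_mult[symmetric]) auto
      also have "ennreal (1/c) * (ennreal c * (\<integral>\<^sup>+x. ennreal (Y x) \<partial>lborel)) = (\<integral>\<^sup>+x. ennreal (Y x) \<partial>lborel)"
        using c0 by (simp add: mult.assoc[symmetric] ennreal_mult[symmetric])
      finally show ?thesis .
    qed
    have gM: "(\<integral>\<^sup>+x. ennreal (g x ^ DIM('a)) \<partial>lborel) \<le> ennreal M"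
    proof -
      have "(\<integral>\<^sup>+x. ennreal (g x ^ DIM('a)) \<partial>lborel) \<le> (\<integral>\<^sup>+x. ennreal (6^n) * ennreal (Y x) \<partial>lborel)"
        using gY XY0 by (intro nn_integral_mono) (auto simp: n_def ennreal_mult[symmetric] intro!: ennreal_leI)
      also have "\<dots> = ennreal (6^n) * (\<integral>\<^sup>+x. ennreal (Y x) \<partial>lborel)" by (rule nn_integral_cmult) measurable
      also have "\<dots> \<le> ennreal (6^n) * ennreal (3/c)" using Y3 by (rule mult_left_mono) simp
      also have "\<dots> = ennreal M" using c0 by (simp add: M_def flip: ennreal_mult)
      finally show ?thesis .
    qed
    have gz: "g x = 0" if "x \<notin> \<Omega>" for x
    proof -
      have "x \<notin> K" using that K by auto
      then show ?thesis using Du0[of x] a0[of x] K(6)[of x] by (simp add: g_def b_def)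
    qed
    have rep: "ennreal (unit_ball_vol DIM('a) * \<bar>damped R u x\<bar>) \<le> cone_average g {0<..} x" if "x \<noteq> 0" for x
    proof (rule cone_average_representation[OF n2 that, where f' = "damped_deriv R u Du" and r = r0])
      show "(damped R u has_derivative damped_deriv R u Du y) (at y)" if "y \<noteq> 0" for y
        by (rule damped_has_derivative[OF u(1) r0 that])
      show "continuous_on (-{0}) (\<lambda>y. damped_deriv R u Du y z)" for z
        by (rule continuous_on_damped_deriv[OF u r0])
      show "\<bar>damped_deriv R u Du y z\<bar> \<le> g y * norm z" if "y \<noteq> 0" for y z
        unfolding g_def b_def a_def n_def
      proof (rule damped_deriv_bound[OF n2 that])
        assume "norm y \<ge> R"
        then have "y \<notin> K" using K by auto
        then show "u y = 0 \<and> Du y = 0" using K(6) Du0 by auto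
      qed
      show "norm y > r0 \<Longrightarrow> damped R u y = 0" for y using r0 by (simp add: damped_def)
    qed (rule gm)
    have fin\<Omega>: "emeasure lborel \<Omega> < \<infinity>" by (rule emeasure_bounded_finite[OF K(4)])
    have "(\<integral>\<^sup>+x. ennreal (exp (A * \<bar>damped R u x\<bar> powr (real DIM('a) / (real DIM('a) - 1)))) * indicator \<Omega> x \<partial>lborel)
       \<le> ennreal B * emeasure lborel \<Omega>"
      by (rule trud[OF dm gm g0 gM _ fin\<Omega> gz rep]) (use K in auto)
    moreover have "\<bar>damped R u x\<bar> = \<bar>u x\<bar> / E2 (norm x / R) powr (2 / DIM('a))" for x
      by (simp add: damped_def abs_mult powr_minus_divide)
    ultimately show ?thesis by (simp only:)
  qed
  note bound = this
  show ?thesis by (rule that[OF A0 B0]) (rule bound; assumption)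
qed


section \<open>Test functions and domains\<close>

lemma grad_has_derivative:
  assumes "f differentiable (at x)"
  shows "(f has_derivative (\<lambda>h. grad f x \<bullet> h)) (at x)"
proof -
  have fd: "(f has_derivative frechet_derivative f (at x)) (at x)"
    using assms by (simp add: frechet_derivative_works)
  have "frechet_derivative f (at x) h = grad f x \<bullet> h" for h
  proof -
    have "frechet_derivative f (at x) h = frechet_derivative f (at x) (\<Sum>i\<in>UNIV. (h $ i) *\<^sub>R axis i 1)"
      by (simp add: basis_expansion flip: scalar_mult_eq_scaleR)
    also have "\<dots> = (\<Sum>i\<in>UNIV. h $ i * frechet_derivative f (at x) (axis i 1))"
      using has_derivative_linear[OF fd] by (simp add: linear_sum linear_scale)
    finally show ?thesis by (simp add: grad_def inner_vec_def mult.commute)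
  qed
  then show ?thesis using fd by (simp add: has_derivative_eq_rhs fun_eq_iff)
qed

lemma grad_eqI:
  assumes "(f has_derivative (\<lambda>h. D \<bullet> h)) (at x)"
  shows "grad f x = D"
proof -
  have "frechet_derivative f (at x) = (\<lambda>h. D \<bullet> h)" using frechet_derivative_at[OF assms] by simp
  then show ?thesis by (simp add: grad_def vec_eq_iff inner_axis)
qed

lemma test_function_has_derivative:
  assumes "test_function \<Omega> \<phi>"
  shows "(\<phi> has_derivative (\<lambda>h. grad \<phi> x \<bullet> h)) (at x)" "continuous_on UNIV (grad \<phi>)"
proof -
  have C: "Ck (Suc 0) \<phi>" using assms by (auto simp: test_function_def)
  then show "(\<phi> has_derivative (\<lambda>h. grad \<phi> x \<bullet> h)) (at x)" by (auto intro: grad_has_derivative)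
  have "continuous_on UNIV (\<lambda>x. \<chi> i. grad \<phi> x $ i)" using C by (intro continuous_on_vec_lambda) simp
  then show "continuous_on UNIV (grad \<phi>)" by simp
qed

lemma test_function_continuous:
  assumes "test_function \<Omega> \<phi>" shows "continuous_on UNIV \<phi>"
proof -
  have "Ck 0 \<phi>" using assms unfolding test_function_def by blast
  then show ?thesis by simp
qed

lemma test_function_support:
  assumes "test_function \<Omega> \<phi>"
  obtains K where "compact K" "K \<subseteq> \<Omega>" "\<And>x. x \<notin> K \<Longrightarrow> \<phi> x = 0" "\<And>x. x \<notin> K \<Longrightarrow> grad \<phi> x = 0"
proof -
  obtain K where K: "compact K" "K \<subseteq> \<Omega>" "\<And>x. x \<notin> K \<Longrightarrow> \<phi> x = 0"
    using assms by (auto simp: test_function_def)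
  moreover have "grad \<phi> x = 0" if "x \<notin> K" for x
    by (rule gradient_zero_off_support[OF test_function_has_derivative(1)[OF assms] open_Compl[OF compact_imp_closed[OF K(1)]]])
       (use that K(3) in auto)
  ultimately show ?thesis by (rule that)
qed

lemma compact_support_norm_bound:
  fixes K :: "'a::real_normed_vector set"
  assumes "compact K"
  obtains r where "\<forall>x. norm x > r \<longrightarrow> x \<notin> K"
proof -
  obtain r where "\<forall>x\<in>K. norm x \<le> r" using compact_imp_bounded[OF assms] by (auto simp: bounded_iff)
  then show ?thesis using that[of r] by (meson not_less)
qed

text \<open>An open set contains points of larger norm around each of its points, so the supremum is not attained.\<close>

lemma domain_subset_ball:
  fixes \<Omega> :: "(real^'n) set"
  assumes "open \<Omega>" "bounded \<Omega>" "R \<ge> R_dom \<Omega>"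
  shows "\<Omega> \<subseteq> ball 0 R"
proof
  fix x assume x: "x \<in> \<Omega>"
  have bdd: "bdd_above (norm ` \<Omega>)" using assms(2) by (auto simp: bounded_iff bdd_above_def)
  obtain e where e: "e > 0" "ball x e \<subseteq> \<Omega>" using assms(1) x by (meson openE)
  obtain y where y: "y \<in> \<Omega>" "norm y > norm x"
  proof (cases "x = 0")
    case True
    obtain v :: "real^'n" where v: "norm v = e/2" using vector_choose_size[of "e/2"] e by auto
    then have "x + v \<in> ball x e" using e by (simp add: dist_norm)
    then have "x + v \<in> \<Omega>" using e(2) by blast
    then show ?thesis using that[of "x + v"] e(1) v True by simp
  next
    case False
    \<comment> \<open>moving outwards along \<open>x\<close> increases the norm\<close>
    define v where "v = (e / 2 / norm x) *\<^sub>R x"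
    have "x + v \<in> ball x e" using e False by (simp add: dist_norm v_def)
    moreover have "norm (x + v) = (1 + e / 2 / norm x) * norm x"
    proof -
      have "x + v = (1 + e / 2 / norm x) *\<^sub>R x" by (simp add: v_def scaleR_add_left)
      then show ?thesis using e by (simp add: abs_of_pos add_pos_nonneg)
    qed
    then have "norm (x + v) > norm x" using e False by (simp add: distrib_right)
    ultimately show ?thesis using that[of "x + v"] e by auto
  qed
  have "norm y \<le> R_dom \<Omega>" unfolding R_dom_def using bdd y by (intro cSUP_upper) auto
  then show "x \<in> ball 0 R" using y assms by simp
qed

lemma locally_integrable_imp_measurable:
  fixes f :: "real^'n \<Rightarrow> 'b::euclidean_space"
  assumes "open \<Omega>" "locally_integrable \<Omega> f"
  shows "f \<in> borel_measurable (lebesgue_on \<Omega>)"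
proof -
  obtain C :: "nat \<Rightarrow> (real^'n) set" where C: "\<And>n. compact (C n)" "\<And>n. C n \<subseteq> \<Omega>" "\<And>n. C n \<subseteq> interior (C (Suc n))"
    "\<Union> (range C) = \<Omega>"
    using open_Union_compact_subsets[OF assms(1)] by metis
  have mono: "C n \<subseteq> C m" if "n \<le> m" for n m
    using lift_Suc_mono_le[of C n m] C(3) interior_subset that by (meson subset_trans)
  have "(\<lambda>x. if x \<in> \<Omega> then f x else 0) \<in> borel_measurable lebesgue"
  proof (rule borel_measurable_LIMSEQ_metric[where f = "\<lambda>n x. if x \<in> C n then f x else 0"])
    fix n
    have "f \<in> borel_measurable (lebesgue_on (C n))"
      using assms(2) C(1,2)[of n] by (auto simp: locally_integrable_def)
    then show "(\<lambda>x. if x \<in> C n then f x else 0) \<in> borel_measurable lebesgue"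
      using C(1)[of n] by (intro borel_measurable_if_I) (auto intro: lmeasurable_compact fmeasurableD)
  next
    fix x
    show "(\<lambda>n. if x \<in> C n then f x else 0) \<longlonglongrightarrow> (if x \<in> \<Omega> then f x else 0)"
    proof (cases "x \<in> \<Omega>")
      case True
      then obtain m where "x \<in> C m" using C(4) by auto
      then have "eventually (\<lambda>n. (if x \<in> C n then f x else 0) = f x) sequentially"
        using mono by (auto simp: eventually_sequentially)
      then show ?thesis using True by (simp add: tendsto_eventually)
    next
      case False
      then have "x \<notin> C n" for n using C(2) by auto
      then show ?thesis using False by simp
    qed
  qed
  then show ?thesis by (rule borel_measurable_if_D)
qed

lemma W1_weak_grad:
  assumes "u \<in> W1 p \<Omega>" shows "has_weak_gradient \<Omega> u (weak_grad \<Omega> u)"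
proof -
  obtain g where "has_weak_gradient \<Omega> u g" using assms unfolding W1_def by auto
  then show ?thesis unfolding weak_grad_def by (rule someI[where P = "has_weak_gradient \<Omega> u"])
qed

lemma nn_integral_lebesgue_on_eq_lborel:
  assumes "\<Omega> \<in> sets lebesgue"
  shows "(\<integral>\<^sup>+x. f x \<partial>lebesgue_on \<Omega>) = (\<integral>\<^sup>+x. f x * indicator \<Omega> x \<partial>lborel)"
  using assms by (simp add: nn_integral_restrict_space nn_integral_completion)

lemma nn_integral_lebesgue_on_eq_lborel_support:
  assumes "\<Omega> \<in> sets lebesgue" "\<And>x. x \<notin> \<Omega> \<Longrightarrow> f x = 0"
  shows "(\<integral>\<^sup>+x. f x \<partial>lebesgue_on \<Omega>) = (\<integral>\<^sup>+x. f x \<partial>lborel)"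
  unfolding nn_integral_lebesgue_on_eq_lborel[OF assms(1)]
  by (rule nn_integral_cong) (auto simp: indicator_def assms(2))

lemma integral_lebesgue_on_eq_lborel:
  fixes f :: "'a::euclidean_space \<Rightarrow> real"
  assumes "\<Omega> \<in> sets lebesgue" "f \<in> borel_measurable borel" "\<And>x. x \<notin> \<Omega> \<Longrightarrow> f x = 0"
  shows "(LINT x|lebesgue_on \<Omega>. f x) = (LINT x|lborel. f x)"
proof -
  have "(LINT x|lebesgue_on \<Omega>. f x) = (LINT x|lebesgue. indicator \<Omega> x *\<^sub>R f x)"
    using assms(1) by (intro integral_restrict_space) simp
  also have "(\<lambda>x. indicator \<Omega> x *\<^sub>R f x) = f"
    using assms(3) by (intro ext) (simp split: split_indicator)
  also have "(LINT x|lebesgue. f x) = (LINT x|lborel. f x)"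
    using assms(2) by (intro integral_completion) simp
  finally show ?thesis .
qed

lemma continuous_on_UNIV_measurable_lebesgue_on:
  fixes f :: "'a::euclidean_space \<Rightarrow> 'b::euclidean_space"
  assumes "continuous_on UNIV f"
  shows "f \<in> borel_measurable (lebesgue_on S)"
  using borel_measurable_continuous_onI[OF assms] by (intro measurable_restrict_space1 measurable_completion) simp

lemma continuous_compact_support_integrable_power:
  fixes f :: "real^'n \<Rightarrow> 'b::euclidean_space"
  assumes f: "continuous_on UNIV f" and K: "compact K" "\<And>x. x \<notin> K \<Longrightarrow> f x = 0" and n: "n > 0"
    and \<Omega>: "\<Omega> \<in> sets lebesgue"
  shows "integrable (lebesgue_on \<Omega>) (\<lambda>x. norm (f x) ^ n)"
proof -
  obtain r where r: "\<forall>x. norm x > r \<longrightarrow> x \<notin> K" by (rule compact_support_norm_bound[OF K(1)])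
  have "integrable lborel (\<lambda>x. norm (f x) ^ n)"
    by (rule integrable_continuous_bounded_support[of _ r]) (use f K r n in \<open>auto intro!: continuous_intros\<close>)
  then have "integrable lebesgue (\<lambda>x. norm (f x) ^ n)" by (simp add: integrable_completion)
  then have "integrable lebesgue (\<lambda>x. indicator \<Omega> x *\<^sub>R norm (f x) ^ n)"
    using \<Omega> by (intro integrable_mult_indicator) auto
  then show ?thesis using \<Omega> by (simp add: integrable_restrict_space)
qed

lemma continuous_locally_integrable:
  fixes f :: "real^'n \<Rightarrow> 'b::euclidean_space"
  assumes "continuous_on UNIV f"
  shows "locally_integrable \<Omega> f"
  unfolding locally_integrable_def
proof (intro allI impI)
  fix K :: "(real^'n) set" assume K: "compact K" "K \<subseteq> \<Omega>"
  have "integrable lborel (\<lambda>x. indicator K x *\<^sub>R f x)"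
    using continuous_on_subset[OF assms subset_UNIV] by (intro borel_integrable_compact K)
  then have "integrable lebesgue (\<lambda>x. indicator K x *\<^sub>R f x)"
    by (simp add: integrable_completion borel_measurable_integrable)
  then show "integrable (lebesgue_on K) f"
    using K by (subst integrable_restrict_space) (auto intro: fmeasurableD lmeasurable_compact)
qed


section \<open>Exponential integrability for Sobolev functions\<close>

lemma leray_term_eq:
  fixes u :: "real^'n \<Rightarrow> real" and \<Omega> :: "(real^'n) set"
  defines "n \<equiv> CARD('n)"
  assumes \<Omega>: "\<Omega> \<subseteq> ball 0 R" and u: "u \<in> borel_measurable (lebesgue_on \<Omega>)"
  shows "(\<integral>\<^sup>+x. ennreal (norm (ground_slope R u x) ^ n) \<partial>lebesgue_on \<Omega>)
    = ennreal (((real n - 1) / real n) ^ n)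
      * (\<integral>\<^sup>+x. ennreal (\<bar>u x\<bar> ^ n / (norm x ^ n * E1 (norm x / R) ^ n)) \<partial>lebesgue_on \<Omega>)"
proof -
  define \<kappa> where "\<kappa> = ((real n - 1) / real n) ^ n"
  have \<kappa>: "\<kappa> \<ge> 0"
    using one_le_card_finite[where 'a='n] by (auto simp: \<kappa>_def n_def intro!: zero_le_power divide_nonneg_nonneg)
  have gs: "norm (ground_slope R u x) ^ n = \<kappa> * (\<bar>u x\<bar> ^ n / (norm x ^ n * E1 (norm x / R) ^ n))" if "x \<in> \<Omega>" for x
  proof -
    have "norm x < R" using that \<Omega> by auto
    from norm_ground_slope[OF this, of u] show ?thesis
      by (simp add: \<kappa>_def n_def power_mult_distrib power_divide)
  qed
  have m: "(\<lambda>x. ennreal (\<bar>u x\<bar> ^ n / (norm x ^ n * E1 (norm x / R) ^ n))) \<in> borel_measurable (lebesgue_on \<Omega>)"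
  proof -
    have [measurable]: "u \<in> borel_measurable (lebesgue_on \<Omega>)" by (rule u)
    have "(\<lambda>x::real^'n. norm x ^ n * E1 (norm x / R) ^ n) \<in> borel_measurable borel" by measurable
    then have [measurable]: "(\<lambda>x::real^'n. norm x ^ n * E1 (norm x / R) ^ n) \<in> borel_measurable (lebesgue_on \<Omega>)"
      by (intro measurable_restrict_space1 measurable_completion) simp
    show ?thesis by measurable
  qed
  have "(\<integral>\<^sup>+x. ennreal (norm (ground_slope R u x) ^ n) \<partial>lebesgue_on \<Omega>)
     = (\<integral>\<^sup>+x. ennreal \<kappa> * ennreal (\<bar>u x\<bar> ^ n / (norm x ^ n * E1 (norm x / R) ^ n)) \<partial>lebesgue_on \<Omega>)"
  proof (rule nn_integral_cong)
    fix x assume "x \<in> space (lebesgue_on \<Omega>)"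
    then have "x \<in> \<Omega>" by simp
    from gs[OF this] show "ennreal (norm (ground_slope R u x) ^ n)
        = ennreal \<kappa> * ennreal (\<bar>u x\<bar> ^ n / (norm x ^ n * E1 (norm x / R) ^ n))"
      by (simp only: ennreal_mult'[OF \<kappa>])
  qed
  also have "\<dots> = ennreal \<kappa> * (\<integral>\<^sup>+x. ennreal (\<bar>u x\<bar> ^ n / (norm x ^ n * E1 (norm x / R) ^ n)) \<partial>lebesgue_on \<Omega>)" by (rule nn_integral_cmult[OF m])
  finally show ?thesis unfolding \<kappa>_def .
qed

text \<open>In the extended reals \<open>\<infinity> - x = \<infinity>\<close> for every \<open>x\<close>, so the hypothesis forces the gradient energy to be
  finite.\<close>

lemma I_fun_le_1D:
  fixes u :: "real^'n \<Rightarrow> real"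
  assumes \<Omega>: "\<Omega> \<subseteq> ball 0 R" and I: "I_fun u \<Omega> R \<le> 1"
    and u: "u \<in> borel_measurable (lebesgue_on \<Omega>)"
  shows "(\<integral>\<^sup>+x. ennreal (norm (weak_grad \<Omega> u x) ^ CARD('n)) \<partial>lebesgue_on \<Omega>) < \<infinity>"
    "(\<integral>\<^sup>+x. ennreal (norm (weak_grad \<Omega> u x) ^ CARD('n)) \<partial>lebesgue_on \<Omega>)
      \<le> 1 + (\<integral>\<^sup>+x. ennreal (norm (ground_slope R u x) ^ CARD('n)) \<partial>lebesgue_on \<Omega>)"
proof -
  define n where "n = CARD('n)"
  define \<kappa> where "\<kappa> = ((real n - 1) / real n) ^ n"
  have "n > 0" by (simp add: n_def)
  then have \<kappa>: "\<kappa> \<ge> 0" by (auto simp: \<kappa>_def intro!: zero_le_power divide_nonneg_nonneg)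
  define G where "G = (\<integral>\<^sup>+x. ennreal (norm (weak_grad \<Omega> u x) ^ n) \<partial>lebesgue_on \<Omega>)"
  define X where "X = (\<integral>\<^sup>+x. ennreal (\<bar>u x\<bar> ^ n / (norm x ^ n * E1 (norm x / R) ^ n)) \<partial>lebesgue_on \<Omega>)"
  have Y: "(\<integral>\<^sup>+x. ennreal (norm (ground_slope R u x) ^ n) \<partial>lebesgue_on \<Omega>) = ennreal \<kappa> * X"
    unfolding X_def \<kappa>_def n_def by (rule leray_term_eq[OF \<Omega> u])
  have I': "enn2ereal G - ereal \<kappa> * enn2ereal X \<le> 1"
    using I unfolding I_fun_def G_def X_def \<kappa>_def n_def .
  have fin: "G \<noteq> top"
  proof
    assume "G = top"
    then have "enn2ereal G = \<infinity>" by (simp add: top_ennreal.rep_eq top_ereal_def)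
    then show False using I' by simp
  qed
  then obtain g where g: "G = ennreal g" "g \<ge> 0" by (cases G) auto
  have GY: "G \<le> 1 + ennreal \<kappa> * X"
  proof (cases "ennreal \<kappa> * X = top")
    case False
    then obtain y where y: "ennreal \<kappa> * X = ennreal y" "y \<ge> 0" by (cases "ennreal \<kappa> * X") auto
    have "ereal \<kappa> * enn2ereal X = enn2ereal (ennreal \<kappa> * X)"
      using \<kappa> by (simp add: times_ennreal.rep_eq enn2ereal_ennreal)
    then have "ereal g - ereal y \<le> 1" using I' g y by (simp add: enn2ereal_ennreal)
    then have "g \<le> 1 + y" by (simp add: one_ereal_def)
    then have "ennreal g \<le> ennreal (1 + y)" by (rule ennreal_leI)
    then show ?thesis using g y by (simp add: ennreal_plus)
  qed simp
  show "(\<integral>\<^sup>+x. ennreal (norm (weak_grad \<Omega> u x) ^ CARD('n)) \<partial>lebesgue_on \<Omega>) < \<infinity>"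
    using fin unfolding G_def n_def by (simp add: less_top)
  show "(\<integral>\<^sup>+x. ennreal (norm (weak_grad \<Omega> u x) ^ CARD('n)) \<partial>lebesgue_on \<Omega>)
      \<le> 1 + (\<integral>\<^sup>+x. ennreal (norm (ground_slope R u x) ^ CARD('n)) \<partial>lebesgue_on \<Omega>)"
    using GY unfolding Y[symmetric] G_def n_def .
qed

lemma integrable_norm_diff_power:
  fixes f g :: "'a \<Rightarrow> 'b::euclidean_space"
  assumes [measurable]: "f \<in> borel_measurable M" "g \<in> borel_measurable M"
    and "integrable M (\<lambda>x. norm (f x) ^ n)" "integrable M (\<lambda>x. norm (g x) ^ n)"
  shows "integrable M (\<lambda>x. norm (f x - g x) ^ n)"
proof (rule Bochner_Integration.integrable_bound)
  show "integrable M (\<lambda>x. 2^n * (norm (f x) ^ n + norm (g x) ^ n))" using assms(3,4) by simp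
  show "AE x in M. norm (norm (f x - g x) ^ n) \<le> norm (2^n * (norm (f x) ^ n + norm (g x) ^ n))"
  proof (rule AE_I2)
    fix x
    have "norm (f x - g x) ^ n \<le> (norm (f x) + norm (g x)) ^ n" by (intro power_mono norm_triangle_ineq4) auto
    also have "\<dots> \<le> 2^n * (norm (f x) ^ n + norm (g x) ^ n)" by (intro power_add_le_two_power) auto
    finally show "norm (norm (f x - g x) ^ n) \<le> norm (2^n * (norm (f x) ^ n + norm (g x) ^ n))" by simp
  qed
qed measurable

text \<open>The approximating test functions need not satisfy \<open>I_n \<le> 1\<close>, but along a subsequence they satisfy it up to a
  constant: their energies converge, and their Leray terms are, by Fatou, asymptotically not smaller than that of \<open>u\<close>.\<close>

lemma W1_0_exponential_bound:
  assumes n2: "CARD('n::finite) \<ge> 2"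
  obtains A B where "A > 0" "B > 0"
   "\<And>(\<Omega> :: (real^'n) set) R u. \<lbrakk>open \<Omega>; bounded \<Omega>; R \<ge> R_dom \<Omega>; u \<in> W1_0 CARD('n) \<Omega>; I_fun u \<Omega> R \<le> 1\<rbrakk> \<Longrightarrow>
     (\<integral>\<^sup>+x. ennreal (exp (A * (\<bar>u x\<bar> / E2 (norm x / R) powr (2 / CARD('n))) powr (real CARD('n) / (real CARD('n) - 1)))) \<partial>lebesgue_on \<Omega>)
       \<le> ennreal B * emeasure lebesgue \<Omega>"
proof -
  define n where "n = CARD('n)"
  have Dn: "DIM(real^'n) = n" by (simp add: n_def)
  have nn: "n \<ge> 2" using n2 by (simp add: n_def)
  have nD: "DIM(real^'n) \<ge> 2" using n2 by simp
  define p where "p = real n / (real n - 1)"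
  have p: "p > 0" using nn by (simp add: p_def)
  obtain A B where A0: "A > 0" and B0: "B > 0" and
   web: "\<And>(u :: real^'n \<Rightarrow> real) Du R K \<Omega>. \<lbrakk>\<And>x. (u has_derivative (\<lambda>h. Du x \<bullet> h)) (at x); continuous_on UNIV Du;
     compact K; K \<subseteq> \<Omega>; open \<Omega>; bounded \<Omega>; \<Omega> \<subseteq> ball 0 R; \<And>x. x \<notin> K \<Longrightarrow> u x = 0;
     (\<integral>\<^sup>+x. ennreal (norm (Du x) ^ n) \<partial>lborel) \<le> ennreal 3 + (\<integral>\<^sup>+x. ennreal (norm (ground_slope R u x) ^ n) \<partial>lborel)\<rbrakk> \<Longrightarrow>
     (\<integral>\<^sup>+x. ennreal (exp (A * (\<bar>u x\<bar> / E2 (norm x / R) powr (2 / n)) powr p)) * indicator \<Omega> x \<partial>lborel)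
       \<le> ennreal B * emeasure lborel \<Omega>"
  proof (rule weighted_exponential_bound[OF nD], goal_cases)
    case (1 A B)
    show ?case by (rule 1(1)[OF 1(2,3)], rule 1(4)[unfolded Dn, folded p_def])
  qed
  have "(\<integral>\<^sup>+x. ennreal (exp (A * (\<bar>u x\<bar> / E2 (norm x / R) powr (2 / n)) powr p)) \<partial>lebesgue_on \<Omega>)
       \<le> ennreal B * emeasure lebesgue \<Omega>"
    if \<Omega>: "open \<Omega>" "bounded \<Omega>" "R \<ge> R_dom \<Omega>" and u: "u \<in> W1_0 CARD('n) \<Omega>" and I: "I_fun u \<Omega> R \<le> 1"
    for \<Omega> :: "(real^'n) set" and R u
  proof -
    have \<Omega>R: "\<Omega> \<subseteq> ball 0 R" by (rule domain_subset_ball[OF \<Omega>])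
    have \<Omega>L: "\<Omega> \<in> sets lebesgue" using \<Omega>(1) by auto
    have \<Omega>B: "\<Omega> \<in> sets borel" using \<Omega>(1) by auto
    have uW: "u \<in> W1 n \<Omega>" using u by (simp add: W1_0_def n_def)
    define W where "W = weak_grad \<Omega> u"
    obtain \<phi> where \<phi>: "\<And>k. test_function \<Omega> (\<phi> k)"
      and lim\<phi>: "(\<lambda>k. LINT x|lebesgue_on \<Omega>. \<bar>\<phi> k x - u x\<bar> ^ n) \<longlonglongrightarrow> 0"
      and limD: "(\<lambda>k. LINT x|lebesgue_on \<Omega>. norm (grad (\<phi> k) x - W x) ^ n) \<longlonglongrightarrow> 0"
      using u unfolding W1_0_def n_def W_def by blast
    have um[measurable]: "u \<in> borel_measurable (lebesgue_on \<Omega>)" and ui: "integrable (lebesgue_on \<Omega>) (\<lambda>x. norm (u x) ^ n)"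
      using uW by (auto simp: W1_def Lp_def)
    have Wm[measurable]: "W \<in> borel_measurable (lebesgue_on \<Omega>)"
      using W1_weak_grad[OF uW] \<Omega>(1) unfolding W_def has_weak_gradient_def
      by (blast intro: locally_integrable_imp_measurable)
    note IG = I_fun_le_1D[OF \<Omega>R I um, folded n_def W_def]
    have Wi: "integrable (lebesgue_on \<Omega>) (\<lambda>x. norm (W x) ^ n)"
      using IG(1) by (simp add: integrable_iff_bounded)
    have \<phi>c: "continuous_on UNIV (\<phi> k)" "continuous_on UNIV (grad (\<phi> k))" for k
      using test_function_continuous[OF \<phi>] test_function_has_derivative(2)[OF \<phi>] by auto
    have \<phi>m[measurable]: "\<phi> k \<in> borel_measurable (lebesgue_on \<Omega>)" "grad (\<phi> k) \<in> borel_measurable (lebesgue_on \<Omega>)" for k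
      by (rule continuous_on_UNIV_measurable_lebesgue_on \<phi>c)+
    have \<phi>i: "integrable (lebesgue_on \<Omega>) (\<lambda>x. norm (\<phi> k x) ^ n)" "integrable (lebesgue_on \<Omega>) (\<lambda>x. norm (grad (\<phi> k) x) ^ n)" for k
    proof -
      obtain K where K: "compact K" "K \<subseteq> \<Omega>" "\<And>x. x \<notin> K \<Longrightarrow> \<phi> k x = 0" "\<And>x. x \<notin> K \<Longrightarrow> grad (\<phi> k) x = 0"
        by (rule test_function_support[OF \<phi>[of k]]) blast
      show "integrable (lebesgue_on \<Omega>) (\<lambda>x. norm (\<phi> k x) ^ n)"
        by (rule continuous_compact_support_integrable_power[OF \<phi>c(1) K(1,3) _ \<Omega>L]) (use nn in simp_all)
      show "integrable (lebesgue_on \<Omega>) (\<lambda>x. norm (grad (\<phi> k) x) ^ n)"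
        by (rule continuous_compact_support_integrable_power[OF \<phi>c(2) K(1,4) _ \<Omega>L]) (use nn in simp_all)
    qed
    have di: "integrable (lebesgue_on \<Omega>) (\<lambda>x. norm (\<phi> k x - u x) ^ n)" "integrable (lebesgue_on \<Omega>) (\<lambda>x. norm (grad (\<phi> k) x - W x) ^ n)" for k
      by (rule integrable_norm_diff_power \<phi>m um Wm \<phi>i ui Wi)+
    \<comment> \<open>a subsequence converges almost everywhere\<close>
    have "\<exists>r. strict_mono r \<and> (AE x in lebesgue_on \<Omega>. (\<lambda>k. norm (\<phi> (r k) x - u x) ^ n) \<longlonglongrightarrow> 0)"
      by (rule tendsto_L1_AE_subseq[OF di(1)]) (use lim\<phi> in simp)
    then obtain r where r: "strict_mono r" "AE x in lebesgue_on \<Omega>. (\<lambda>k. norm (\<phi> (r k) x - u x) ^ n) \<longlonglongrightarrow> 0" by blast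
    have ae: "AE x in lebesgue_on \<Omega>. (\<lambda>k. \<phi> (r k) x) \<longlonglongrightarrow> u x"
      using r(2)
    proof eventually_elim
      case (elim x)
      have "(\<lambda>k. root n (norm (\<phi> (r k) x - u x) ^ n)) \<longlonglongrightarrow> root n 0"
        using elim by (rule tendsto_real_root)
      then have "(\<lambda>k. norm (\<phi> (r k) x - u x)) \<longlonglongrightarrow> 0" using nn by (simp add: real_root_power_cancel)
      then have "(\<lambda>k. \<phi> (r k) x - u x) \<longlonglongrightarrow> 0" by (rule tendsto_norm_zero_cancel)
      then show ?case by (simp add: LIM_zero_iff)
    qed
    obtain G where G: "(\<integral>\<^sup>+x. ennreal (norm (W x) ^ n) \<partial>lebesgue_on \<Omega>) = ennreal G" "G \<ge> 0"
      using IG(1) by (cases "(\<integral>\<^sup>+x. ennreal (norm (W x) ^ n) \<partial>lebesgue_on \<Omega>)") auto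
    have GI: "(LINT x|lebesgue_on \<Omega>. norm (W x) ^ n) = G"
      using G nn_integral_eq_integral[OF Wi] by (simp add: integral_nonneg_AE)
    have extend: "(\<integral>\<^sup>+x. ennreal (norm (F x) ^ n) \<partial>lebesgue_on \<Omega>) = (\<integral>\<^sup>+x. ennreal (norm (F x) ^ n) \<partial>lborel)"
      if "\<And>x. x \<notin> \<Omega> \<Longrightarrow> F x = 0" for F :: "real^'n \<Rightarrow> real^'n"
      unfolding nn_integral_lebesgue_on_eq_lborel[OF \<Omega>L]
      using that nn by (intro nn_integral_cong) (auto simp: indicator_def)
    have supp: "\<phi> k x = 0" "grad (\<phi> k) x = 0" if "x \<notin> \<Omega>" for k x
    proof -
      obtain K where K: "K \<subseteq> \<Omega>" "\<And>x. x \<notin> K \<Longrightarrow> \<phi> k x = 0" "\<And>x. x \<notin> K \<Longrightarrow> grad (\<phi> k) x = 0"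
        by (rule test_function_support[OF \<phi>[of k]]) blast
      then show "\<phi> k x = 0" "grad (\<phi> k) x = 0" using that by auto
    qed
    define Y where "Y k = (\<integral>\<^sup>+x. ennreal (norm (ground_slope R (\<phi> k) x) ^ n) \<partial>lebesgue_on \<Omega>)" for k
    \<comment> \<open>the Dirichlet energies converge from above\<close>
    have ev1: "eventually (\<lambda>k. (\<integral>\<^sup>+x. ennreal (norm (grad (\<phi> k) x) ^ n) \<partial>lebesgue_on \<Omega>) \<le> ennreal (G + 1)) sequentially"
    proof -
      have "((\<lambda>\<theta>. (1 / (1 - \<theta>))^n * G) \<longlongrightarrow> (1 / (1 - 0))^n * G) (at_right (0::real))"
        by (intro tendsto_intros) auto
      then have "eventually (\<lambda>\<theta>. (1 / (1 - \<theta>))^n * G < G + 1/2) (at_right (0::real))"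
        by (rule order_tendstoD) simp
      moreover have "eventually (\<lambda>\<theta>::real. 0 < \<theta> \<and> \<theta> < 1) (at_right 0)"
        by (auto simp: eventually_at_right[of 0 1] intro!: exI[of _ 1])
      ultimately have "eventually (\<lambda>\<theta>::real. (1 / (1 - \<theta>))^n * G < G + 1/2 \<and> 0 < \<theta> \<and> \<theta> < 1) (at_right 0)"
        by (rule eventually_conj)
      then obtain \<theta> :: real where \<theta>: "(1 / (1 - \<theta>))^n * G < G + 1/2" "0 < \<theta>" "\<theta> < 1"
        using eventually_happens[of _ "at_right (0::real)"] by (auto simp: trivial_limit_at_right_real)
      have "(\<lambda>k. (1/\<theta>)^n * (LINT x|lebesgue_on \<Omega>. norm (grad (\<phi> k) x - W x) ^ n)) \<longlonglongrightarrow> (1/\<theta>)^n * 0"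
        by (intro tendsto_intros limD)
      then have "eventually (\<lambda>k. (1/\<theta>)^n * (LINT x|lebesgue_on \<Omega>. norm (grad (\<phi> k) x - W x) ^ n) < 1/2) sequentially"
        by (rule order_tendstoD) simp
      then show ?thesis
      proof eventually_elim
        case (elim k)
        have "(\<integral>\<^sup>+x. ennreal (norm (grad (\<phi> k) x) ^ n) \<partial>lebesgue_on \<Omega>) = ennreal (LINT x|lebesgue_on \<Omega>. norm (grad (\<phi> k) x) ^ n)"
          by (rule nn_integral_eq_integral[OF \<phi>i(2)]) simp
        also have "\<dots> \<le> ennreal (LINT x|lebesgue_on \<Omega>. (1 / (1 - \<theta>))^n * norm (W x) ^ n + (1/\<theta>)^n * norm (grad (\<phi> k) x - W x) ^ n)"
        proof (intro ennreal_leI integral_mono)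
          fix x
          have "norm (grad (\<phi> k) x) ^ n \<le> (norm (W x) + norm (grad (\<phi> k) x - W x)) ^ n"
            using norm_triangle_ineq[of "W x" "grad (\<phi> k) x - W x"] by (intro power_mono) auto
          also have "\<dots> \<le> (1 / (1 - \<theta>))^n * norm (W x) ^ n + (1/\<theta>)^n * norm (grad (\<phi> k) x - W x) ^ n"
            using \<theta> by (intro add_power_le_split) auto
          finally show "norm (grad (\<phi> k) x) ^ n \<le> (1 / (1 - \<theta>))^n * norm (W x) ^ n + (1/\<theta>)^n * norm (grad (\<phi> k) x - W x) ^ n" .
        qed (use \<phi>i di Wi in auto)
        also have "(LINT x|lebesgue_on \<Omega>. (1 / (1 - \<theta>))^n * norm (W x) ^ n + (1/\<theta>)^n * norm (grad (\<phi> k) x - W x) ^ n)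
           = (1 / (1 - \<theta>))^n * G + (1/\<theta>)^n * (LINT x|lebesgue_on \<Omega>. norm (grad (\<phi> k) x - W x) ^ n)"
          using di(2) Wi by (simp add: GI)
        also have "ennreal \<dots> \<le> ennreal (G + 1)" using \<theta>(1) elim by (intro ennreal_leI) linarith
        finally show ?case .
      qed
    qed
    \<comment> \<open>Fatou's lemma for the Leray term\<close>
    have Yl: "(\<integral>\<^sup>+x. ennreal (norm (ground_slope R u x) ^ n) \<partial>lebesgue_on \<Omega>) \<le> liminf (\<lambda>k. Y (r k))"
    proof -
      have "(\<integral>\<^sup>+x. ennreal (norm (ground_slope R u x) ^ n) \<partial>lebesgue_on \<Omega>)
         \<le> (\<integral>\<^sup>+x. liminf (\<lambda>k. ennreal (norm (ground_slope R (\<phi> (r k)) x) ^ n)) \<partial>lebesgue_on \<Omega>)"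
      proof (rule nn_integral_mono_AE)
        show "AE x in lebesgue_on \<Omega>. ennreal (norm (ground_slope R u x) ^ n) \<le> liminf (\<lambda>k. ennreal (norm (ground_slope R (\<phi> (r k)) x) ^ n))"
          using ae
        proof eventually_elim
          case (elim x)
          have "(\<lambda>k. norm (ground_slope R (\<phi> (r k)) x) ^ n) \<longlonglongrightarrow> norm (ground_slope R u x) ^ n"
            unfolding ground_slope_def divide_inverse by (intro tendsto_intros elim)
          then have "(\<lambda>k. ennreal (norm (ground_slope R (\<phi> (r k)) x) ^ n)) \<longlonglongrightarrow> ennreal (norm (ground_slope R u x) ^ n)"
            by (rule tendsto_ennrealI)
          from lim_imp_Liminf[OF sequentially_bot this] show ?case by (simp only: order_refl)
        qed
      qed
      also have "\<dots> \<le> liminf (\<lambda>k. \<integral>\<^sup>+x. ennreal (norm (ground_slope R (\<phi> (r k)) x) ^ n) \<partial>lebesgue_on \<Omega>)"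
      proof (rule nn_integral_liminf)
        fix k
        have [measurable]: "\<phi> (r k) \<in> borel_measurable borel"
          using \<phi>c(1) by (intro borel_measurable_continuous_onI)
        have "(\<lambda>x. ennreal (norm (ground_slope R (\<phi> (r k)) x) ^ n)) \<in> borel_measurable borel"
          unfolding ground_slope_def[abs_def] by measurable
        then show "(\<lambda>x. ennreal (norm (ground_slope R (\<phi> (r k)) x) ^ n)) \<in> borel_measurable (lebesgue_on \<Omega>)"
          by (intro measurable_restrict_space1 measurable_completion) simp
      qed
      finally show ?thesis unfolding Y_def .
    qed
    \<comment> \<open>the liminf may be infinite, so the comparison is made with \<open>G - 1\<close> and \<open>G - 2\<close>\<close>
    have ev2: "eventually (\<lambda>k. ennreal G \<le> ennreal 2 + Y (r k)) sequentially"
    proof (cases "G < 2")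
      case True
      then have "ennreal G \<le> ennreal 2" by (intro ennreal_leI) simp
      then have "ennreal G \<le> ennreal 2 + Y (r k)" for k by (rule order_trans) simp
      then show ?thesis by simp
    next
      case False
      have "ennreal (1 + (G - 1)) \<le> 1 + liminf (\<lambda>k. Y (r k))"
        using order_trans[OF IG(2) add_left_mono[OF Yl]] unfolding G(1) by simp
      moreover have "ennreal (1 + (G - 1)) = 1 + ennreal (G - 1)" using False by (subst ennreal_plus) auto
      ultimately have "ennreal (G - 1) \<le> liminf (\<lambda>k. Y (r k))"
        by (simp add: ennreal_add_left_cancel_le)
      moreover have "ennreal (G - 2) < ennreal (G - 1)" using False by (intro ennreal_lessI) auto
      ultimately have "ennreal (G - 2) < liminf (\<lambda>k. Y (r k))" by (rule order_less_le_trans[rotated])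
      then have "eventually (\<lambda>k. ennreal (G - 2) < Y (r k)) sequentially" by (rule less_LiminfD)
      then show ?thesis
      proof eventually_elim
        case (elim k)
        have "ennreal G = ennreal 2 + ennreal (G - 2)" using False by (subst ennreal_plus[symmetric]) auto
        also have "\<dots> \<le> ennreal 2 + Y (r k)" using elim by (intro add_left_mono) auto
        finally show ?case .
      qed
    qed
    have "eventually (\<lambda>k. (\<integral>\<^sup>+x. ennreal (norm (grad (\<phi> (r k)) x) ^ n) \<partial>lebesgue_on \<Omega>) \<le> ennreal (G + 1)) sequentially"
      using ev1 r(1) by (rule eventually_subseq[rotated])
    then have bound: "eventually (\<lambda>k. (\<integral>\<^sup>+x. ennreal (exp (A * (\<bar>\<phi> (r k) x\<bar> / E2 (norm x / R) powr (2 / n)) powr p)) \<partial>lebesgue_on \<Omega>)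
        \<le> ennreal B * emeasure lborel \<Omega>) sequentially"
      using ev2
    proof eventually_elim
      case (elim k)
      obtain K where K: "compact K" "K \<subseteq> \<Omega>" "\<And>x. x \<notin> K \<Longrightarrow> \<phi> (r k) x = 0"
        by (rule test_function_support[OF \<phi>[of "r k"]]) blast
      have "(\<integral>\<^sup>+x. ennreal (norm (grad (\<phi> (r k)) x) ^ n) \<partial>lborel) \<le> ennreal G + ennreal 1"
      proof -
        have "(\<integral>\<^sup>+x. ennreal (norm (grad (\<phi> (r k)) x) ^ n) \<partial>lebesgue_on \<Omega>) = (\<integral>\<^sup>+x. ennreal (norm (grad (\<phi> (r k)) x) ^ n) \<partial>lborel)"
          by (rule extend) (rule supp(2))
        then show ?thesis using elim(1) G(2) by (simp add: ennreal_plus)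
      qed
      also have "\<dots> \<le> (ennreal 2 + Y (r k)) + ennreal 1" using elim(2) by (rule add_right_mono)
      also have "\<dots> = ennreal 3 + Y (r k)"
      proof -
        have "ennreal 2 + ennreal 1 = ennreal 3" by (subst ennreal_plus[symmetric]) auto
        then show ?thesis by (metis add.assoc add.commute)
      qed
      also have "Y (r k) = (\<integral>\<^sup>+x. ennreal (norm (ground_slope R (\<phi> (r k)) x) ^ n) \<partial>lborel)"
        unfolding Y_def by (rule extend) (simp add: ground_slope_def supp)
      finally have "(\<integral>\<^sup>+x. ennreal (norm (grad (\<phi> (r k)) x) ^ n) \<partial>lborel)
         \<le> ennreal 3 + (\<integral>\<^sup>+x. ennreal (norm (ground_slope R (\<phi> (r k)) x) ^ n) \<partial>lborel)" .
      from web[OF test_function_has_derivative[OF \<phi>] K(1,2) \<Omega>(1,2) \<Omega>R K(3) this]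
      show ?case unfolding nn_integral_lebesgue_on_eq_lborel[OF \<Omega>L] .
    qed
    have "(\<integral>\<^sup>+x. ennreal (exp (A * (\<bar>u x\<bar> / E2 (norm x / R) powr (2 / n)) powr p)) \<partial>lebesgue_on \<Omega>)
      \<le> (\<integral>\<^sup>+x. liminf (\<lambda>k. ennreal (exp (A * (\<bar>\<phi> (r k) x\<bar> / E2 (norm x / R) powr (2 / n)) powr p))) \<partial>lebesgue_on \<Omega>)"
    proof (rule nn_integral_mono_AE)
      show "AE x in lebesgue_on \<Omega>. ennreal (exp (A * (\<bar>u x\<bar> / E2 (norm x / R) powr (2 / n)) powr p))
        \<le> liminf (\<lambda>k. ennreal (exp (A * (\<bar>\<phi> (r k) x\<bar> / E2 (norm x / R) powr (2 / n)) powr p)))"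
        using ae
      proof eventually_elim
        case (elim x)
        have "(\<lambda>k. \<bar>\<phi> (r k) x\<bar> / E2 (norm x / R) powr (2 / n)) \<longlonglongrightarrow> \<bar>u x\<bar> / E2 (norm x / R) powr (2 / n)"
          unfolding divide_inverse by (intro tendsto_intros elim)
        then have "(\<lambda>k. (\<bar>\<phi> (r k) x\<bar> / E2 (norm x / R) powr (2 / n)) powr p) \<longlonglongrightarrow> (\<bar>u x\<bar> / E2 (norm x / R) powr (2 / n)) powr p"
          by (rule tendsto_powr') (use p in \<open>auto intro!: tendsto_intros\<close>)
        then have "(\<lambda>k. ennreal (exp (A * (\<bar>\<phi> (r k) x\<bar> / E2 (norm x / R) powr (2 / n)) powr p))) \<longlonglongrightarrow> ennreal (exp (A * (\<bar>u x\<bar> / E2 (norm x / R) powr (2 / n)) powr p))"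
          by (intro tendsto_ennrealI tendsto_exp tendsto_mult tendsto_const)
        from lim_imp_Liminf[OF sequentially_bot this] show ?case by (simp only: order_refl)
      qed
    qed
    also have "\<dots> \<le> liminf (\<lambda>k. \<integral>\<^sup>+x. ennreal (exp (A * (\<bar>\<phi> (r k) x\<bar> / E2 (norm x / R) powr (2 / n)) powr p)) \<partial>lebesgue_on \<Omega>)"
    proof (rule nn_integral_liminf)
      fix k
      have [measurable]: "\<phi> (r k) \<in> borel_measurable borel"
        using \<phi>c(1) by (intro borel_measurable_continuous_onI)
      have "(\<lambda>x. ennreal (exp (A * (\<bar>\<phi> (r k) x\<bar> / E2 (norm x / R) powr (2 / n)) powr p))) \<in> borel_measurable borel"
        by measurable
      then show "(\<lambda>x. ennreal (exp (A * (\<bar>\<phi> (r k) x\<bar> / E2 (norm x / R) powr (2 / n)) powr p))) \<in> borel_measurable (lebesgue_on \<Omega>)"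
        by (intro measurable_restrict_space1 measurable_completion) simp
    qed
    also have "\<dots> \<le> ennreal B * emeasure lborel \<Omega>"
      by (rule Liminf_le) (use bound in auto)
    also have "emeasure lborel \<Omega> = emeasure lebesgue \<Omega>" using \<Omega>B by simp
    finally show ?thesis .
  qed
  note bound = this
  show ?thesis by (rule that[OF A0 B0]) (rule bound[unfolded n_def p_def]; assumption)
qed


section \<open>Smooth functions and bumps\<close>

text \<open>This predicate and the next one are versions of \<open>Ck\<close> relative to an open set: \<open>ln\<close> and powers are
  smooth on the positive half line only, and \<open>E1\<close> away from the origin.  The derivatives are quantified existentially so
  that the chain rule needs no equation for \<open>grad\<close>.\<close>

primrec diff_upto :: "nat \<Rightarrow> real set \<Rightarrow> (real \<Rightarrow> real) \<Rightarrow> bool" where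
  "diff_upto 0 S g \<longleftrightarrow> continuous_on S g"
| "diff_upto (Suc k) S g \<longleftrightarrow> (\<exists>g'. (\<forall>x\<in>S. (g has_real_derivative g' x) (at x)) \<and> diff_upto k S g')"

primrec Ck_on :: "nat \<Rightarrow> (real^'n) set \<Rightarrow> (real^'n \<Rightarrow> real) \<Rightarrow> bool" where
  "Ck_on 0 S f \<longleftrightarrow> continuous_on S f"
| "Ck_on (Suc k) S f \<longleftrightarrow>
     (\<exists>D. (\<forall>x\<in>S. (f has_derivative (\<lambda>h. D x \<bullet> h)) (at x)) \<and> (\<forall>i. Ck_on k S (\<lambda>x. D x $ i)))"

lemma diff_upto_lincomb:
  "diff_upto k S f \<Longrightarrow> diff_upto k S g \<Longrightarrow> diff_upto k S (\<lambda>x. a * f x + b * g x)"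
proof (induction k arbitrary: f g)
  case 0
  then show ?case by (auto intro!: continuous_intros)
next
  case (Suc k)
  then obtain f' g' where *: "\<forall>x\<in>S. (f has_real_derivative f' x) (at x)" "diff_upto k S f'"
    "\<forall>x\<in>S. (g has_real_derivative g' x) (at x)" "diff_upto k S g'" by auto
  have "\<forall>x\<in>S. ((\<lambda>x. a * f x + b * g x) has_real_derivative a * f' x + b * g' x) (at x)"
    using * by (auto intro!: DERIV_add DERIV_cmult)
  then show ?case using Suc.IH[OF *(2,4)] by auto
qed

lemma diff_upto_powr: "diff_upto k {0<..} (\<lambda>x. c * x powr a)"
proof (induction k arbitrary: a c)
  case 0
  show ?case by (auto intro!: continuous_intros)
next
  case (Suc k)
  have "\<forall>x\<in>{0<..}. ((\<lambda>x. c * x powr a) has_real_derivative (c * a) * x powr (a - 1)) (at x)"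
    by (auto intro!: derivative_eq_intros)
  then show ?case using Suc.IH by auto
qed

lemma diff_upto_ln: "diff_upto k {0<..} ln"
proof (cases k)
  case 0
  then show ?thesis by (auto intro!: continuous_intros)
next
  case (Suc m)
  have "\<forall>x\<in>{0<..}. (ln has_real_derivative 1 * x powr (-1)) (at x)"
    by (auto intro!: derivative_eq_intros simp: powr_minus_divide)
  then show ?thesis unfolding Suc diff_upto.simps using diff_upto_powr[of m 1 "-1"]
    by (intro exI[of _ "\<lambda>x. 1 * x powr (-1)"] conjI)
qed

text \<open>The family \<open>x^(-j) exp (-1/x)\<close>, extended by zero, is closed under differentiation up to linear combinations,
  whence all its members are smooth.\<close>

definition flat_fun :: "nat \<Rightarrow> real \<Rightarrow> real" where
  "flat_fun j x = (if x > 0 then inverse x ^ j * exp (- inverse x) else 0)"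

lemma flat_fun_has_real_derivative:
  "(flat_fun j has_real_derivative (- real j) * flat_fun (j+1) x + 1 * flat_fun (j+2) x) (at x)"
proof -
  consider "x > 0" | "x < 0" | "x = 0" by linarith
  then show ?thesis
  proof cases
    case 1
    have "((\<lambda>x. inverse x ^ j * exp (- inverse x)) has_real_derivative
       (- real j) * (inverse x ^ (j+1) * exp (- inverse x)) + inverse x ^ (j+2) * exp (- inverse x)) (at x)"
    proof -
      have i: "(inverse has_real_derivative - (inverse x ^ 2)) (at x)"
        using 1 DERIV_inverse[of x] by (simp add: numeral_2_eq_2)
      have e: "((\<lambda>x. exp (- inverse x)) has_real_derivative exp (- inverse x) * inverse x ^ 2) (at x)"
        using DERIV_chain2[OF DERIV_exp DERIV_minus[OF i]] by simp
      have "((\<lambda>x. inverse x ^ j) has_real_derivative real j * inverse x ^ (j - Suc 0) * (- (inverse x ^ 2))) (at x)"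
        using DERIV_power[OF i, of j] by (simp add: mult_ac)
      from DERIV_mult[OF this e] show ?thesis
        by (rule DERIV_cong) (cases j; simp add: power2_eq_square algebra_simps)
    qed
    then have "(flat_fun j has_real_derivative
       (- real j) * (inverse x ^ (j+1) * exp (- inverse x)) + inverse x ^ (j+2) * exp (- inverse x)) (at x)"
      by (rule has_field_derivative_transform_within_open[of _ _ _ "{0<..}"]) (use 1 in \<open>auto simp: flat_fun_def\<close>)
    then show ?thesis using 1 by (simp add: flat_fun_def)
  next
    case 2
    have "((\<lambda>_. 0) has_real_derivative 0) (at x)" by simp
    then have "(flat_fun j has_real_derivative 0) (at x)"
      by (rule has_field_derivative_transform_within_open[of _ _ _ "{..<0}"])
         (use 2 in \<open>auto simp: flat_fun_def\<close>)
    then show ?thesis using 2 by (simp add: flat_fun_def)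
  next
    case 3
    \<comment> \<open>at the origin the exponential beats every power\<close>
    have l: "((\<lambda>h. flat_fun j h / h) \<longlongrightarrow> 0) (at_left 0)"
      by (rule Lim_transform_eventually[OF tendsto_const])
         (auto simp: eventually_at_left[of "-1" 0] flat_fun_def intro!: exI[of _ "-1"])
    have "((\<lambda>h. (inverse h) ^ (j+1) / exp (inverse h)) \<longlongrightarrow> 0) (at_right (0::real))"
      by (rule filterlim_compose[OF tendsto_power_div_exp_0 filterlim_inverse_at_top_right])
    then have r: "((\<lambda>h. flat_fun j h / h) \<longlongrightarrow> 0) (at_right 0)"
      by (rule Lim_transform_eventually)
         (auto simp: eventually_at_right[of 0 1] flat_fun_def exp_minus divide_inverse mult_ac intro!: exI[of _ 1])
    have "((\<lambda>h. flat_fun j h / h) \<longlongrightarrow> 0) (at 0)" using l r by (simp add: filterlim_split_at)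
    then show ?thesis using 3 by (simp add: DERIV_def flat_fun_def)
  qed
qed

lemma diff_upto_flat_fun: "diff_upto k UNIV (flat_fun j)"
proof (induction k arbitrary: j)
  case 0
  show ?case using flat_fun_has_real_derivative
    by (auto intro!: continuous_at_imp_continuous_on DERIV_isCont)
next
  case (Suc k)
  show ?case
    using flat_fun_has_real_derivative[of j] diff_upto_lincomb[OF Suc.IH[of "j+1"] Suc.IH[of "j+2"], of "- real j" 1]
    unfolding diff_upto.simps
    by (intro exI[of _ "\<lambda>x. - real j * flat_fun (j+1) x + 1 * flat_fun (j+2) x"] conjI ballI)
qed

lemma flat_fun_0_bounds: "0 \<le> flat_fun 0 x" "flat_fun 0 x \<le> 1" "x \<le> 0 \<Longrightarrow> flat_fun 0 x = 0"
  by (auto simp: flat_fun_def)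

lemma Ck_on_Suc_imp: "Ck_on (Suc k) S f \<Longrightarrow> Ck_on k S f"
proof (induction k arbitrary: f)
  case 0
  then obtain D where "\<forall>x\<in>S. (f has_derivative (\<lambda>h. D x \<bullet> h)) (at x)" by auto
  then show ?case by (auto intro!: continuous_at_imp_continuous_on has_derivative_continuous)
next
  case (Suc k)
  then obtain D where D: "\<forall>x\<in>S. (f has_derivative (\<lambda>h. D x \<bullet> h)) (at x)" "\<forall>i. Ck_on (Suc k) S (\<lambda>x. D x $ i)"
    by (auto simp del: Ck_on.simps(2) simp: Ck_on.simps(2)[of "Suc k"])
  then show ?case using Suc.IH by (auto simp del: Ck_on.simps(2) simp: Ck_on.simps(2)[of k])
qed

lemma Ck_on_const: "Ck_on k S (\<lambda>x. c)"
proof (induction k arbitrary: c)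
  case (Suc k)
  have "((\<lambda>x. c) has_derivative (\<bullet>) (0::real^'a)) (at x)" for x
  proof -
    have "(\<bullet>) (0::real^'a) = (\<lambda>_. 0)" by auto
    then show ?thesis by simp
  qed
  then show ?case using Suc.IH[of 0] by (auto intro!: exI[of _ "\<lambda>x. 0"])
qed simp

lemma Ck_on_coordinate: "Ck_on k S (\<lambda>x. x $ i)"
proof (cases k)
  case (Suc m)
  have "\<forall>x\<in>S. ((\<lambda>x. x $ i) has_derivative (\<lambda>h. axis i 1 \<bullet> h)) (at x)"
    by (auto simp: inner_axis' intro!: bounded_linear_imp_has_derivative bounded_linear_vec_nth)
  then show ?thesis unfolding Suc using Ck_on_const[of m S] by (auto intro!: exI[of _ "\<lambda>x. axis i 1"])
qed (auto intro!: continuous_intros)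

lemma Ck_on_add: "Ck_on k S f \<Longrightarrow> Ck_on k S g \<Longrightarrow> Ck_on k S (\<lambda>x. f x + g x)"
proof (induction k arbitrary: f g)
  case (Suc k)
  then obtain D E where *: "\<forall>x\<in>S. (f has_derivative (\<lambda>h. D x \<bullet> h)) (at x)" "\<forall>i. Ck_on k S (\<lambda>x. D x $ i)"
    "\<forall>x\<in>S. (g has_derivative (\<lambda>h. E x \<bullet> h)) (at x)" "\<forall>i. Ck_on k S (\<lambda>x. E x $ i)" by auto
  have "\<forall>x\<in>S. ((\<lambda>x. f x + g x) has_derivative (\<lambda>h. (D x + E x) \<bullet> h)) (at x)"
    using * by (auto simp: inner_add_left intro!: has_derivative_add)
  moreover have "\<forall>i. Ck_on k S (\<lambda>x. (D x + E x) $ i)" using Suc.IH * by simp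
  ultimately show ?case by (auto intro!: exI[of _ "\<lambda>x. D x + E x"])
qed (auto intro!: continuous_intros)

lemma Ck_on_mult: "Ck_on k S f \<Longrightarrow> Ck_on k S g \<Longrightarrow> Ck_on k S (\<lambda>x. f x * g x)"
proof (induction k arbitrary: f g)
  case (Suc k)
  then obtain D E where *: "\<forall>x\<in>S. (f has_derivative (\<lambda>h. D x \<bullet> h)) (at x)" "\<forall>i. Ck_on k S (\<lambda>x. D x $ i)"
    "\<forall>x\<in>S. (g has_derivative (\<lambda>h. E x \<bullet> h)) (at x)" "\<forall>i. Ck_on k S (\<lambda>x. E x $ i)" by auto
  have fg: "Ck_on k S f" "Ck_on k S g" using Suc.prems by (auto intro: Ck_on_Suc_imp simp del: Ck_on.simps)
  define F where "F x = f x *\<^sub>R E x + g x *\<^sub>R D x" for x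
  have "\<forall>x\<in>S. ((\<lambda>x. f x * g x) has_derivative (\<lambda>h. F x \<bullet> h)) (at x)"
  proof
    fix x assume "x \<in> S"
    then show "((\<lambda>x. f x * g x) has_derivative (\<lambda>h. F x \<bullet> h)) (at x)"
      using has_derivative_mult[of f "\<lambda>h. D x \<bullet> h" x UNIV g "\<lambda>h. E x \<bullet> h"] *
      by (simp add: F_def inner_add_left mult.commute)
  qed
  moreover have "\<forall>i. Ck_on k S (\<lambda>x. F x $ i)"
    using Suc.IH[OF fg(1)] Suc.IH[OF fg(2)] * by (auto simp: F_def intro!: Ck_on_add)
  ultimately show ?case by auto
qed (auto intro!: continuous_intros)

lemma Ck_on_compose:
  "Ck_on k S f \<Longrightarrow> diff_upto k T g \<Longrightarrow> f ` S \<subseteq> T \<Longrightarrow> Ck_on k S (\<lambda>x. g (f x))"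
proof (induction k arbitrary: g)
  case 0
  then show ?case by (auto intro: continuous_on_compose2)
next
  case (Suc k)
  then obtain D where D: "\<forall>x\<in>S. (f has_derivative (\<lambda>h. D x \<bullet> h)) (at x)" "\<forall>i. Ck_on k S (\<lambda>x. D x $ i)" by auto
  obtain g' where g': "\<forall>x\<in>T. (g has_real_derivative g' x) (at x)" "diff_upto k T g'" using Suc.prems by auto
  have f: "Ck_on k S f" using Suc.prems by (auto intro: Ck_on_Suc_imp simp del: Ck_on.simps)
  have "\<forall>x\<in>S. ((\<lambda>x. g (f x)) has_derivative (\<lambda>h. (g' (f x) *\<^sub>R D x) \<bullet> h)) (at x)"
  proof
    fix x assume x: "x \<in> S"
    then have "(g has_derivative (*) (g' (f x))) (at (f x))"
      using g' Suc.prems(3) by (auto simp: has_field_derivative_def)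
    with D(1) x show "((\<lambda>x. g (f x)) has_derivative (\<lambda>h. (g' (f x) *\<^sub>R D x) \<bullet> h)) (at x)"
      using has_derivative_compose[of f "\<lambda>h. D x \<bullet> h" x UNIV g "(*) (g' (f x))"] by simp
  qed
  moreover have "\<forall>i. Ck_on k S (\<lambda>x. (g' (f x) *\<^sub>R D x) $ i)"
    using Ck_on_mult[OF Suc.IH[OF f g'(2) Suc.prems(3)]] D by simp
  ultimately show ?case by (auto intro!: exI[of _ "\<lambda>x. g' (f x) *\<^sub>R D x"])
qed

lemma Ck_on_prod:
  "finite I \<Longrightarrow> (\<And>i. i \<in> I \<Longrightarrow> Ck_on k S (f i)) \<Longrightarrow> Ck_on k S (\<lambda>x. \<Prod>i\<in>I. f i x)"
  by (induction I rule: finite_induct) (auto intro: Ck_on_const Ck_on_mult)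

lemma Ck_on_sum:
  "finite I \<Longrightarrow> (\<And>i. i \<in> I \<Longrightarrow> Ck_on k S (f i)) \<Longrightarrow> Ck_on k S (\<lambda>x. \<Sum>i\<in>I. f i x)"
  by (induction I rule: finite_induct) (auto intro: Ck_on_const Ck_on_add)

lemma Ck_on_cong:
  assumes "open S" "\<And>x. x \<in> S \<Longrightarrow> f x = g x" "Ck_on k S f" shows "Ck_on k S g"
proof (cases k)
  case 0
  then show ?thesis using assms continuous_on_cong[of S S f g] by simp
next
  case (Suc m)
  then obtain D where D: "\<forall>x\<in>S. (f has_derivative (\<lambda>h. D x \<bullet> h)) (at x)" "\<forall>i. Ck_on m S (\<lambda>x. D x $ i)" using assms(3) by auto
  have "\<forall>x\<in>S. (g has_derivative (\<lambda>h. D x \<bullet> h)) (at x)"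
  proof
    fix x assume "x \<in> S"
    then show "(g has_derivative (\<lambda>h. D x \<bullet> h)) (at x)"
      using D(1) assms(1,2) by (auto intro: has_derivative_transform_within_open)
  qed
  then show ?thesis using D(2) unfolding Suc by auto
qed

text \<open>On the union, the gradient is glued from the gradients on the two pieces, which agree with \<open>grad f\<close>.\<close>

lemma Ck_on_Un:
  "open S \<Longrightarrow> open T \<Longrightarrow> Ck_on k S f \<Longrightarrow> Ck_on k T f \<Longrightarrow> Ck_on k (S \<union> T) f"
proof (induction k arbitrary: f)
  case 0
  then show ?case by (auto intro: continuous_on_open_Un)
next
  case (Suc k)
  then obtain D E where *: "\<forall>x\<in>S. (f has_derivative (\<lambda>h. D x \<bullet> h)) (at x)" "\<forall>i. Ck_on k S (\<lambda>x. D x $ i)"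
    "\<forall>x\<in>T. (f has_derivative (\<lambda>h. E x \<bullet> h)) (at x)" "\<forall>i. Ck_on k T (\<lambda>x. E x $ i)" by auto
  define F where "F = grad f"
  have FD: "F x = D x" if "x \<in> S" for x using grad_eqI *(1) that unfolding F_def by blast
  have FE: "F x = E x" if "x \<in> T" for x using grad_eqI *(3) that unfolding F_def by blast
  have "\<forall>x\<in>S \<union> T. (f has_derivative (\<lambda>h. F x \<bullet> h)) (at x)" using * FD FE by auto
  moreover have "Ck_on k (S \<union> T) (\<lambda>x. F x $ i)" for i
  proof (rule Suc.IH[OF Suc.prems(1,2)])
    show "Ck_on k S (\<lambda>x. F x $ i)" by (rule Ck_on_cong[OF Suc.prems(1) _ *(2)[rule_format, of i]]) (simp add: FD)
    show "Ck_on k T (\<lambda>x. F x $ i)" by (rule Ck_on_cong[OF Suc.prems(2) _ *(4)[rule_format, of i]]) (simp add: FE)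
  qed
  ultimately show ?case by auto
qed

lemma Ck_on_UNIV_imp_Ck: "Ck_on k UNIV f \<Longrightarrow> Ck k f"
proof (induction k arbitrary: f)
  case (Suc k)
  then obtain D where D: "\<forall>x. (f has_derivative (\<lambda>h. D x \<bullet> h)) (at x)" "\<forall>i. Ck_on k UNIV (\<lambda>x. D x $ i)" by auto
  have "grad f = D" using grad_eqI D(1) by blast
  then show ?case using D Suc.IH by (auto simp: differentiable_def)
qed simp

text \<open>Smooth functions supported in a box that increase to its indicator as \<open>N\<close> grows.\<close>

definition box_bump :: "real^'n \<Rightarrow> real^'n \<Rightarrow> nat \<Rightarrow> real^'n \<Rightarrow> real" where
  "box_bump a b N x = (\<Prod>i\<in>UNIV. flat_fun 0 (real N * (x $ i - a $ i)) * flat_fun 0 (real N * (b $ i - x $ i)))"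

lemma box_bump_outside: "x \<notin> box a b \<Longrightarrow> box_bump a b N x = 0"
proof -
  assume "x \<notin> box a b"
  then obtain i where "\<not> (a $ i < x $ i \<and> x $ i < b $ i)" by (auto simp: mem_box_cart)
  then have "flat_fun 0 (real N * (x $ i - a $ i)) * flat_fun 0 (real N * (b $ i - x $ i)) = 0"
    by (auto simp: flat_fun_0_bounds(3) mult_nonneg_nonpos not_less)
  then show ?thesis unfolding box_bump_def by (intro prod_zero) auto
qed

lemma box_bump_bounds: "0 \<le> box_bump a b N x" "box_bump a b N x \<le> 1"
  unfolding box_bump_def
  by (auto intro!: prod_nonneg prod_le_1 mult_nonneg_nonneg mult_le_one flat_fun_0_bounds)

lemma box_bump_tendsto: "(\<lambda>N. box_bump a b N x) \<longlonglongrightarrow> indicator (box a b) x"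
proof (cases "x \<in> box a b")
  case True
  have *: "(\<lambda>N. flat_fun 0 (real N * y)) \<longlonglongrightarrow> 1" if "y > 0" for y
  proof -
    have "filterlim (\<lambda>N. real N * y) at_top sequentially"
      using that by (intro filterlim_at_top_mult_tendsto_pos[OF tendsto_const]) (auto simp: filterlim_real_sequentially)
    then have "(\<lambda>N. exp (- inverse (real N * y))) \<longlonglongrightarrow> exp (- 0)"
      by (intro tendsto_intros tendsto_inverse_0_at_top)
    moreover have "eventually (\<lambda>N. exp (- inverse (real N * y)) = flat_fun 0 (real N * y)) sequentially"
      using eventually_gt_at_top[of 0] by eventually_elim (use that in \<open>auto simp: flat_fun_def\<close>)
    ultimately show ?thesis by (auto elim: Lim_transform_eventually)
  qed
  have "(\<lambda>N. box_bump a b N x) \<longlonglongrightarrow> (\<Prod>i\<in>(UNIV::'a set). 1 * 1)"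
    unfolding box_bump_def using True by (intro tendsto_prod tendsto_mult *) (auto simp: mem_box_cart)
  then show ?thesis using True by simp
qed (simp add: box_bump_outside)

lemma test_function_box_bump:
  assumes "cbox a b \<subseteq> \<Omega>"
  shows "test_function \<Omega> (box_bump a b N)"
proof -
  have "Ck_on k UNIV (box_bump a b N)" for k
  proof -
    have aff: "Ck_on k UNIV (\<lambda>x::real^'a. real N * (x $ i - a $ i))" "Ck_on k UNIV (\<lambda>x::real^'a. real N * (b $ i - x $ i))" for i
    proof -
      have "Ck_on k UNIV (\<lambda>x::real^'a. real N * (x $ i + - (a $ i)))"
        by (intro Ck_on_mult Ck_on_add Ck_on_const Ck_on_coordinate)
      then show "Ck_on k UNIV (\<lambda>x::real^'a. real N * (x $ i - a $ i))" by simp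
      have "Ck_on k UNIV (\<lambda>x::real^'a. real N * (b $ i + (-1) * (x $ i)))"
        by (intro Ck_on_mult Ck_on_add Ck_on_const Ck_on_coordinate)
      then show "Ck_on k UNIV (\<lambda>x::real^'a. real N * (b $ i - x $ i))" by simp
    qed
    show ?thesis unfolding box_bump_def[abs_def]
      by (intro Ck_on_prod Ck_on_mult Ck_on_compose[OF aff(1) diff_upto_flat_fun] Ck_on_compose[OF aff(2) diff_upto_flat_fun]) auto
  qed
  then show ?thesis unfolding test_function_def
    using assms box_bump_outside[of _ a b N] box_subset_cbox[of a b]
    by (auto intro!: Ck_on_UNIV_imp_Ck exI[of _ "cbox a b"])
qed


section \<open>Uniqueness of weak gradients\<close>

text \<open>The product \<open>u \<phi>\<close> has compact support, so its partial derivatives integrate to zero.\<close>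

lemma test_function_has_weak_gradient:
  fixes \<Omega> :: "(real^'n) set"
  assumes \<Omega>: "open \<Omega>" and u: "test_function \<Omega> u"
  shows "has_weak_gradient \<Omega> u (grad u)"
  unfolding has_weak_gradient_def
proof (intro conjI allI impI)
  note uc = test_function_continuous[OF u] and uD = test_function_has_derivative[OF u]
  show "locally_integrable \<Omega> u" "locally_integrable \<Omega> (grad u)"
    using uc uD(2) by (auto intro: continuous_locally_integrable)
  fix \<phi> :: "real^'n \<Rightarrow> real" and i assume \<phi>: "test_function \<Omega> \<phi>"
  note \<phi>c = test_function_continuous[OF \<phi>] and \<phi>D = test_function_has_derivative[OF \<phi>]
  obtain K where K: "compact K" "K \<subseteq> \<Omega>" "\<And>x. x \<notin> K \<Longrightarrow> u x = 0" "\<And>x. x \<notin> K \<Longrightarrow> grad u x = 0"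
    by (rule test_function_support[OF u]) blast
  obtain r where r: "\<forall>x. norm x > r \<longrightarrow> x \<notin> K" by (rule compact_support_norm_bound[OF K(1)])
  have \<Omega>L: "\<Omega> \<in> sets lebesgue" using \<Omega> by auto
  have c1: "continuous_on UNIV (\<lambda>x. u x * grad \<phi> x $ i)" and c2: "continuous_on UNIV (\<lambda>x. grad u x $ i * \<phi> x)"
    by (intro continuous_intros uc \<phi>c uD(2) \<phi>D(2))+
  have z1: "u x * grad \<phi> x $ i = 0" and z2: "grad u x $ i * \<phi> x = 0" if "x \<notin> K" for x
    using K(3,4)[OF that] by auto
  have D: "((\<lambda>x. u x * \<phi> x) has_derivative (\<lambda>h. u x * (grad \<phi> x \<bullet> h) + (grad u x \<bullet> h) * \<phi> x)) (at x)" for x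
    by (rule has_derivative_mult[OF uD(1) \<phi>D(1)])
  have ax: "v \<bullet> axis i 1 = v $ i" for v :: "real^'n" by (simp add: inner_axis)
  have I: "(LINT x|lborel. u x * grad \<phi> x $ i + grad u x $ i * \<phi> x) = 0"
    using directional_derivative_integral_zero(2)[of "\<lambda>x. u x * \<phi> x" "\<lambda>x h. u x * (grad \<phi> x \<bullet> h) + (grad u x \<bullet> h) * \<phi> x" "axis i 1" r, OF D]
      c1 c2 r K(3) unfolding ax by (simp add: continuous_on_add)
  have i1: "integrable lborel (\<lambda>x. u x * grad \<phi> x $ i)" and i2: "integrable lborel (\<lambda>x. grad u x $ i * \<phi> x)"
    using z1 z2 r by (auto intro!: integrable_continuous_bounded_support[OF c1, of r] integrable_continuous_bounded_support[OF c2, of r])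
  have "(LINT x|lborel. u x * grad \<phi> x $ i) = - (LINT x|lborel. grad u x $ i * \<phi> x)"
    using I Bochner_Integration.integral_add[OF i1 i2] by simp
  moreover have "(LINT x|lebesgue_on \<Omega>. u x * grad \<phi> x $ i) = (LINT x|lborel. u x * grad \<phi> x $ i)"
    using z1 K(2) by (intro integral_lebesgue_on_eq_lborel[OF \<Omega>L borel_measurable_continuous_onI[OF c1]]) blast
  moreover have "(LINT x|lebesgue_on \<Omega>. grad u x $ i * \<phi> x) = (LINT x|lborel. grad u x $ i * \<phi> x)"
    using z2 K(2) by (intro integral_lebesgue_on_eq_lborel[OF \<Omega>L borel_measurable_continuous_onI[OF c2]]) blast
  ultimately show "(LINT x|lebesgue_on \<Omega>. u x * grad \<phi> x $ i) = - (LINT x|lebesgue_on \<Omega>. grad u x $ i * \<phi> x)" by simp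
qed

text \<open>Boxes form an intersection-stable generator of the Borel sets, so the integrals over all Borel sets vanish.\<close>

lemma AE_zero_if_integral_boxes_zero:
  fixes f :: "real^'n \<Rightarrow> real"
  assumes f: "integrable lborel f" and z: "\<And>a b. (LINT x|lborel. indicator (box a b) x * f x) = 0"
  shows "AE x in lborel. f x = 0"
proof (rule sigma_finite_measure.density_zero[OF lborel.sigma_finite_measure_axioms f])
  let ?G = "range (\<lambda>(a, b). box a b :: (real^'n) set)"
  have si: "set_integrable lborel A f" if "A \<in> sets borel" for A
    unfolding set_integrable_def using f that by (intro integrable_mult_indicator) auto
  have UN: "(LINT x|lborel. f x) = 0"
  proof -
    define B where "B k = box (- (real k *\<^sub>R One)) (real k *\<^sub>R One :: real^'n)" for k
    have "(\<lambda>k. LINT x|lborel. indicator (B k) x * f x) \<longlonglongrightarrow> (LINT x|lborel. f x)"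
    proof (rule integral_dominated_convergence[where w = "\<lambda>x. \<bar>f x\<bar>"])
      show "AE x in lborel. (\<lambda>k. indicator (B k) x * f x) \<longlonglongrightarrow> f x"
      proof (rule AE_I2)
        fix x :: "real^'n"
        have "x \<in> (\<Union>k. B k)" unfolding B_def UN_box_eq_UNIV by (rule UNIV_I)
        then obtain k where "x \<in> B k" by (rule UN_E)
        then have k: "- real k < x \<bullet> i" "x \<bullet> i < real k" if "i \<in> Basis" for i
          using that by (simp_all add: B_def mem_box)
        have "x \<in> B m" if "m \<ge> k" for m
          unfolding B_def mem_box
        proof
          fix i :: "real^'n" assume i: "i \<in> Basis"
          then show "- (real m *\<^sub>R One) \<bullet> i < x \<bullet> i \<and> x \<bullet> i < (real m *\<^sub>R One) \<bullet> i"
            using k[OF i] that by simp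
        qed
        then have "eventually (\<lambda>m. indicator (B m) x * f x = f x) sequentially"
          by (auto simp: eventually_sequentially intro!: exI[of _ k])
        then show "(\<lambda>k. indicator (B k) x * f x) \<longlonglongrightarrow> f x" by (rule tendsto_eventually)
      qed
    qed (use f in \<open>auto simp: B_def indicator_def\<close>)
    then show ?thesis using z by (simp add: B_def LIMSEQ_const_iff)
  qed
  fix A :: "(real^'n) set" assume "A \<in> sets lborel"
  then have "A \<in> sigma_sets UNIV ?G" by (simp add: borel_eq_box)
  moreover have "Int_stable ?G" by (auto simp: Int_stable_def box_Int_box)
  moreover have "?G \<subseteq> Pow UNIV" by simp
  ultimately have G: "Int_stable ?G" "?G \<subseteq> Pow UNIV" "A \<in> sigma_sets UNIV ?G" by simp_all
  from G show "set_lebesgue_integral lborel A f = 0"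
  proof (induction rule: sigma_sets_induct_disjoint)
    case (basic A)
    then show ?case using z by (auto simp: set_lebesgue_integral_def)
  next
    case empty
    then show ?case by (simp add: set_lebesgue_integral_def)
  next
    case (compl A)
    then have A: "A \<in> sets borel" by (simp add: borel_eq_box)
    have "set_lebesgue_integral lborel (UNIV - A) f = (LINT x|lborel. f x - indicator A x *\<^sub>R f x)"
      unfolding set_lebesgue_integral_def by (intro Bochner_Integration.integral_cong) (auto simp: indicator_def)
    also have "\<dots> = (LINT x|lborel. f x) - set_lebesgue_integral lborel A f"
      unfolding set_lebesgue_integral_def
      by (rule Bochner_Integration.integral_diff[OF f si[OF A, unfolded set_integrable_def]])
    finally show ?case using UN compl by simp
  next
    case (union A)
    then have A: "\<And>i. A i \<in> sets lborel" by (simp add: borel_eq_box image_subset_iff)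
    have "set_lebesgue_integral lborel (\<Union>i. A i) f = (\<Sum>i. set_lebesgue_integral lborel (A i) f)"
      using union(1) A by (intro lebesgue_integral_countable_add si) (auto simp: disjoint_family_on_def)
    then show ?case using union by simp
  qed
qed

text \<open>Box bumps approximate the indicators of boxes, so \<open>d\<close> has integral zero over every box inside \<open>\<Omega>\<close>; and \<open>\<Omega>\<close> is a
  countable union of boxes.\<close>

lemma fundamental_lemma_test_functions:
  fixes d :: "real^'n \<Rightarrow> real"
  assumes \<Omega>: "open \<Omega>" and d: "locally_integrable \<Omega> d"
    and z: "\<And>\<phi>. test_function \<Omega> \<phi> \<Longrightarrow> (LINT x|lebesgue_on \<Omega>. d x * \<phi> x) = 0"
  shows "AE x in lebesgue_on \<Omega>. d x = 0"
proof -
  have \<Omega>L: "\<Omega> \<in> sets lebesgue" using \<Omega> by auto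
  have boxes: "AE x in lebesgue. x \<in> cbox a b \<longrightarrow> d x = 0" if ab: "cbox a b \<subseteq> \<Omega>" for a b
  proof -
    define Q where "Q = box a b"
    define f where "f x = indicator Q x * d x" for x
    have cb: "integrable lebesgue (\<lambda>x. indicator (cbox a b) x *\<^sub>R d x)"
    proof -
      have "integrable (lebesgue_on (cbox a b)) d" using d ab unfolding locally_integrable_def by simp
      then show ?thesis by (subst (asm) integrable_restrict_space) auto
    qed
    have fi: "integrable lebesgue f"
    proof -
      have "integrable lebesgue (\<lambda>x. indicator Q x *\<^sub>R (indicator (cbox a b) x *\<^sub>R d x))"
        by (rule integrable_mult_indicator[OF _ cb]) (auto simp: Q_def)
      also have "(\<lambda>x. indicator Q x *\<^sub>R (indicator (cbox a b) x *\<^sub>R d x)) = f"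
        using box_subset_cbox[of a b] by (intro ext) (auto simp: f_def Q_def split: split_indicator)
      finally show ?thesis .
    qed
    \<comment> \<open>a Borel representative, for which the generator argument applies\<close>
    obtain g where g: "g \<in> borel_measurable lborel" "AE x in lborel. f x = g x"
      using completion_ex_borel_measurable_real[OF borel_measurable_integrable[OF fi]] by blast
    have gae: "AE x in lebesgue. f x = g x" using g(2) by (rule AE_completion)
    have gi: "integrable lborel g"
    proof -
      have "integrable lebesgue g"
        using fi gae g(1) by (subst integrable_cong_AE[symmetric, of f]) (auto intro: measurable_completion)
      then show ?thesis using g(1) by (simp add: integrable_completion)
    qed
    have "(LINT x|lborel. indicator (box p q) x * g x) = 0" for p q
    proof -
      define a' where "a' = (\<chi> i. max (a $ i) (p $ i))"
      define b' where "b' = (\<chi> i. min (b $ i) (q $ i))"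
      have bb: "box p q \<inter> Q = box a' b'"
        by (auto simp: Q_def a'_def b'_def mem_box_cart)
      have "cbox a' b' \<subseteq> cbox a b" by (auto simp: a'_def b'_def mem_box_cart)
      then have sub: "cbox a' b' \<subseteq> \<Omega>" using ab by blast
      have [measurable]: "g \<in> borel_measurable borel" using g(1) by simp
      have "(LINT x|lborel. indicator (box p q) x * g x) = (LINT x|lebesgue. indicator (box p q) x * g x)"
        by (intro integral_completion[symmetric]) measurable
      also have "\<dots> = (LINT x|lebesgue. indicator (box a' b') x * d x)"
      proof (rule integral_cong_AE)
        have m: "(\<lambda>x. indicator (box p q) x * f x) \<in> borel_measurable lebesgue"
          using fi by (intro borel_measurable_times borel_measurable_integrable borel_measurable_indicator) auto
        have fe: "(\<lambda>x. indicator (box p q) x * f x) = (\<lambda>x. indicator (box a' b') x * d x)"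
          unfolding f_def bb[symmetric] by (intro ext) (simp split: split_indicator)
        show "(\<lambda>x. indicator (box a' b') x * d x) \<in> borel_measurable lebesgue" using m unfolding fe .
        show "AE x in lebesgue. indicator (box p q) x * g x = indicator (box a' b') x * d x"
          using gae
        proof eventually_elim
          case (elim x)
          then show ?case using fun_cong[OF fe, of x] by simp
        qed
        show "(\<lambda>x. indicator (box p q) x * g x) \<in> borel_measurable lebesgue"
          using g(1) by (intro borel_measurable_times measurable_completion borel_measurable_indicator) auto
      qed
      also have "\<dots> = 0"
      proof -
        have int: "integrable lebesgue (\<lambda>x. indicator (cbox a' b') x *\<^sub>R d x)"
        proof -
          have "integrable (lebesgue_on (cbox a' b')) d" using d sub unfolding locally_integrable_def by simp
          then show ?thesis by (subst (asm) integrable_restrict_space) auto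
        qed
        define D where "D x = indicator (cbox a' b') x * d x" for x
        have D: "integrable lebesgue D" using int by (simp add: D_def[abs_def])
        have "(\<lambda>N. LINT x|lebesgue. D x * box_bump a' b' N x) \<longlonglongrightarrow> (LINT x|lebesgue. D x * indicator (box a' b') x)"
        proof (rule integral_dominated_convergence[where w = "\<lambda>x. \<bar>D x\<bar>"])
          show "(\<lambda>x. D x * box_bump a' b' N x) \<in> borel_measurable lebesgue" for N
          proof -
            have "box_bump a' b' N \<in> borel_measurable lborel"
              using borel_measurable_continuous_onI[OF test_function_continuous[OF test_function_box_bump[OF sub]]] by simp
            from borel_measurable_times[OF borel_measurable_integrable[OF D] measurable_completion[OF this]]
            show ?thesis .
          qed
          show "AE x in lebesgue. norm (D x * box_bump a' b' N x) \<le> \<bar>D x\<bar>" for N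
            using box_bump_bounds[of a' b' N] by (auto simp: abs_mult mult_left_le)
          show "(\<lambda>x. D x * indicator (box a' b') x) \<in> borel_measurable lebesgue"
            using D by (intro borel_measurable_times borel_measurable_integrable borel_measurable_indicator) auto
        qed (use D in \<open>auto intro!: tendsto_mult box_bump_tendsto\<close>)
        moreover have "(LINT x|lebesgue. D x * box_bump a' b' N x) = 0" for N
        proof -
          have "(LINT x|lebesgue. D x * box_bump a' b' N x) = (LINT x|lebesgue. indicator \<Omega> x *\<^sub>R (d x * box_bump a' b' N x))"
            using sub box_bump_outside[of _ a' b' N] box_subset_cbox[of a' b']
            by (intro Bochner_Integration.integral_cong) (auto simp: D_def indicator_def)
          also have "\<dots> = (LINT x|lebesgue_on \<Omega>. d x * box_bump a' b' N x)"
            using \<Omega>L by (intro integral_restrict_space[symmetric]) simp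
          finally show ?thesis using z[OF test_function_box_bump[OF sub]] by simp
        qed
        ultimately have "(LINT x|lebesgue. D x * indicator (box a' b') x) = 0" by (simp add: LIMSEQ_const_iff)
        moreover have "(\<lambda>x. D x * indicator (box a' b') x) = (\<lambda>x. indicator (box a' b') x * d x)"
          using box_subset_cbox[of a' b'] by (intro ext) (auto simp: D_def split: split_indicator)
        ultimately show ?thesis by simp
      qed
      finally show ?thesis .
    qed
    from AE_zero_if_integral_boxes_zero[OF gi this] have "AE x in lborel. g x = 0" .
    then have g0: "AE x in lebesgue. g x = 0" by (rule AE_completion)
    have bd: "AE x in lebesgue. x \<notin> cbox a b - box a b"
      using negligible_frontier_interval[of a b] by (intro AE_not_in) (simp add: negligible_iff_null_sets)
    from gae g0 bd show ?thesis
    proof eventually_elim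
      case (elim x)
      then show ?case by (auto simp: f_def Q_def indicator_def)
    qed
  qed
  obtain \<D> where \<D>: "countable \<D>" "\<D> \<subseteq> Pow \<Omega>" "\<And>X. X \<in> \<D> \<Longrightarrow> \<exists>a b. X = cbox a b" "\<Union>\<D> = \<Omega>"
    using open_countable_Union_open_cbox[OF \<Omega>] by metis
  have "AE x in lebesgue. \<forall>X\<in>\<D>. x \<in> X \<longrightarrow> d x = 0"
  proof (subst AE_ball_countable[OF \<D>(1)], rule ballI)
    fix X assume X: "X \<in> \<D>"
    then obtain a b where ab: "X = cbox a b" using \<D>(3) by blast
    then show "AE x in lebesgue. x \<in> X \<longrightarrow> d x = 0" using boxes[of a b] X \<D>(2) by auto
  qed
  then have "AE x in lebesgue. x \<in> \<Omega> \<longrightarrow> d x = 0"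
    by eventually_elim (use \<D>(4) in blast)
  then show ?thesis using \<Omega>L by (simp add: AE_restrict_space_iff)
qed

lemma weak_gradient_unique:
  fixes \<Omega> :: "(real^'n) set"
  assumes \<Omega>: "open \<Omega>" and g: "has_weak_gradient \<Omega> u g" and h: "has_weak_gradient \<Omega> u h"
  shows "AE x in lebesgue_on \<Omega>. g x = h x"
proof -
  have \<Omega>L: "\<Omega> \<in> sets lebesgue" using \<Omega> by auto
  have li: "locally_integrable \<Omega> g" "locally_integrable \<Omega> h"
    using g h unfolding has_weak_gradient_def by auto
  have comp: "AE x in lebesgue_on \<Omega>. g x $ i - h x $ i = 0" for i
  proof (rule fundamental_lemma_test_functions[OF \<Omega>])
    have "integrable (lebesgue_on K) (\<lambda>x. g x $ i - h x $ i)" if K: "compact K" "K \<subseteq> \<Omega>" for K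
    proof -
      have "integrable (lebesgue_on K) g" "integrable (lebesgue_on K) h"
        using li K unfolding locally_integrable_def by auto
      then show ?thesis
        by (intro Bochner_Integration.integrable_diff integrable_bounded_linear[OF bounded_linear_vec_nth])
    qed
    then show "locally_integrable \<Omega> (\<lambda>x. g x $ i - h x $ i)" unfolding locally_integrable_def by blast
    fix \<phi> assume \<phi>: "test_function \<Omega> \<phi>"
    obtain K where K: "compact K" "K \<subseteq> \<Omega>" "\<And>x. x \<notin> K \<Longrightarrow> \<phi> x = 0"
      by (rule test_function_support[OF \<phi>]) blast
    have KL: "K \<in> sets lebesgue" using K(1) by (auto intro: fmeasurableD lmeasurable_compact)
    have \<phi>c: "continuous_on UNIV \<phi>" by (rule test_function_continuous[OF \<phi>])
    obtain M where M: "\<And>x. \<bar>\<phi> x\<bar> \<le> M"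
    proof -
      have "compact (\<phi> ` K)" using continuous_on_subset[OF \<phi>c subset_UNIV] K(1) by (rule compact_continuous_image)
      then obtain M where "\<forall>x\<in>K. \<bar>\<phi> x\<bar> \<le> M" by (auto simp: bounded_iff dest!: compact_imp_bounded)
      then have "\<bar>\<phi> x\<bar> \<le> max M 0" for x using K(3)[of x] by (cases "x \<in> K") (auto simp: le_max_iff_disj)
      then show ?thesis by (rule that)
    qed
    have int: "integrable (lebesgue_on \<Omega>) (\<lambda>x. w x $ i * \<phi> x)" if w: "locally_integrable \<Omega> w" for w :: "real^'n \<Rightarrow> real^'n"
    proof -
      have "integrable (lebesgue_on K) w" using w K unfolding locally_integrable_def by auto
      then have wi: "integrable (lebesgue_on K) (\<lambda>x. w x $ i)"
        by (rule integrable_bounded_linear[OF bounded_linear_vec_nth])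
      have "integrable (lebesgue_on K) (\<lambda>x. w x $ i * \<phi> x)"
      proof (rule Bochner_Integration.integrable_bound[of _ "\<lambda>x. M * (w x $ i)"])
        show "(\<lambda>x. w x $ i * \<phi> x) \<in> borel_measurable (lebesgue_on K)"
          using wi continuous_on_UNIV_measurable_lebesgue_on[OF \<phi>c] by (intro borel_measurable_times) auto
        have "\<bar>w x $ i\<bar> * \<bar>\<phi> x\<bar> \<le> \<bar>M\<bar> * \<bar>w x $ i\<bar>" for x
          using M[of x] mult_left_mono[of "\<bar>\<phi> x\<bar>" "\<bar>M\<bar>" "\<bar>w x $ i\<bar>"] by (simp add: mult.commute)
        then show "AE x in lebesgue_on K. norm (w x $ i * \<phi> x) \<le> norm (M * (w x $ i))" by (simp add: abs_mult)
      qed (use wi in simp)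
      then have "integrable lebesgue (\<lambda>x. indicator K x *\<^sub>R (w x $ i * \<phi> x))"
        using KL by (subst (asm) integrable_restrict_space) auto
      also have "(\<lambda>x. indicator K x *\<^sub>R (w x $ i * \<phi> x)) = (\<lambda>x. indicator \<Omega> x *\<^sub>R (w x $ i * \<phi> x))"
        using K by (intro ext) (auto split: split_indicator)
      finally show ?thesis using \<Omega>L by (subst integrable_restrict_space) auto
    qed
    have "(LINT x|lebesgue_on \<Omega>. g x $ i * \<phi> x) = (LINT x|lebesgue_on \<Omega>. h x $ i * \<phi> x)"
    proof -
      have "(LINT x|lebesgue_on \<Omega>. u x * grad \<phi> x $ i) = - (LINT x|lebesgue_on \<Omega>. g x $ i * \<phi> x)"
        using g \<phi> by (simp add: has_weak_gradient_def)
      moreover have "(LINT x|lebesgue_on \<Omega>. u x * grad \<phi> x $ i) = - (LINT x|lebesgue_on \<Omega>. h x $ i * \<phi> x)"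
        using h \<phi> by (simp add: has_weak_gradient_def)
      ultimately show ?thesis by simp
    qed
    then show "(LINT x|lebesgue_on \<Omega>. (g x $ i - h x $ i) * \<phi> x) = 0"
      using Bochner_Integration.integral_diff[OF int[OF li(1)] int[OF li(2)]] by (simp add: left_diff_distrib)
  qed
  have "AE x in lebesgue_on \<Omega>. \<forall>i\<in>UNIV. g x $ i - h x $ i = 0"
    using comp by (subst AE_ball_countable) auto
  then show ?thesis by eventually_elim (simp add: vec_eq_iff)
qed


section \<open>Trial functions concentrating at the origin\<close>

definition bump :: "real \<Rightarrow> real" where
  "bump y = flat_fun 0 (y - 1) * flat_fun 0 (3 - y)"

definition bump_deriv :: "real \<Rightarrow> real" where
  "bump_deriv y = flat_fun 2 (y - 1) * flat_fun 0 (3 - y) - flat_fun 0 (y - 1) * flat_fun 2 (3 - y)"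

lemma bump_has_real_derivative: "(bump has_real_derivative bump_deriv y) (at y)"
proof -
  have f: "(flat_fun 0 has_real_derivative flat_fun 2 x) (at x)" for x
    using flat_fun_has_real_derivative[of 0 x] by (simp add: numeral_2_eq_2)
  have 1: "((\<lambda>y. flat_fun 0 (y - 1)) has_real_derivative flat_fun 2 (y - 1) * 1) (at y)"
    by (rule DERIV_chain2[OF f]) (auto intro!: derivative_eq_intros)
  have 2: "((\<lambda>y. flat_fun 0 (3 - y)) has_real_derivative flat_fun 2 (3 - y) * (-1)) (at y)"
    by (rule DERIV_chain2[OF f]) (auto intro!: derivative_eq_intros)
  from DERIV_mult[OF 1 2] show ?thesis
    unfolding bump_def[abs_def] bump_deriv_def by (simp add: algebra_simps)
qed

lemma flat_fun_2_bounds: "0 \<le> flat_fun 2 x" "flat_fun 2 x \<le> 2"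
proof -
  show "0 \<le> flat_fun 2 x" by (simp add: flat_fun_def)
  have "y\<^sup>2 * exp (-y) \<le> 2" if "y > 0" for y :: real
  proof -
    have "1 + y + y\<^sup>2 / 2 \<le> exp y" using that by (intro exp_lower_Taylor_quadratic) simp
    then have "y\<^sup>2 \<le> 2 * exp y" using that by simp
    then show ?thesis by (simp add: exp_minus field_simps)
  qed
  from this[of "inverse x"] show "flat_fun 2 x \<le> 2" by (simp add: flat_fun_def)
qed

lemma bump_bounds:
  "0 \<le> bump y" "bump y \<le> 1" "\<bar>bump_deriv y\<bar> \<le> 4"
  "y \<le> 1 \<or> 3 \<le> y \<Longrightarrow> bump y = 0" "y \<le> 1 \<or> 3 \<le> y \<Longrightarrow> bump_deriv y = 0"
proof -
  show "0 \<le> bump y" "bump y \<le> 1" unfolding bump_def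
    by (auto intro!: mult_nonneg_nonneg mult_le_one flat_fun_0_bounds)
  have "flat_fun 2 (y - 1) * flat_fun 0 (3 - y) \<le> 2 * 1" "flat_fun 0 (y - 1) * flat_fun 2 (3 - y) \<le> 1 * 2"
    by (intro mult_mono flat_fun_2_bounds flat_fun_0_bounds; simp)+
  moreover have "0 \<le> flat_fun 2 (y - 1) * flat_fun 0 (3 - y)" "0 \<le> flat_fun 0 (y - 1) * flat_fun 2 (3 - y)"
    by (intro mult_nonneg_nonneg flat_fun_2_bounds flat_fun_0_bounds)+
  ultimately show "\<bar>bump_deriv y\<bar> \<le> 4" unfolding bump_deriv_def by linarith
  show "y \<le> 1 \<or> 3 \<le> y \<Longrightarrow> bump y = 0" "y \<le> 1 \<or> 3 \<le> y \<Longrightarrow> bump_deriv y = 0"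
    by (auto simp: bump_def bump_deriv_def flat_fun_def)
qed

lemma bump_lower_bound:
  assumes "2 \<le> y" "y \<le> 5/2" shows "exp (-3) \<le> bump y"
proof -
  have "exp (-1) \<le> flat_fun 0 (y - 1)" using assms by (simp add: flat_fun_def inverse_le_1_iff)
  moreover have "exp (-2) \<le> flat_fun 0 (3 - y)"
    using assms le_imp_inverse_le[of "1/2" "3 - y"] by (simp add: flat_fun_def)
  ultimately have "exp (-1) * exp (-2) \<le> bump y" unfolding bump_def by (intro mult_mono) (auto simp: flat_fun_0_bounds)
  then show ?thesis by (simp add: exp_add[symmetric])
qed

text \<open>A slowly varying multiple of the ground state \<open>E1^k\<close>.  The factor \<open>L^(1/n)\<close> is, in order, the largest
  amplitude for which the energy excess stays bounded as \<open>L\<close> grows.\<close>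

definition trial :: "real \<Rightarrow> real \<Rightarrow> real \<Rightarrow> real^'n \<Rightarrow> real" where
  "trial R L \<epsilon> x = (if x \<noteq> 0 \<and> norm x < R
     then \<epsilon> * L powr (1 / CARD('n)) * E1 (norm x / R) powr ((real CARD('n) - 1) / CARD('n))
            * bump (ln (E1 (norm x / R)) / L)
     else 0)"

text \<open>The radius at which \<open>ln E1 = s\<close>.\<close>

definition trial_radius :: "real \<Rightarrow> real \<Rightarrow> real" where
  "trial_radius R s = R * exp (1 - exp s)"

lemma trial_eq_0:
  fixes x :: "real^'n"
  assumes R: "R > 0" and L: "L > 0" and x: "norm x \<le> trial_radius R (3*L) \<or> trial_radius R L \<le> norm x"
  shows "trial R L \<epsilon> x = 0"
proof (cases "x \<noteq> 0 \<and> norm x < R")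
  case True
  then have nx: "0 < norm x" "norm x < R" by auto
  have t1: "E1 (norm x / R) \<ge> 1" using E1_ge_1[of "norm x" R] nx by simp
  have tE: "E1 (norm x / R) = 1 + ln R - ln (norm x)" using E1_eq nx R by blast
  have lnr: "ln (trial_radius R s) = ln R + 1 - exp s" for s using R by (simp add: trial_radius_def ln_mult)
  have pos: "trial_radius R s > 0" for s using R by (simp add: trial_radius_def)
  have "ln (E1 (norm x / R)) / L \<le> 1 \<or> 3 \<le> ln (E1 (norm x / R)) / L"
    using x
  proof
    assume "norm x \<le> trial_radius R (3*L)"
    then have "ln (norm x) \<le> ln R + 1 - exp (3*L)" using nx pos unfolding lnr[symmetric] by simp
    then have "exp (3*L) \<le> E1 (norm x / R)" unfolding tE by linarith
    then have "3*L \<le> ln (E1 (norm x / R))" using t1 by (simp add: ln_ge_iff)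
    then show ?thesis using L by (simp add: le_divide_eq)
  next
    assume "trial_radius R L \<le> norm x"
    then have "ln R + 1 - exp L \<le> ln (norm x)" using nx pos unfolding lnr[symmetric] by simp
    then have "E1 (norm x / R) \<le> exp L" unfolding tE by linarith
    then have "ln (E1 (norm x / R)) \<le> L" using t1 by (metis exp_gt_zero ln_exp ln_le_cancel_iff less_le_trans zero_less_one)
    then show ?thesis using L by (simp add: divide_le_eq)
  qed
  then show ?thesis using bump_bounds(4) by (auto simp: trial_def)
next
  case False
  then show ?thesis unfolding trial_def by (rule if_not_P)
qed

lemma trial_radius_less: "R > 0 \<Longrightarrow> s > 0 \<Longrightarrow> trial_radius R s < R"
  by (simp add: trial_radius_def)

text \<open>Where \<open>E1\<close> is not smooth, at the origin and at \<open>|x| \<ge> R\<close>, the trial function vanishes identically.  In between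
  it is composed of smooth functions of \<open>|x|\<^sup>2\<close>.\<close>

lemma test_function_trial:
  fixes \<Omega> :: "(real^'n) set"
  assumes R: "R > 0" and L: "L > 0" and sub: "cball 0 (trial_radius R L) \<subseteq> \<Omega>"
  shows "test_function \<Omega> (trial R L \<epsilon>)"
proof -
  define r1 where "r1 = trial_radius R (3*L)" define r2 where "r2 = trial_radius R L"
  have r1: "r1 > 0" using R by (simp add: r1_def trial_radius_def)
  have r2: "r2 < R" using R L by (simp add: r2_def trial_radius_less)
  define S1 where "S1 = {x::real^'n. x \<noteq> 0 \<and> norm x < R}"
  define S2 where "S2 = {x::real^'n. norm x < r1}"
  define S3 where "S3 = {x::real^'n. norm x > r2}"
  have op: "open S1" "open S2" "open S3"
    unfolding S1_def S2_def S3_def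
    by (auto intro!: open_Collect_less open_Collect_conj open_Collect_neq continuous_intros)
  \<comment> \<open>a neighbourhood of the origin and one of the outside, where the function is zero, complete the region of smoothness\<close>
  have cover: "S1 \<union> (S2 \<union> S3) = UNIV" using r1 r2 by (auto simp: S1_def S2_def S3_def)
  have "Ck_on k UNIV (trial R L \<epsilon> :: real^'n \<Rightarrow> real)" for k
  proof -
    have q: "Ck_on k S1 (\<lambda>x. \<Sum>i\<in>UNIV. x $ i * x $ i)"
      by (intro Ck_on_sum Ck_on_mult Ck_on_coordinate) simp
    have qE: "(\<Sum>i\<in>UNIV. x $ i * x $ i) = (norm x)\<^sup>2" for x :: "real^'n"
      by (simp add: power2_norm_eq_inner inner_vec_def)
    have "Ck_on k S1 (\<lambda>x. (1 + ln R) + (-1/2) * ln (\<Sum>i\<in>UNIV. x $ i * x $ i))"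
      by (intro Ck_on_add Ck_on_mult Ck_on_const Ck_on_compose[OF q diff_upto_ln]) (auto simp: qE S1_def)
    then have t: "Ck_on k S1 (\<lambda>x. E1 (norm x / R))"
    proof (rule Ck_on_cong[OF op(1), rotated])
      fix x assume "x \<in> S1"
      then have "0 < norm x" by (auto simp: S1_def)
      then show "(1 + ln R) + (-1/2) * ln (\<Sum>i\<in>UNIV. x $ i * x $ i) = E1 (norm x / R)"
        using E1_eq[of "norm x" R] R by (simp add: qE ln_realpow)
    qed
    have tpos: "(\<lambda>x. E1 (norm x / R)) ` S1 \<subseteq> {0<..}"
    proof -
      have "E1 (norm x / R) > 0" if "x \<in> S1" for x
        using that E1_ge_1[of "norm x" R] by (auto simp: S1_def)
      then show ?thesis by auto
    qed
    have tp: "Ck_on k S1 (\<lambda>x. 1 * E1 (norm x / R) powr ((real CARD('n) - 1) / CARD('n)))"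
      by (rule Ck_on_compose[OF t diff_upto_powr tpos])
    have l: "Ck_on k S1 (\<lambda>x. ln (E1 (norm x / R)))" by (rule Ck_on_compose[OF t diff_upto_ln tpos])
    have f1: "Ck_on k S1 (\<lambda>x. flat_fun 0 ((1/L) * ln (E1 (norm x / R)) + (-1)))"
      by (intro Ck_on_compose[OF _ diff_upto_flat_fun] Ck_on_add Ck_on_mult Ck_on_const l) simp
    have f2: "Ck_on k S1 (\<lambda>x. flat_fun 0 (3 + (-1/L) * ln (E1 (norm x / R))))"
      by (intro Ck_on_compose[OF _ diff_upto_flat_fun] Ck_on_add Ck_on_mult Ck_on_const l) simp
    have "Ck_on k S1 (\<lambda>x. (\<epsilon> * L powr (1 / CARD('n))) * (1 * E1 (norm x / R) powr ((real CARD('n) - 1) / CARD('n)))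
        * (flat_fun 0 ((1/L) * ln (E1 (norm x / R)) + (-1)) * flat_fun 0 (3 + (-1/L) * ln (E1 (norm x / R)))))"
      by (intro Ck_on_mult Ck_on_const tp f1 f2)
    then have c1: "Ck_on k S1 (trial R L \<epsilon>)"
      by (rule Ck_on_cong[OF op(1), rotated]) (simp add: S1_def trial_def bump_def)
    have c2: "Ck_on k (S2 \<union> S3) (trial R L \<epsilon>)"
      by (rule Ck_on_cong[OF open_Un[OF op(2,3)] _ Ck_on_const[of k _ 0]])
         (use trial_eq_0[OF R L, where 'n='n] in \<open>auto simp: S2_def S3_def r1_def r2_def\<close>)
    show ?thesis using Ck_on_Un[OF op(1) open_Un[OF op(2,3)] c1 c2] unfolding cover .
  qed
  moreover have "trial R L \<epsilon> x = 0" if "x \<notin> cball 0 r2" for x :: "real^'n"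
    using that trial_eq_0[OF R L, of x \<epsilon>] by (simp add: r2_def)
  ultimately show ?thesis
    unfolding test_function_def using sub
    by (auto intro!: Ck_on_UNIV_imp_Ck exI[of _ "cball 0 r2"] simp: r2_def)
qed

text \<open>When the derivative falls on \<open>E1^k\<close> it reproduces the ground slope, so the difference contains only the
  derivative of the bump, and this carries the small factor \<open>1/L\<close>.\<close>

lemma grad_trial:
  fixes x :: "real^'n"
  assumes L: "L > 0" and x: "x \<noteq> 0" "norm x < R"
  defines "t \<equiv> E1 (norm x / R)" and "n \<equiv> real CARD('n)"
  shows "grad (trial R L \<epsilon>) x - ground_slope R (trial R L \<epsilon>) x
    = - (\<epsilon> * L powr (1/n) * t powr ((n - 1)/n - 1) * (bump_deriv (ln t / L) / L) / (norm x)\<^sup>2) *\<^sub>R x"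
proof -
  define c where "c = \<epsilon> * L powr (1/n)" define k where "k = (n - 1)/n"
  have nx: "0 < norm x" "norm x < R" using x by auto
  then have R: "R > 0" by linarith
  have t: "t \<ge> 1" unfolding t_def using E1_ge_1[of "norm x" R] nx by simp
  define F where "F r = c * E1 (r/R) powr k * bump (ln (E1 (r/R)) / L)" for r
  define F' where "F' = - (c * (k * t powr (k - 1)) * bump (ln t / L) + c * t powr (k - 1) * (bump_deriv (ln t / L) / L)) / norm x"
  have dE: "((\<lambda>r. E1 (r/R)) has_real_derivative - (1 / norm x)) (at (norm x))"
    by (rule E1_has_real_derivative[OF nx(1) R])
  have "((\<lambda>r. E1 (r/R) powr k) has_real_derivative k * t powr (k - 1) * (- (1 / norm x))) (at (norm x))"
    by (rule DERIV_cong[OF DERIV_fun_powr[OF dE]]) (use t in \<open>auto simp: t_def\<close>)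
  moreover have "((\<lambda>r. bump (ln (E1 (r/R)) / L)) has_real_derivative bump_deriv (ln t / L) * (1 / t * (- (1 / norm x)) / L)) (at (norm x))"
  proof -
    have "((\<lambda>r. ln (E1 (r/R))) has_real_derivative 1 / t * (- (1 / norm x))) (at (norm x))"
      using DERIV_chain2[OF DERIV_ln_divide dE] t by (simp add: t_def)
    from DERIV_chain2[OF bump_has_real_derivative DERIV_cdivide[OF this, of L]] show ?thesis by (simp add: t_def)
  qed
  ultimately have "((\<lambda>r. c * (E1 (r/R) powr k * bump (ln (E1 (r/R)) / L))) has_real_derivative
      c * (k * t powr (k - 1) * (- (1 / norm x)) * bump (ln t / L) + bump_deriv (ln t / L) * (1 / t * (- (1 / norm x)) / L) * t powr k)) (at (norm x))"
    unfolding t_def by (intro DERIV_cmult DERIV_mult)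
  also have "(\<lambda>r. c * (E1 (r/R) powr k * bump (ln (E1 (r/R)) / L))) = F" by (simp add: F_def fun_eq_iff)
  also have "c * (k * t powr (k - 1) * (- (1 / norm x)) * bump (ln t / L) + bump_deriv (ln t / L) * (1 / t * (- (1 / norm x)) / L) * t powr k) = F'"
  proof -
    have "t powr k = t * t powr (k - 1)" using t by (simp add: powr_mult_base)
    then show ?thesis using t nx unfolding F'_def by (simp add: field_simps)
  qed
  finally have "(F has_derivative (*) F') (at (norm x))" by (simp add: has_field_derivative_def)
  moreover have "(norm has_derivative (\<lambda>v. (x \<bullet> v) / norm x)) (at x within UNIV)"
    using has_derivative_norm[of x] x by (simp add: sgn_div_norm inner_commute divide_inverse mult_ac)
  ultimately have "((\<lambda>y. F (norm y)) has_derivative (\<lambda>v. F' * ((x \<bullet> v) / norm x))) (at x)"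
    by (rule has_derivative_compose[rotated])
  then have "(trial R L \<epsilon> has_derivative (\<lambda>v. F' * ((x \<bullet> v) / norm x))) (at x)"
  proof (rule has_derivative_transform_within_open)
    show "open {y::real^'n. y \<noteq> 0 \<and> norm y < R}"
      by (intro open_Collect_less open_Collect_conj open_Collect_neq continuous_intros)
    show "F (norm y) = trial R L \<epsilon> y" if "y \<in> {y. y \<noteq> 0 \<and> norm y < R}" for y :: "real^'n"
      using that by (simp add: F_def trial_def c_def k_def n_def)
  qed (use x in simp)
  then have "(trial R L \<epsilon> has_derivative (\<lambda>v. ((F' / norm x) *\<^sub>R x) \<bullet> v)) (at x)" by simp
  then have g: "grad (trial R L \<epsilon>) x = (F' / norm x) *\<^sub>R x" by (rule grad_eqI)
  have "trial R L \<epsilon> x = c * t powr k * bump (ln t / L)"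
    using x by (simp add: trial_def c_def k_def n_def t_def)
  also have "t powr k = t * t powr (k - 1)" using t by (simp add: powr_mult_base)
  finally have a: "ground_slope R (trial R L \<epsilon>) x = - ((k * c * t powr (k - 1) * bump (ln t / L)) / (norm x)\<^sup>2) *\<^sub>R x"
    using t unfolding ground_slope_def by (simp add: k_def n_def t_def)
  have "F' / norm x = - (k * c * t powr (k - 1) * bump (ln t / L)) / (norm x)\<^sup>2 - (c * t powr (k - 1) * (bump_deriv (ln t / L) / L)) / (norm x)\<^sup>2"
    using nx unfolding F'_def by (simp add: power2_eq_square diff_divide_distrib add_divide_distrib mult_ac)
  then show ?thesis unfolding g a c_def[symmetric] k_def[symmetric]
    by (simp add: scaleR_left_diff_distrib)
qed

lemma harm_le_1_plus_ln:
  assumes "N \<ge> 1" shows "harm N \<le> 1 + ln (real N)"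
proof -
  have "harm (Suc (N-1)) - ln (real (Suc (N-1))) \<le> harm (Suc 0) - ln (real (Suc 0))"
    using decseqD[OF decseq_harm_diff_ln, of 0 "N-1"] by simp
  then show ?thesis using assms by (simp add: harm_def)
qed

text \<open>In polar coordinates the integral is \<open>\<integral> dt / t\<close>.  Each shell \<open>j \<le> t < j + 1\<close> has a bounded share of the
  dilation invariant measure \<open>dx / |x|^n\<close>, which leads to a harmonic sum.\<close>

lemma nn_integral_log_weight_le:
  fixes w :: "real^'n \<Rightarrow> real"
  defines "n \<equiv> CARD('n)"
  assumes R: "R > 0" and T: "T \<ge> 1"
  assumes w: "\<And>x. w x = (if x \<noteq> 0 \<and> norm x < R \<and> E1 (norm x / R) \<le> T then 1 / (E1 (norm x / R) * norm x ^ n) else 0)"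
  shows "(\<integral>\<^sup>+x. ennreal (w x) \<partial>lborel) \<le> ennreal (unit_ball_vol n * exp n * (1 + ln T))"
proof -
  define N where "N = nat \<lfloor>T\<rfloor>"
  have N: "N \<ge> 1" "real N \<le> T" using T by (auto simp: N_def le_nat_iff le_floor_iff)
  define C where "C j = exp (n * real j) / (j * R^n)" for j :: nat
  have C0: "C j \<ge> 0" for j using R by (simp add: C_def)
  define B where "B j = (cball 0 (R * exp (1 - real j)) :: (real^'n) set)" for j :: nat
  have "ennreal (w x) \<le> (\<Sum>j\<in>{1..N}. ennreal (C j) * indicator (B j) x)" for x
  proof (cases "x \<noteq> 0 \<and> norm x < R \<and> E1 (norm x / R) \<le> T")
    case True
    define t where "t = E1 (norm x / R)"
    have nx: "0 < norm x" "norm x < R" using True by auto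
    have t: "1 \<le> t" "t \<le> T" using True E1_ge_1[of "norm x" R] nx by (auto simp: t_def)
    have tE: "t = 1 + ln R - ln (norm x)" unfolding t_def using E1_eq nx R by blast
    define j where "j = nat \<lfloor>t\<rfloor>"
    have j: "j \<ge> 1" "real j \<le> t" "t < real j + 1" using t by (auto simp: j_def le_nat_iff le_floor_iff)
    have jN: "j \<in> {1..N}" using j t by (auto simp: j_def N_def intro!: nat_mono floor_mono)
    have nxe: "norm x = R * exp (1 - t)" using nx R unfolding tE by (simp add: exp_diff exp_add)
    have "x \<in> B j" using j R by (simp add: B_def nxe)
    moreover have "w x \<le> C j"
    proof -
      have "w x = 1 / (t * norm x ^ n)" unfolding w t_def by (rule if_P[OF True])
      then have "w x = 1 / (t * (R * exp (1 - t))^n)" unfolding nxe[symmetric] .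
      also have "\<dots> \<le> 1 / (real j * (R * exp (- real j))^n)"
        using j R by (intro divide_left_mono mult_mono power_mono mult_pos_pos) auto
      also have "\<dots> = C j"
      proof -
        have "exp (- real j) ^ n = inverse (exp (n * real j))"
          by (simp add: exp_of_nat_mult power_inverse exp_minus)
        then show ?thesis using R j by (simp add: C_def power_mult_distrib divide_inverse mult_ac)
      qed
      finally show ?thesis .
    qed
    ultimately have "ennreal (w x) \<le> ennreal (C j) * indicator (B j) x" by (simp add: ennreal_leI)
    also have "\<dots> \<le> (\<Sum>j\<in>{1..N}. ennreal (C j) * indicator (B j) x)"
      using jN by (intro member_le_sum) auto
    finally show ?thesis .
  next
    case False
    then show ?thesis using w by auto
  qed
  then have "(\<integral>\<^sup>+x. ennreal (w x) \<partial>lborel) \<le> (\<integral>\<^sup>+x. (\<Sum>j\<in>{1..N}. ennreal (C j) * indicator (B j) x) \<partial>lborel)"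
    by (rule nn_integral_mono)
  also have "\<dots> = (\<Sum>j\<in>{1..N}. ennreal (C j) * emeasure lborel (B j))"
  proof -
    have [measurable]: "B j \<in> sets borel" for j by (simp add: B_def)
    show ?thesis by (subst nn_integral_sum) (simp_all add: nn_integral_cmult_indicator)
  qed
  also have "\<dots> = (\<Sum>j\<in>{1..N}. ennreal (unit_ball_vol n * exp n * (1 / j)))"
  proof (rule sum.cong)
    fix j assume j: "j \<in> {1..N}"
    have "emeasure lborel (B j) = ennreal (unit_ball_vol n * (R * exp (1 - real j)) ^ n)"
      unfolding B_def using R by (simp add: emeasure_cball n_def)
    then have "ennreal (C j) * emeasure lborel (B j) = ennreal (C j * (unit_ball_vol n * (R * exp (1 - real j)) ^ n))"
      using C0 by (simp add: ennreal_mult')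
    also have "C j * (unit_ball_vol n * (R * exp (1 - real j)) ^ n) = unit_ball_vol n * exp n * (1 / j)"
    proof -
      have "exp (n * real j) * exp (1 - real j) ^ n = exp n"
        by (simp add: exp_of_nat_mult[symmetric] exp_add[symmetric] algebra_simps)
      then show ?thesis using R j by (simp add: C_def power_mult_distrib field_simps)
    qed
    finally show "ennreal (C j) * emeasure lborel (B j) = ennreal (unit_ball_vol n * exp n * (1 / j))" .
  qed simp
  also have "\<dots> = ennreal (unit_ball_vol n * exp n * harm N)"
    by (subst sum_ennreal) (auto simp: harm_def sum_distrib_left divide_inverse intro!: mult_nonneg_nonneg)
  also have "\<dots> \<le> ennreal (unit_ball_vol n * exp n * (1 + ln T))"
  proof (intro ennreal_leI mult_left_mono)
    have "ln (real N) \<le> ln T" using N T by simp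
    then show "harm N \<le> 1 + ln T" using harm_le_1_plus_ln[OF N(1)] by linarith
  qed auto
  finally show ?thesis .
qed

text \<open>With \<open>\<sigma> = \<epsilon> E1^(-1/n) / |x|\<close> and \<open>\<mu> = L^(1/n)\<close> one has \<open>|a| \<le> \<mu> \<sigma>\<close> and \<open>|b| \<le> 4 \<mu> \<sigma> / L\<close>.  Hence the quadratic
  term is at most \<open>16 \<mu>^n \<sigma>^n / L\<^sup>2 = 16 \<sigma>^n / L\<close>, while \<open>|b|^n\<close> is even smaller when \<open>n > 2\<close>.\<close>

lemma trial_error_le:
  fixes x :: "real^'n"
  defines "n \<equiv> CARD('n)"
  assumes n2: "CARD('n) \<ge> 2" and R: "R > 0" and L: "L \<ge> 1" and e: "\<epsilon> \<ge> 0"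
  defines "a \<equiv> ground_slope R (trial R L \<epsilon>) x" and "b \<equiv> grad (trial R L \<epsilon>) x - ground_slope R (trial R L \<epsilon>) x"
  shows "norm a ^ (n-2) * (norm b)\<^sup>2 + norm b ^ n
     \<le> 2 * 4^n * \<epsilon>^n / L * (if x \<noteq> 0 \<and> norm x < R \<and> E1 (norm x / R) \<le> exp (3*L) then 1 / (E1 (norm x / R) * norm x ^ n) else 0)"
proof (cases "x \<noteq> 0 \<and> norm x < R \<and> E1 (norm x / R) \<le> exp (3*L)")
  case True
  define t where "t = E1 (norm x / R)"
  \<comment> \<open>\<open>\<mu>^n = L\<close> and \<open>\<sigma>^n = \<epsilon>^n / (E1 |x|^n)\<close>\<close>
  define \<mu> where "\<mu> = L powr (1/n)"
  define \<sigma> where "\<sigma> = \<epsilon> * t powr ((real n - 1)/n - 1) / norm x"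
  have nx: "0 < norm x" "norm x < R" using True by auto
  have L0: "L > 0" using L by simp
  have t: "t \<ge> 1" unfolding t_def using E1_ge_1[of "norm x" R] nx by simp
  have n: "n \<ge> 2" "real n > 0" using n2 by (auto simp: n_def)
  have l0: "\<mu> > 0" using L by (simp add: \<mu>_def)
  have ln: "\<mu> ^ n = L" using L n by (simp add: \<mu>_def powr_realpow[symmetric] powr_powr)
  have s0: "\<sigma> \<ge> 0" using e by (simp add: \<sigma>_def)
  have kn: "((real n - 1)/n - 1) * real n = -1" using n by (simp add: field_simps)
  have "(t powr ((real n - 1)/n - 1)) ^ n = t powr (-1)"
    using t by (simp only: powr_realpow[symmetric] powr_gt_zero powr_powr kn)
  then have sn: "\<sigma> ^ n = \<epsilon>^n * (1 / (t * norm x ^ n))"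
    using t by (simp add: \<sigma>_def power_mult_distrib power_divide powr_minus_divide)
  have tk: "t powr ((real n - 1)/n) = t * t powr ((real n - 1)/n - 1)"
    using t by (simp add: powr_mult_base)
  have k01: "0 \<le> (real n - 1)/n" "(real n - 1)/n \<le> 1" using n by auto
  have ue: "trial R L \<epsilon> x = \<epsilon> * \<mu> * t powr ((real n - 1)/n) * bump (ln t / L)"
    using nx True by (simp add: trial_def \<mu>_def t_def n_def)
  have "norm a = (real n - 1)/n * \<bar>trial R L \<epsilon> x\<bar> / (norm x * t)"
    unfolding a_def norm_ground_slope[OF nx(2)] by (simp add: n_def t_def)
  also have "\<dots> = (real n - 1)/n * bump (ln t / L) * (\<mu> * \<sigma>)"
    unfolding ue tk using t nx e l0 bump_bounds(1)
    by (simp add: abs_mult \<sigma>_def)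
  also have "\<dots> \<le> 1 * 1 * (\<mu> * \<sigma>)"
    using k01 bump_bounds(1,2) l0 s0 by (intro mult_mono) auto
  finally have na: "norm a \<le> \<mu> * \<sigma>" by simp
  have "b = - (\<epsilon> * \<mu> * t powr ((real n - 1)/n - 1) * (bump_deriv (ln t / L) / L) / (norm x)\<^sup>2) *\<^sub>R x"
    unfolding b_def \<mu>_def t_def n_def using grad_trial[OF L0, of x R \<epsilon>] nx by simp
  then have "norm b = \<bar>bump_deriv (ln t / L)\<bar> / L * (\<mu> * \<sigma>)"
    using nx e l0 L0 by (simp add: \<sigma>_def abs_mult power2_eq_square)
  also have "\<dots> \<le> 4 / L * (\<mu> * \<sigma>)"
    using bump_bounds(3) l0 s0 L0 by (intro mult_right_mono divide_right_mono) auto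
  finally have nb: "norm b \<le> 4 / L * (\<mu> * \<sigma>)" .
  have ls: "0 \<le> \<mu> * \<sigma>" using l0 s0 by simp
  have lsn: "(\<mu> * \<sigma>) ^ n = L * \<sigma> ^ n" by (simp add: power_mult_distrib ln)
  have "norm a ^ (n-2) * (norm b)\<^sup>2 \<le> (\<mu> * \<sigma>) ^ (n-2) * (4 / L * (\<mu> * \<sigma>))\<^sup>2"
    by (intro mult_mono power_mono na nb) (use ls in auto)
  also have "\<dots> = 16 / L\<^sup>2 * ((\<mu> * \<sigma>) ^ (n-2) * (\<mu> * \<sigma>)\<^sup>2)"
    by (simp add: power_mult_distrib power_divide)
  also have "(\<mu> * \<sigma>) ^ (n-2) * (\<mu> * \<sigma>)\<^sup>2 = L * \<sigma> ^ n"
    unfolding lsn[symmetric] power_add[symmetric] le_add_diff_inverse2[OF n(1)] ..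
  also have "16 / L\<^sup>2 * (L * \<sigma> ^ n) = 4\<^sup>2 * \<sigma>^n / L" using L0 by (simp add: power2_eq_square)
  also have "\<dots> \<le> 4^n * \<sigma>^n / L"
    using n L0 s0 by (intro divide_right_mono mult_right_mono power_increasing) auto
  finally have 1: "norm a ^ (n-2) * (norm b)\<^sup>2 \<le> 4^n * \<sigma>^n / L" .
  have "norm b ^ n \<le> (4 / L * (\<mu> * \<sigma>)) ^ n" by (intro power_mono nb) simp
  also have "\<dots> = 4 ^ n * \<sigma> ^ n * L / L ^ n" by (simp add: power_mult_distrib[of "4/L"] power_divide lsn)
  also have "\<dots> \<le> 4 ^ n * \<sigma> ^ n * L / L ^ 2"
    using n L s0 by (intro divide_left_mono power_increasing mult_nonneg_nonneg mult_pos_pos) auto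
  also have "\<dots> = 4 ^ n * \<sigma> ^ n / L" using L0 by (simp add: power2_eq_square)
  finally have 2: "norm b ^ n \<le> 4^n * \<sigma>^n / L" .
  have "norm a ^ (n-2) * (norm b)\<^sup>2 + norm b ^ n \<le> 2 * 4^n * \<sigma>^n / L" using 1 2 by simp
  also have "\<dots> = 2 * 4^n * \<epsilon>^n / L * (1 / (t * norm x ^ n))" unfolding sn by simp
  finally show ?thesis using True by (simp add: t_def)
next
  case False
  have L0: "L > 0" using L by simp
  have "b = 0"
  proof (cases "x \<noteq> 0 \<and> norm x < R")
    case True
    then have "exp (3*L) \<le> E1 (norm x / R)" using False by auto
    then have "3*L \<le> ln (E1 (norm x / R))" by (metis exp_gt_zero less_le_trans ln_ge_iff)
    then have "3 \<le> ln (E1 (norm x / R)) / L" using L0 by (simp add: le_divide_eq)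
    then show ?thesis unfolding b_def using True grad_trial[OF L0, of x R \<epsilon>] bump_bounds(5)[of "ln (E1 (norm x / R)) / L"] by simp
  next
    case False
    define S where "S = ball 0 (trial_radius R (3*L)) \<union> - (cball (0::real^'n) (trial_radius R L))"
    have tf: "test_function UNIV (trial R L \<epsilon> :: real^'n \<Rightarrow> real)" by (rule test_function_trial[OF R L0]) simp
    have z: "trial R L \<epsilon> y = 0" if "y \<in> S" for y
      using that by (intro trial_eq_0[OF R L0]) (auto simp: S_def)
    have xS: "x \<in> S"
      using False R trial_radius_less[OF R L0] by (auto simp: S_def trial_radius_def[of R "3*L"])
    have "grad (trial R L \<epsilon>) x = 0"
      by (rule gradient_zero_off_support[of "trial R L \<epsilon>" "grad (trial R L \<epsilon>)", OF test_function_has_derivative(1)[OF tf] _ z xS])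
        (auto simp: S_def)
    then show ?thesis using z[OF xS] by (simp add: b_def ground_slope_def)
  qed
  then show ?thesis using n2 unfolding if_not_P[OF False] by (simp add: n_def zero_power)
qed

text \<open>The upper bound for \<open>|a + b|^n\<close> is integrated.  Its linear term vanishes by the drift identity with \<open>\<gamma> = 0\<close>, where the
  constant weight is allowed because the trial function is zero near the origin; the error is at most
  a constant times \<open>\<epsilon>^n (1 + 3L) / L\<close>, uniformly in \<open>L \<ge> 1\<close>.\<close>

lemma trial_energy_bound:
  assumes n2: "CARD('n::finite) \<ge> 2"
  obtains \<epsilon> where "\<epsilon> > 0" "\<And>R L. R > 0 \<Longrightarrow> L \<ge> 1 \<Longrightarrow>
     (\<integral>\<^sup>+x. ennreal (norm (grad (trial R L \<epsilon>) (x::real^'n)) ^ CARD('n)) \<partial>lborel)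
       \<le> (\<integral>\<^sup>+x. ennreal (norm (ground_slope R (trial R L \<epsilon>) (x::real^'n)) ^ CARD('n)) \<partial>lborel) + 1"
    "\<And>R L. R > 0 \<Longrightarrow> L \<ge> 1 \<Longrightarrow>
     (\<integral>\<^sup>+x. ennreal (norm (ground_slope R (trial R L \<epsilon>) (x::real^'n)) ^ CARD('n)) \<partial>lborel) < \<infinity>"
proof -
  define n where "n = CARD('n)"
  have n: "n \<ge> 2" using n2 by (simp add: n_def)
  obtain C where C: "C > 0" "\<And>a b :: real^'n.
     norm (a+b) ^ n \<le> norm a ^ n + n * norm a^(n-2) * (a \<bullet> b)
        + C * (norm a^(n-2) * (norm b)\<^sup>2 + norm b ^ n)"
    using norm_add_power_le[OF n, where 'a="real^'n"] by auto
  have n2': "DIM(real^'n) \<ge> 2" using n2 by simp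
  obtain c where c: "c > 0" "\<And>(u :: real^'n \<Rightarrow> real) Du R r0.
     (\<And>x. (u has_derivative (\<lambda>h. Du x \<bullet> h)) (at x)) \<Longrightarrow> continuous_on UNIV Du \<Longrightarrow>
     r0 < R \<Longrightarrow> (\<And>x. norm x > r0 \<Longrightarrow> u x = 0) \<Longrightarrow>
     (\<integral>\<^sup>+x. ennreal (norm (ground_slope R u x) ^ DIM(real^'n) + c * (norm (ground_slope R u x) ^ DIM(real^'n) / (E2 (norm x/R))\<^sup>2
          + norm (Du x - ground_slope R u x) ^ DIM(real^'n))) \<partial>lborel)
       \<le> (\<integral>\<^sup>+x. ennreal (norm (Du x) ^ DIM(real^'n)) \<partial>lborel)"
  proof (rule leray_inequality_with_remainder[OF n2'], goal_cases)
    case (1 c) show ?case by (rule 1(1)[OF 1(2)]) (rule 1(3))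
  qed
  \<comment> \<open>the total error is at most \<open>D \<epsilon>^n\<close>; since \<open>\<epsilon> \<le> 1\<close>, the choice of \<open>\<epsilon>\<close> below makes this at most \<open>1\<close>\<close>
  define D where "D = C * 8 * 4^n * (unit_ball_vol n * exp n)"
  have D: "D \<ge> 0" using C(1) by (simp add: D_def)
  define \<epsilon> where "\<epsilon> = 1 / (1 + D)"
  have e: "0 < \<epsilon>" "\<epsilon> \<le> 1" using D by (auto simp: \<epsilon>_def)
  have De: "D * \<epsilon>^n \<le> 1"
  proof -
    have "\<epsilon>^n \<le> \<epsilon>^1" using e n by (intro power_decreasing) auto
    then have "D * \<epsilon>^n \<le> D * \<epsilon>" using D by (intro mult_left_mono) auto
    also have "\<dots> \<le> 1" using D by (simp add: \<epsilon>_def field_simps)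
    finally show ?thesis .
  qed
  have main: "(\<integral>\<^sup>+x. ennreal (norm (grad (trial R L \<epsilon>) (x::real^'n)) ^ n) \<partial>lborel)
       \<le> (\<integral>\<^sup>+x. ennreal (norm (ground_slope R (trial R L \<epsilon>) (x::real^'n)) ^ n) \<partial>lborel) + 1
     \<and> (\<integral>\<^sup>+x. ennreal (norm (ground_slope R (trial R L \<epsilon>) (x::real^'n)) ^ n) \<partial>lborel) < \<infinity>"
    if R: "R > 0" and L: "L \<ge> 1" for R L
  proof -
    define u where "u = (trial R L \<epsilon> :: real^'n \<Rightarrow> real)"
    have L0: "L > 0" using L by simp
    have tf: "test_function UNIV u" unfolding u_def by (rule test_function_trial[OF R L0]) simp
    note du = test_function_has_derivative[OF tf]
    obtain K where K: "compact K" "\<And>x. x \<notin> K \<Longrightarrow> grad u x = 0" using test_function_support[OF tf] by metis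
    define a where "a = ground_slope R u"
    have uc: "continuous_on UNIV u" by (rule test_function_continuous[OF tf])
    have [measurable]: "u \<in> borel_measurable borel" "grad u \<in> borel_measurable borel"
      using uc du(2) by (auto intro: borel_measurable_continuous_onI)
    have [measurable]: "a \<in> borel_measurable borel" unfolding a_def ground_slope_def[abs_def] by measurable
    have rad: "trial_radius R L < R" by (rule trial_radius_less[OF R L0])
    have out: "\<And>x. norm x > trial_radius R L \<Longrightarrow> u x = 0"
      unfolding u_def by (rule trial_eq_0[OF R L0]) auto
    have gi: "integrable lborel (\<lambda>x. norm (grad u x) ^ n)"
    proof -
      have "integrable (lebesgue_on UNIV) (\<lambda>x. norm (grad u x) ^ n)"
        by (rule continuous_compact_support_integrable_power[OF du(2) K]) (use n in auto)
      then have "integrable lebesgue (\<lambda>x. norm (grad u x) ^ n)" by (simp add: lebesgue_on_UNIV_eq)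
      then show ?thesis by (subst (asm) integrable_completion) simp_all
    qed
    have gf: "(\<integral>\<^sup>+x. ennreal (norm (grad u x) ^ n) \<partial>lborel) < \<infinity>"
      using gi by (simp add: nn_integral_eq_integral)
    have "(\<integral>\<^sup>+x. ennreal (norm (a x) ^ n) \<partial>lborel)
       \<le> (\<integral>\<^sup>+x. ennreal (norm (a x) ^ DIM(real^'n) + c * (norm (a x) ^ DIM(real^'n) / (E2 (norm x/R))\<^sup>2
          + norm (grad u x - a x) ^ DIM(real^'n))) \<partial>lborel)"
      using c(1) by (intro nn_integral_mono ennreal_leI) (simp add: n_def)
    also have "\<dots> \<le> (\<integral>\<^sup>+x. ennreal (norm (grad u x) ^ DIM(real^'n)) \<partial>lborel)"
      unfolding a_def by (rule c(2)[OF du rad out])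
    also have "\<dots> < \<infinity>" using gf by (simp add: n_def)
    finally have af: "(\<integral>\<^sup>+x. ennreal (norm (a x) ^ n) \<partial>lborel) < \<infinity>" .
    have ai: "integrable lborel (\<lambda>x. norm (a x) ^ n)"
      by (rule integrableI_nonneg[OF _ _ af]) auto
    define Z where "Z = (\<lambda>x. n * norm (a x) ^ (n-2) * (a x \<bullet> (grad u x - a x)))"
    have near: "trial_radius R (3*L) > 0" "\<And>x. norm x < trial_radius R (3*L) \<Longrightarrow> 1 * \<bar>u x\<bar> = 0"
      using R trial_eq_0[OF R L0, where 'n='n] by (auto simp: trial_radius_def u_def)
    have one: "\<And>x::real^'n. ((\<lambda>x. 1::real) has_derivative (\<lambda>h. 0 \<bullet> h)) (at x)" "continuous_on UNIV (\<lambda>x::real^'n. 0::real^'n)"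
      by simp_all
    have Z: "integrable lborel Z" "(\<integral>x. Z x \<partial>lborel) = 0"
      using weighted_drift_identity[OF n2' du one rad out near, of 0]
      by (simp_all add: Z_def a_def n_def)
    define w where "w = (\<lambda>x::real^'n. if x \<noteq> 0 \<and> norm x < R \<and> E1 (norm x / R) \<le> exp (3*L) then 1 / (E1 (norm x / R) * norm x ^ n) else 0)"
    have wm [measurable]: "w \<in> borel_measurable borel" unfolding w_def by measurable
    have w0: "w x \<ge> 0" for x
    proof -
      have "E1 (norm x / R) \<ge> 1" if "x \<noteq> 0" "norm x < R" using that E1_ge_1[of "norm x" R] by auto
      then show ?thesis by (auto simp: w_def)
    qed
    have "(\<integral>\<^sup>+x. ennreal (w x) \<partial>lborel) \<le> ennreal (unit_ball_vol n * exp n * (1 + ln (exp (3*L))))"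
      unfolding n_def by (rule nn_integral_log_weight_le[OF R]) (use L in \<open>auto simp: w_def n_def\<close>)
    then have wn: "(\<integral>\<^sup>+x. ennreal (w x) \<partial>lborel) \<le> ennreal (unit_ball_vol n * exp n * (1 + 3*L))" by simp
    have wi: "integrable lborel w"
      by (rule integrableI_nonneg) (use w0 wn in \<open>auto simp: top.not_eq_extremum le_less_trans\<close>)
    have wI: "(\<integral>x. w x \<partial>lborel) \<le> unit_ball_vol n * exp n * (1 + 3*L)"
      using wn w0 L by (simp add: nn_integral_eq_integral[OF wi] ennreal_le_iff)
    define q where "q = C * (2 * 4^n * \<epsilon>^n / L)"
    have q0: "q \<ge> 0" using C(1) e L0 by (simp add: q_def)
    have pw: "norm (grad u x) ^ n \<le> norm (a x) ^ n + Z x + q * w x" for x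
    proof -
      have "norm (a x + (grad u x - a x)) ^ n \<le> norm (a x) ^ n + n * norm (a x)^(n-2) * (a x \<bullet> (grad u x - a x))
        + C * (norm (a x)^(n-2) * (norm (grad u x - a x))\<^sup>2 + norm (grad u x - a x) ^ n)" by (rule C(2))
      also have "C * (norm (a x)^(n-2) * (norm (grad u x - a x))\<^sup>2 + norm (grad u x - a x) ^ n) \<le> C * (2 * 4^n * \<epsilon>^n / L * w x)"
        using trial_error_le[OF n2 R L, of \<epsilon> x] e C(1) unfolding w_def a_def u_def n_def by (intro mult_left_mono) auto
      finally show ?thesis by (simp add: Z_def q_def mult.assoc)
    qed
    have "(\<integral>x. norm (grad u x) ^ n \<partial>lborel) \<le> (\<integral>x. (norm (a x) ^ n + Z x) + q * w x \<partial>lborel)"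
      by (intro integral_mono gi Bochner_Integration.integrable_add ai Z(1) integrable_mult_right wi pw)
    also have "\<dots> = (\<integral>x. norm (a x) ^ n \<partial>lborel) + q * (\<integral>x. w x \<partial>lborel)"
      using ai Z wi by simp
    also have "q * (\<integral>x. w x \<partial>lborel) \<le> q * (unit_ball_vol n * exp n * (1 + 3*L))"
      using q0 wI by (rule mult_left_mono[rotated])
    also have "\<dots> \<le> q * (unit_ball_vol n * exp n * (4 * L))"
      using q0 L by (intro mult_left_mono) auto
    also have "\<dots> = D * \<epsilon>^n" using L0 by (simp add: q_def D_def)
    also have "\<dots> \<le> 1" by (rule De)
    finally have "(\<integral>x. norm (grad u x) ^ n \<partial>lborel) \<le> (\<integral>x. norm (a x) ^ n \<partial>lborel) + 1" by simp
    then have "ennreal (\<integral>x. norm (grad u x) ^ n \<partial>lborel) \<le> ennreal (\<integral>x. norm (a x) ^ n \<partial>lborel) + 1"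
      by (simp add: ennreal_leI flip: ennreal_1 ennreal_plus)
    then have "(\<integral>\<^sup>+x. ennreal (norm (grad u x) ^ n) \<partial>lborel) \<le> (\<integral>\<^sup>+x. ennreal (norm (a x) ^ n) \<partial>lborel) + 1"
      using nn_integral_eq_integral[OF gi] nn_integral_eq_integral[OF ai] by simp
    then show ?thesis using af by (simp add: u_def a_def)
  qed
  show ?thesis
  proof (rule that[OF e(1)], goal_cases)
    case (1 R L) then show ?case using main[of R L] by (simp add: n_def)
  next
    case (2 R L) then show ?case using main[of R L] by (simp add: n_def)
  qed
qed

text \<open>The constant sequence approximates a test function; uniqueness of the weak gradient makes its
  second limit condition hold.\<close>

lemma test_function_in_W1_0:
  fixes \<Omega> :: "(real^'n) set"
  assumes \<Omega>: "open \<Omega>" and u: "test_function \<Omega> u" and p: "p > 0"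
  shows "u \<in> W1_0 p \<Omega>" "AE x in lebesgue_on \<Omega>. weak_grad \<Omega> u x = grad u x"
proof -
  note uc = test_function_continuous[OF u] and uD = test_function_has_derivative[OF u]
  obtain K where K: "compact K" "K \<subseteq> \<Omega>" "\<And>x. x \<notin> K \<Longrightarrow> u x = 0" "\<And>x. x \<notin> K \<Longrightarrow> grad u x = 0"
    by (rule test_function_support[OF u]) blast
  have \<Omega>L: "\<Omega> \<in> sets lebesgue" using \<Omega> by auto
  have "u \<in> Lp p \<Omega>" "grad u \<in> Lp p \<Omega>" unfolding Lp_def
    using continuous_on_UNIV_measurable_lebesgue_on[OF uc] continuous_on_UNIV_measurable_lebesgue_on[OF uD(2)]
      continuous_compact_support_integrable_power[OF uc K(1,3) p \<Omega>L]
      continuous_compact_support_integrable_power[OF uD(2) K(1,4) p \<Omega>L] by auto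
  note wg = test_function_has_weak_gradient[OF \<Omega> u]
  have W1: "u \<in> W1 p \<Omega>" unfolding W1_def using \<open>u \<in> Lp p \<Omega>\<close> \<open>grad u \<in> Lp p \<Omega>\<close> wg by auto
  show ae: "AE x in lebesgue_on \<Omega>. weak_grad \<Omega> u x = grad u x"
    by (rule weak_gradient_unique[OF \<Omega> W1_weak_grad[OF W1] wg])
  have "(LINT x|lebesgue_on \<Omega>. norm (grad u x - weak_grad \<Omega> u x) ^ p) = 0"
  proof -
    have "AE x in lebesgue_on \<Omega>. norm (grad u x - weak_grad \<Omega> u x) ^ p = 0"
      by (rule AE_mp[OF ae]) (use p in auto)
    then show ?thesis by (rule integral_eq_zero_AE)
  qed
  then show "u \<in> W1_0 p \<Omega>" unfolding W1_0_def using W1 u p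
    by (auto intro!: exI[of _ "\<lambda>_. u"] simp: zero_power)
qed

lemma I_fun_le_1I:
  fixes u :: "real^'n \<Rightarrow> real"
  assumes \<Omega>: "\<Omega> \<subseteq> ball 0 R"
    and u: "u \<in> borel_measurable (lebesgue_on \<Omega>)"
    and fin: "(\<integral>\<^sup>+x. ennreal (norm (ground_slope R u x) ^ CARD('n)) \<partial>lebesgue_on \<Omega>) < \<infinity>"
    and le: "(\<integral>\<^sup>+x. ennreal (norm (weak_grad \<Omega> u x) ^ CARD('n)) \<partial>lebesgue_on \<Omega>)
      \<le> (\<integral>\<^sup>+x. ennreal (norm (ground_slope R u x) ^ CARD('n)) \<partial>lebesgue_on \<Omega>) + 1"
  shows "I_fun u \<Omega> R \<le> 1"
proof -
  define n where "n = CARD('n)"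
  define \<kappa> where "\<kappa> = ((real n - 1) / real n) ^ n"
  have "n > 0" by (simp add: n_def)
  then have \<kappa>: "\<kappa> \<ge> 0" by (auto simp: \<kappa>_def intro!: zero_le_power divide_nonneg_nonneg)
  define G where "G = (\<integral>\<^sup>+x. ennreal (norm (weak_grad \<Omega> u x) ^ n) \<partial>lebesgue_on \<Omega>)"
  define X where "X = (\<integral>\<^sup>+x. ennreal (\<bar>u x\<bar> ^ n / (norm x ^ n * E1 (norm x / R) ^ n)) \<partial>lebesgue_on \<Omega>)"
  have Y: "(\<integral>\<^sup>+x. ennreal (norm (ground_slope R u x) ^ n) \<partial>lebesgue_on \<Omega>) = ennreal \<kappa> * X"
    unfolding X_def \<kappa>_def n_def by (rule leray_term_eq[OF \<Omega> u])
  have "ennreal \<kappa> * X \<noteq> top" using fin unfolding n_def[symmetric] Y by (simp add: less_top)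
  then obtain y where y: "ennreal \<kappa> * X = ennreal y" "y \<ge> 0" by (cases "ennreal \<kappa> * X") auto
  have "G \<le> ennreal y + 1" using le unfolding n_def[symmetric] Y y G_def .
  then have "G \<le> ennreal (y + 1)" using y by simp
  then obtain g where g: "G = ennreal g" "g \<ge> 0" "g \<le> y + 1"
    using y by (cases G) (auto simp: top_unique simp flip: ennreal_plus ennreal_1)
  have "ereal \<kappa> * enn2ereal X = enn2ereal (ennreal \<kappa> * X)"
    using \<kappa> by (simp add: times_ennreal.rep_eq enn2ereal_ennreal)
  then have "enn2ereal G - ereal \<kappa> * enn2ereal X = ereal (g - y)" using g y by (simp add: enn2ereal_ennreal)
  then show ?thesis using g unfolding I_fun_def G_def X_def \<kappa>_def n_def by simp
qed

lemma trial_admissible: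
  assumes n2: "CARD('n::finite) \<ge> 2"
  obtains \<epsilon> where "\<epsilon> > 0" "\<And>R L (\<Omega> :: (real^'n) set). R > 0 \<Longrightarrow> L \<ge> 1 \<Longrightarrow> open \<Omega> \<Longrightarrow>
     \<Omega> \<subseteq> ball 0 R \<Longrightarrow> cball 0 (trial_radius R L) \<subseteq> \<Omega> \<Longrightarrow> trial R L \<epsilon> \<in> admissible \<Omega> R"
proof (rule trial_energy_bound[OF n2], goal_cases)
  case (1 \<epsilon>)
  have "trial R L \<epsilon> \<in> admissible \<Omega> R" if R: "R > 0" and L: "L \<ge> 1" and \<Omega>: "open \<Omega>" "\<Omega> \<subseteq> ball 0 R"
    and sub: "cball 0 (trial_radius R L) \<subseteq> \<Omega>" for R L and \<Omega> :: "(real^'n) set"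
  proof -
    define u where "u = (trial R L \<epsilon> :: real^'n \<Rightarrow> real)"
    have u: "test_function \<Omega> u" unfolding u_def using test_function_trial[OF R _ sub] L by simp
    obtain K where K: "compact K" "K \<subseteq> \<Omega>" "\<And>x. x \<notin> K \<Longrightarrow> u x = 0" "\<And>x. x \<notin> K \<Longrightarrow> grad u x = 0"
      by (rule test_function_support[OF u]) blast
    have \<Omega>L: "\<Omega> \<in> sets lebesgue" using \<Omega> by auto
    have pos: "CARD('n) > 0" by simp
    note W = test_function_in_W1_0[OF \<Omega>(1) u pos]
    have a: "(\<integral>\<^sup>+x. ennreal (norm (ground_slope R u x) ^ CARD('n)) \<partial>lebesgue_on \<Omega>)
        = (\<integral>\<^sup>+x. ennreal (norm (ground_slope R u x) ^ CARD('n)) \<partial>lborel)"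
    proof (rule nn_integral_lebesgue_on_eq_lborel_support[OF \<Omega>L])
      fix x assume "x \<notin> \<Omega>"
      then have "u x = 0" using K by auto
      then show "ennreal (norm (ground_slope R u x) ^ CARD('n)) = 0" by (simp add: ground_slope_def)
    qed
    have "(\<integral>\<^sup>+x. ennreal (norm (weak_grad \<Omega> u x) ^ CARD('n)) \<partial>lebesgue_on \<Omega>)
        = (\<integral>\<^sup>+x. ennreal (norm (grad u x) ^ CARD('n)) \<partial>lebesgue_on \<Omega>)"
      using W(2) by (intro nn_integral_cong_AE) (auto elim: eventually_mono)
    also have "\<dots> = (\<integral>\<^sup>+x. ennreal (norm (grad u x) ^ CARD('n)) \<partial>lborel)"
    proof (rule nn_integral_lebesgue_on_eq_lborel_support[OF \<Omega>L])
      fix x assume "x \<notin> \<Omega>"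
      then have "grad u x = 0" using K by auto
      then show "ennreal (norm (grad u x) ^ CARD('n)) = 0" by simp
    qed
    also have "\<dots> \<le> (\<integral>\<^sup>+x. ennreal (norm (ground_slope R u x) ^ CARD('n)) \<partial>lborel) + 1"
      unfolding u_def by (rule 1(3)[OF R L])
    finally have "I_fun u \<Omega> R \<le> 1"
      unfolding a[symmetric]
      using I_fun_le_1I[OF \<Omega>(2) continuous_on_UNIV_measurable_lebesgue_on[OF test_function_continuous[OF u]]]
        1(4)[OF R L] unfolding u_def[symmetric] a by blast
    then show ?thesis unfolding admissible_def u_def[symmetric] using W(1) by simp
  qed
  from 1(1)[OF 1(2) this] show ?case by blast
qed

text \<open>On the shell \<open>T \<le> E1 \<le> T + 1\<close> with \<open>T = exp (2L)\<close> the argument \<open>ln E1 / L\<close> lies in \<open>[2, 5/2]\<close>, where the bump is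
  bounded below, and \<open>E2 \<le> 3L\<close>.  The power \<open>n/(n-1)\<close> turns \<open>E1^k\<close> into \<open>E1\<close>.  The exponent \<open>b\<close> stands for
  \<open>max \<beta> 0\<close>, since \<open>\<beta>\<close> may be negative.\<close>

lemma trial_exp_integral_ge:
  fixes \<Omega> :: "(real^'n) set"
  assumes n2: "CARD('n) \<ge> 2" and R: "R > 0" and L: "L \<ge> 2" and e: "\<epsilon> > 0" and c: "c > 0"
    and \<Omega>: "open \<Omega>" "cball 0 (trial_radius R L) \<subseteq> \<Omega>" and b: "\<beta> \<le> b" "0 \<le> b"
  defines "n \<equiv> real CARD('n)"
  shows "ennreal (unit_ball_vol n * R ^ CARD('n) * exp ((c * (\<epsilon> * exp (-3) * 3 powr (-b) * L powr (1/n - b)) powr (n/(n-1)) - n) * exp (2*L)))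
     \<le> exp_integral c \<beta> (trial R L \<epsilon>) \<Omega> R"
proof -
  define T where "T = exp (2*L)"
  define m where "m = \<epsilon> * exp (-3) * 3 powr (-b) * L powr (1/n - b)"
  define p where "p = n / (n - 1)"
  define A where "A = (cball 0 (R * exp (1 - T)) - ball 0 (R * exp (- T)) :: (real^'n) set)"
  have n: "n \<ge> 2" using n2 by (simp add: n_def)
  have p0: "p > 0" using n by (simp add: p_def)
  have T1: "T \<ge> 1" using L by (simp add: T_def)
  have m0: "m > 0" using e L by (simp add: m_def)
  have [measurable]: "A \<in> sets borel" by (simp add: A_def)
  have pw: "ennreal (exp (c * (m powr p * T))) * indicator A x
     \<le> ennreal (exp (c * (\<bar>trial R L \<epsilon> x\<bar> / E2 (norm x / R) powr \<beta>) powr p)) * indicator \<Omega> x" for x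
  proof (cases "x \<in> A")
    case True
    then have x: "R * exp (-T) \<le> norm x" "norm x \<le> R * exp (1 - T)" by (auto simp: A_def)
    have "R * exp (-T) > 0" using R by simp
    then have x0: "norm x > 0" using x by linarith
    have "exp (1 - T) < 1" using L by (simp add: T_def)
    then have "R * exp (1 - T) < R" using R by simp
    then have xR: "norm x < R" using x by linarith
    define t where "t = E1 (norm x / R)"
    have tE: "t = 1 + ln R - ln (norm x)" unfolding t_def using E1_eq x0 R by blast
    have "ln (R * exp (-T)) \<le> ln (norm x)" "ln (norm x) \<le> ln (R * exp (1 - T))"
      using x x0 R by (subst ln_le_cancel_iff; simp)+
    then have t: "T \<le> t" "t \<le> T + 1" unfolding tE using R by (simp_all add: ln_mult)
    have t1: "t \<ge> 1" using t T1 by linarith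
    have lt: "2 * L \<le> ln t" using t unfolding T_def by (simp add: ln_ge_iff t1[THEN less_le_trans[OF zero_less_one]])
    have "ln t \<le> ln (T * exp 1)"
    proof (subst ln_le_cancel_iff)
      have "T * 2 \<le> T * exp 1" using T1 exp_ge_add_one_self[of 1] by (intro mult_left_mono) auto
      then show "t \<le> T * exp 1" using t(2) T1 by linarith
    qed (use t1 T1 in auto)
    then have lt2: "ln t \<le> 2 * L + 1" by (simp add: T_def ln_mult)
    have "exp (-3) \<le> bump (ln t / L)"
      using lt lt2 L by (intro bump_lower_bound) (auto simp: le_divide_eq divide_le_eq)
    then have ub: "\<epsilon> * L powr (1/n) * t powr ((n - 1)/n) * exp (-3) \<le> \<bar>trial R L \<epsilon> x\<bar>"
      using x0 xR e unfolding trial_def t_def[symmetric] n_def[symmetric]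
      by (auto simp: abs_mult intro!: mult_left_mono)
    have E: "1 \<le> E2 (norm x / R)" "E2 (norm x / R) \<le> 3 * L"
    proof -
      show "1 \<le> E2 (norm x / R)" using E2_ge_1[OF x0, of R] xR by simp
      have "E2 (norm x / R) = 1 + ln t" using E2_eq[of "norm x / R"] t1 by (simp add: t_def)
      then show "E2 (norm x / R) \<le> 3 * L" using lt2 L by linarith
    qed
    have "E2 (norm x / R) powr \<beta> \<le> E2 (norm x / R) powr b" using E b by (intro powr_mono) auto
    also have "\<dots> \<le> (3 * L) powr b" using E b by (intro powr_mono2) auto
    finally have Eb: "E2 (norm x / R) powr \<beta> \<le> (3 * L) powr b" .
    have "m * t powr ((n - 1)/n) = \<epsilon> * L powr (1/n) * t powr ((n - 1)/n) * exp (-3) / (3 * L) powr b"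
      using L by (simp add: m_def powr_mult powr_diff powr_minus field_simps)
    also have "\<dots> \<le> \<bar>trial R L \<epsilon> x\<bar> / E2 (norm x / R) powr \<beta>"
      by (intro frac_le ub Eb) (use E in auto)
    finally have "(m * t powr ((n - 1)/n)) powr p \<le> (\<bar>trial R L \<epsilon> x\<bar> / E2 (norm x / R) powr \<beta>) powr p"
      using m0 p0 by (intro powr_mono2) auto
    moreover have "(m * t powr ((n - 1)/n)) powr p = m powr p * t"
    proof -
      have "(n - 1)/n * p = 1" using n by (simp add: p_def)
      then show ?thesis using m0 t1 by (simp add: powr_mult powr_powr)
    qed
    moreover have "m powr p * T \<le> m powr p * t" using t by (intro mult_left_mono) auto
    ultimately have "m powr p * T \<le> (\<bar>trial R L \<epsilon> x\<bar> / E2 (norm x / R) powr \<beta>) powr p" by linarith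
    then have "exp (c * (m powr p * T)) \<le> exp (c * (\<bar>trial R L \<epsilon> x\<bar> / E2 (norm x / R) powr \<beta>) powr p)"
      using c by simp
    moreover have "x \<in> \<Omega>"
    proof -
      have "exp L \<le> T" using L by (simp add: T_def)
      then have "R * exp (1 - T) \<le> trial_radius R L" using R by (simp add: trial_radius_def)
      then have "norm x \<le> trial_radius R L" using x(2) by linarith
      then show ?thesis using \<Omega>(2) by auto
    qed
    ultimately show ?thesis using True by (simp add: ennreal_leI)
  qed simp
  have \<Omega>L: "\<Omega> \<in> sets lebesgue" using \<Omega> by auto
  \<comment> \<open>\<open>exp n - 1 \<ge> 1\<close>: the inner ball takes at most half of the outer one\<close>
  have vol: "ennreal (unit_ball_vol n * (R ^ CARD('n) * exp (- n * T))) \<le> emeasure lborel A"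
  proof -
    have ex: "exp s ^ CARD('n) = exp (n * s)" for s by (simp add: n_def exp_of_nat_mult)
    have "exp (n * (1 - T)) = exp n * exp (- n * T)" by (simp add: exp_add[symmetric] algebra_simps)
    moreover have "exp n \<ge> 2" using exp_ge_add_one_self[of n] n by linarith
    ultimately have "2 * exp (- n * T) \<le> exp (n * (1 - T))" by simp
    then have "R ^ CARD('n) * exp (- n * T) \<le> R ^ CARD('n) * (exp (n * (1 - T)) - exp (- n * T))"
      using R by (intro mult_left_mono) auto
    also have "\<dots> = (R * exp (1 - T)) ^ CARD('n) - (R * exp (-T)) ^ CARD('n)"
      unfolding power_mult_distrib ex by (simp add: algebra_simps)
    finally have "unit_ball_vol n * (R ^ CARD('n) * exp (- n * T)) \<le> unit_ball_vol n * ((R * exp (1 - T)) ^ CARD('n) - (R * exp (-T)) ^ CARD('n))"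
      using n by (intro mult_left_mono) auto
    then have "ennreal (unit_ball_vol n * (R ^ CARD('n) * exp (- n * T)))
      \<le> ennreal (unit_ball_vol n * (R * exp (1 - T)) ^ CARD('n) - unit_ball_vol n * (R * exp (-T)) ^ CARD('n))"
      by (intro ennreal_leI) (simp add: right_diff_distrib)
    also have "\<dots> = emeasure lborel (cball 0 (R * exp (1 - T)) :: (real^'n) set) - emeasure lborel (ball 0 (R * exp (- T)) :: (real^'n) set)"
      using R n by (simp add: emeasure_cball emeasure_ball n_def ennreal_minus)
    also have "\<dots> = emeasure lborel A" unfolding A_def
    proof (rule emeasure_Diff[symmetric])
      have "R * exp (- T) \<le> R * exp (1 - T)" using R by simp
      then show "ball 0 (R * exp (- T)) \<subseteq> (cball 0 (R * exp (1 - T)) :: (real^'n) set)" by auto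
    qed (use emeasure_ball[of "R * exp (-T)" "0::real^'n"] R in auto)
    finally show ?thesis .
  qed
  have "unit_ball_vol n * R ^ CARD('n) * exp ((c * m powr p - n) * T) = exp (c * (m powr p * T)) * (unit_ball_vol n * (R ^ CARD('n) * exp (- n * T)))"
    by (simp add: exp_add[symmetric] algebra_simps)
  then have "ennreal (unit_ball_vol n * R ^ CARD('n) * exp ((c * m powr p - n) * T)) =
     ennreal (exp (c * (m powr p * T))) * ennreal (unit_ball_vol n * (R ^ CARD('n) * exp (- n * T)))"
    by (simp only: ennreal_mult' exp_ge_zero)
  also have "\<dots> \<le> ennreal (exp (c * (m powr p * T))) * emeasure lborel A"
    using vol by (rule mult_left_mono) simp
  also have "\<dots> = (\<integral>\<^sup>+x. ennreal (exp (c * (m powr p * T))) * indicator A x \<partial>lborel)"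
    by (simp add: nn_integral_cmult_indicator)
  also have "\<dots> \<le> (\<integral>\<^sup>+x. ennreal (exp (c * (\<bar>trial R L \<epsilon> x\<bar> / E2 (norm x / R) powr \<beta>) powr p)) * indicator \<Omega> x \<partial>lborel)"
    by (rule nn_integral_mono) (rule pw)
  also have "\<dots> = exp_integral c \<beta> (trial R L \<epsilon>) \<Omega> R"
    unfolding exp_integral_def p_def n_def by (rule nn_integral_lebesgue_on_eq_lborel[OF \<Omega>L, symmetric])
  finally show ?thesis unfolding m_def p_def T_def .
qed


section \<open>The two ranges of the exponent\<close>

text \<open>The parameter \<open>L\<close> is chosen so large that the trial function is supported in \<open>\<Omega>\<close> and that the factor of \<open>exp (2L)\<close> in
  the lower bound is at least one.\<close>

lemma exp_integral_unbounded:
  fixes \<Omega> :: "(real^'n) set"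
  assumes n2: "CARD('n) \<ge> 2" and \<Omega>: "open \<Omega>" "bounded \<Omega>" "0 \<in> \<Omega>" and R: "R \<ge> R_dom \<Omega>"
    and \<beta>: "\<beta> < 1 / real CARD('n)" and c: "c > 0"
  shows "(SUP u \<in> admissible \<Omega> R. exp_integral c \<beta> u \<Omega> R) = \<infinity>"
proof -
  define n where "n = real CARD('n)"
  have n: "n \<ge> 2" using n2 by (simp add: n_def)
  have ball: "\<Omega> \<subseteq> ball 0 R" by (rule domain_subset_ball[OF \<Omega>(1,2) R])
  then have "0 \<in> ball (0::real^'n) R" using \<Omega>(3) by blast
  then have R0: "R > 0" by simp
  obtain r where r: "r > 0" "cball 0 r \<subseteq> \<Omega>" using \<Omega>(1,3) open_contains_cball by blast
  obtain \<epsilon> where e: "\<epsilon> > 0" "\<And>R L (\<Omega> :: (real^'n) set). R > 0 \<Longrightarrow> L \<ge> 1 \<Longrightarrow> open \<Omega> \<Longrightarrow>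
     \<Omega> \<subseteq> ball 0 R \<Longrightarrow> cball 0 (trial_radius R L) \<subseteq> \<Omega> \<Longrightarrow> trial R L \<epsilon> \<in> admissible \<Omega> R"
    by (rule trial_admissible[OF n2]) blast
  define b where "b = max \<beta> 0"
  define \<delta> where "\<delta> = 1/n - b"
  define p where "p = n/(n-1)"
  define m where "m = \<epsilon> * exp (-3) * 3 powr (-b)"
  define v where "v = unit_ball_vol n * R ^ CARD('n)"
  have d0: "\<delta> > 0" using \<beta> n by (auto simp: \<delta>_def b_def n_def)
  have p0: "p > 0" using n by (simp add: p_def)
  have m0: "m > 0" using e by (simp add: m_def)
  have v0: "v > 0" using R0 n by (simp add: v_def)
  have "ennreal M \<le> (SUP u \<in> admissible \<Omega> R. exp_integral c \<beta> u \<Omega> R)" if M: "M > 0" for M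
  proof -
    \<comment> \<open>\<open>L0\<close> solves \<open>c (m L^\<delta>)^p = n + 1\<close>; the other terms of the maximum handle the support and the target \<open>M\<close>\<close>
    define L0 where "L0 = ((((n + 1)/c) powr (1/p)) / m) powr (1/\<delta>)"
    define L where "L = max (max 2 L0) (max (ln (R / r)) (ln (M / v)))"
    have L: "2 \<le> L" "L0 \<le> L" "ln (R / r) \<le> L" "ln (M / v) \<le> L" by (auto simp: L_def)
    have "L0 powr \<delta> \<le> L powr \<delta>" using L d0 by (intro powr_mono2) (auto simp: L0_def)
    then have "((n + 1)/c) powr (1/p) / m \<le> L powr \<delta>"
      using d0 m0 by (simp add: L0_def powr_powr)
    then have "((n + 1)/c) powr (1/p) \<le> m * L powr \<delta>" using m0 by (simp add: divide_le_eq mult.commute)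
    then have "(((n + 1)/c) powr (1/p)) powr p \<le> (m * L powr \<delta>) powr p" using p0 by (intro powr_mono2) auto
    then have "(n + 1)/c \<le> (m * L powr \<delta>) powr p" using p0 c n by (simp add: powr_powr)
    then have big: "n + 1 \<le> c * (m * L powr \<delta>) powr p" using c by (simp add: divide_le_eq mult.commute)
    have "cball 0 (trial_radius R L) \<subseteq> \<Omega>"
    proof -
      have "1 - exp L \<le> - L" using exp_ge_add_one_self[of L] by linarith
      then have "trial_radius R L \<le> R * exp (- L)" using R0 by (simp add: trial_radius_def)
      also have "\<dots> \<le> r"
      proof -
        have "R / r \<le> exp L" using L(3) R0 r(1) by (subst (asm) exp_le_cancel_iff[symmetric]) simp
        then show ?thesis using r(1) by (simp add: exp_minus field_simps)
      qed
      finally show ?thesis using r(2) by (meson dual_order.trans subset_cball)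
    qed
    note sub = this
    have "M / v \<le> exp L" using L(4) M v0 by (subst (asm) exp_le_cancel_iff[symmetric]) simp
    then have "M \<le> v * exp L" using v0 by (simp add: divide_le_eq mult.commute)
    also have "\<dots> \<le> v * exp (2*L)" using v0 L(1) by simp
    also have "\<dots> \<le> v * exp (1 * exp (2*L))"
    proof -
      have "2 * L \<le> exp (2*L)" using exp_ge_add_one_self[of "2*L"] by linarith
      then show ?thesis using v0 by simp
    qed
    also have "\<dots> \<le> v * exp ((c * (m * L powr \<delta>) powr p - n) * exp (2*L))"
      using v0 big by (intro mult_left_mono) (auto intro!: mult_right_mono)
    finally have "ennreal M \<le> ennreal (v * exp ((c * (m * L powr \<delta>) powr p - n) * exp (2*L)))"
      by (rule ennreal_leI)
    also have "\<dots> \<le> exp_integral c \<beta> (trial R L \<epsilon>) \<Omega> R"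
      unfolding v_def m_def \<delta>_def p_def n_def
      by (rule trial_exp_integral_ge[OF n2 R0 L(1) e(1) c \<Omega>(1) sub]) (simp_all add: b_def)
    also have "\<dots> \<le> (SUP u \<in> admissible \<Omega> R. exp_integral c \<beta> u \<Omega> R)"
      by (rule SUP_upper) (rule e(2)[OF R0 _ \<Omega>(1) ball sub], use L in simp)
    finally show ?thesis .
  qed
  note big = this
  show ?thesis
  proof (rule ccontr)
    assume "(SUP u \<in> admissible \<Omega> R. exp_integral c \<beta> u \<Omega> R) \<noteq> \<infinity>"
    then obtain s where s: "(SUP u \<in> admissible \<Omega> R. exp_integral c \<beta> u \<Omega> R) = ennreal s" "s \<ge> 0"
      by (cases "SUP u \<in> admissible \<Omega> R. exp_integral c \<beta> u \<Omega> R") auto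
    have "ennreal (s + 1) \<le> ennreal s" using big[of "s + 1"] s by simp
    then show False using s(2) by (simp add: ennreal_le_iff)
  qed
qed

text \<open>Away from the origin \<open>E2 \<ge> 1\<close>.  At the origin the conventions for division and \<open>ln\<close> give \<open>E2\<close> the
  value \<open>0\<close>, and both integrands are \<open>1\<close>.\<close>

lemma exp_integral_mono:
  fixes \<Omega> :: "(real^'n) set"
  assumes n2: "CARD('n) \<ge> 2" and \<Omega>: "\<Omega> \<subseteq> ball 0 R" and c: "0 < c" "c \<le> A" and \<beta>: "b \<le> \<beta>"
  shows "exp_integral c \<beta> u \<Omega> R \<le> exp_integral A b u \<Omega> R"
  unfolding exp_integral_def
proof (intro nn_integral_mono ennreal_leI)
  fix x assume "x \<in> space (lebesgue_on \<Omega>)"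
  then have x: "norm x < R" using \<Omega> by auto
  define q where "q = real CARD('n) / (real CARD('n) - 1)"
  have q: "q \<ge> 0" using n2 by (simp add: q_def)
  have "exp (c * (\<bar>u x\<bar> / E2 (norm x / R) powr \<beta>) powr q) \<le> exp (A * (\<bar>u x\<bar> / E2 (norm x / R) powr b) powr q)"
  proof (cases "x = 0")
    case True
    then show ?thesis by (simp add: E1_def E2_def)
  next
    case False
    then have E: "1 \<le> E2 (norm x / R)" using E2_ge_1[of "norm x" R] x by simp
    have "\<bar>u x\<bar> / E2 (norm x / R) powr \<beta> \<le> \<bar>u x\<bar> / E2 (norm x / R) powr b"
      using E \<beta> by (intro divide_left_mono powr_mono mult_pos_pos) auto
    then have "(\<bar>u x\<bar> / E2 (norm x / R) powr \<beta>) powr q \<le> (\<bar>u x\<bar> / E2 (norm x / R) powr b) powr q"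
      using q by (intro powr_mono2) auto
    then show ?thesis using c by (simp add: mult_mono)
  qed
  then show "exp (c * (\<bar>u x\<bar> / E2 (norm x / R) powr \<beta>) powr (real CARD('n) / (real CARD('n) - 1)))
     \<le> exp (A * (\<bar>u x\<bar> / E2 (norm x / R) powr b) powr (real CARD('n) / (real CARD('n) - 1)))"
    unfolding q_def .
qed

theorem theorem1p1:
  assumes "CARD('n::finite) \<ge> 2"
  shows "(\<exists>A>0. \<exists>B>0. \<forall>(\<Omega> :: (real^'n) set) R \<beta> c.
            domain \<Omega> \<longrightarrow> bounded \<Omega> \<longrightarrow> 0 \<in> \<Omega> \<longrightarrow> R \<ge> R_dom \<Omega> \<longrightarrow>
            \<beta> \<ge> 2 / real CARD('n) \<longrightarrow> 0 < c \<longrightarrow> c < A \<longrightarrow>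
              (\<forall>u \<in> W1_0 CARD('n) \<Omega>. I_fun u \<Omega> R \<le> 1 \<longrightarrow>
                 exp_integral c \<beta> u \<Omega> R \<le> ennreal B * emeasure lebesgue \<Omega>) \<and>
              (SUP u \<in> admissible \<Omega> R. exp_integral c \<beta> u \<Omega> R) < \<infinity>)
       \<and> (\<forall>(\<Omega> :: (real^'n) set) R \<beta> c.
            domain \<Omega> \<longrightarrow> bounded \<Omega> \<longrightarrow> 0 \<in> \<Omega> \<longrightarrow> R \<ge> R_dom \<Omega> \<longrightarrow>
            \<beta> < 1 / real CARD('n) \<longrightarrow> c > 0 \<longrightarrow>
              (SUP u \<in> admissible \<Omega> R. exp_integral c \<beta> u \<Omega> R) = \<infinity>)"
proof -
  obtain A B where AB: "A > 0" "B > 0"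
   "\<And>(\<Omega> :: (real^'n) set) R u. \<lbrakk>open \<Omega>; bounded \<Omega>; R \<ge> R_dom \<Omega>; u \<in> W1_0 CARD('n) \<Omega>; I_fun u \<Omega> R \<le> 1\<rbrakk> \<Longrightarrow>
     exp_integral A (2 / CARD('n)) u \<Omega> R \<le> ennreal B * emeasure lebesgue \<Omega>"
    unfolding exp_integral_def by (rule W1_0_exponential_bound[OF assms]) blast
  have bound: "exp_integral c \<beta> u \<Omega> R \<le> ennreal B * emeasure lebesgue \<Omega>"
    if \<Omega>: "domain \<Omega>" "bounded \<Omega>" and R: "R \<ge> R_dom \<Omega>" and \<beta>: "\<beta> \<ge> 2 / real CARD('n)" and c: "0 < c" "c < A"
      and u: "u \<in> W1_0 CARD('n) \<Omega>" "I_fun u \<Omega> R \<le> 1" for \<Omega> :: "(real^'n) set" and R \<beta> c u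
  proof -
    have op: "open \<Omega>" using \<Omega>(1) by (simp add: domain_def)
    have "exp_integral c \<beta> u \<Omega> R \<le> exp_integral A (2 / CARD('n)) u \<Omega> R"
      by (rule exp_integral_mono[OF assms domain_subset_ball[OF op \<Omega>(2) R]]) (use c \<beta> in auto)
    also have "\<dots> \<le> ennreal B * emeasure lebesgue \<Omega>" by (rule AB(3)[OF op \<Omega>(2) R u])
    finally show ?thesis .
  qed
  have sup: "(SUP u \<in> admissible \<Omega> R. exp_integral c \<beta> u \<Omega> R) < \<infinity>"
    if \<Omega>: "domain \<Omega>" "bounded \<Omega>" and R: "R \<ge> R_dom \<Omega>" and \<beta>: "\<beta> \<ge> 2 / real CARD('n)" and c: "0 < c" "c < A"
      for \<Omega> :: "(real^'n) set" and R \<beta> c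
  proof -
    have "emeasure lborel \<Omega> < \<infinity>" using emeasure_bounded_finite[OF \<Omega>(2)] .
    moreover have "\<Omega> \<in> sets borel" using \<Omega>(1) by (simp add: domain_def)
    ultimately have "ennreal B * emeasure lebesgue \<Omega> < \<infinity>"
      by (simp add: emeasure_completion ennreal_mult_less_top)
    moreover have "(SUP u \<in> admissible \<Omega> R. exp_integral c \<beta> u \<Omega> R) \<le> ennreal B * emeasure lebesgue \<Omega>"
      by (rule SUP_least) (rule bound[OF \<Omega> R \<beta> c], auto simp: admissible_def)
    ultimately show ?thesis by (rule le_less_trans[rotated])
  qed
  have unbounded: "(SUP u \<in> admissible \<Omega> R. exp_integral c \<beta> u \<Omega> R) = \<infinity>"
    if "domain \<Omega>" "bounded \<Omega>" "0 \<in> \<Omega>" "R \<ge> R_dom \<Omega>" "\<beta> < 1 / real CARD('n)" "c > 0"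
      for \<Omega> :: "(real^'n) set" and R \<beta> c
    using that by (intro exp_integral_unbounded[OF assms]) (auto simp: domain_def)
  show ?thesis
  proof (rule conjI)
    show "\<exists>A>0. \<exists>B>0. \<forall>(\<Omega> :: (real^'n) set) R \<beta> c.
            domain \<Omega> \<longrightarrow> bounded \<Omega> \<longrightarrow> 0 \<in> \<Omega> \<longrightarrow> R \<ge> R_dom \<Omega> \<longrightarrow>
            \<beta> \<ge> 2 / real CARD('n) \<longrightarrow> 0 < c \<longrightarrow> c < A \<longrightarrow>
              (\<forall>u \<in> W1_0 CARD('n) \<Omega>. I_fun u \<Omega> R \<le> 1 \<longrightarrow>
                 exp_integral c \<beta> u \<Omega> R \<le> ennreal B * emeasure lebesgue \<Omega>) \<and>
              (SUP u \<in> admissible \<Omega> R. exp_integral c \<beta> u \<Omega> R) < \<infinity>"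
      apply (rule exI[of _ A], rule conjI, rule AB(1), rule exI[of _ B], rule conjI, rule AB(2))
      apply (intro allI impI conjI ballI)
       apply (rule bound; assumption)
      apply (rule sup; assumption)
      done
  qed (intro allI impI, rule unbounded; assumption)
qed

end
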